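(* Let $\mathcal{F}$ be the free associative unital $K$-algebra on generators $\tau,\sigma_1,\dots,\sigma_{n-1}$, let $I\subset\mathcal{F}$ be the two-sided ideal generated by the defining relations of $H(m,1,n)$ (so $\mathcal{F}/I=H(m,1,n)$), and let $K[\mathcal{X}]$ be the free associative unital $K$-algebra on generators $\mathcal{X}_{\lambda^{(m)}}$, one for each standard $m$-tableau $X_{\lambda^{(m)}}$ of each shape $\lambda^{(m)}$, $\lambda^{(m)}$ ranging over all $m$-partitions of $n$. Consider the relations, for all standard $m$-tableaux $X_{\lambda^{(m)}}$ and all $i=1,\dots,n-1$, $$\Bigl(\sigma_i+\frac{(q-q^{-1})\,c(X_{\lambda^{(m)}}|i+1)}{c(X_{\lambda^{(m)}}|i)-c(X_{\lambda^{(m)}}|i+1)}\Bigr)\cdot\mathcal{X}_{\lambda^{(m)}}=\mathcal{X}_{\lambda^{(m)}}^{s_i}\cdot\Bigl(\sigma_i+\frac{(q-q^{-1})\,c(X_{\lambda^{(m)}}|i)}{c(X_{\lambda^{(m)}}|i+1)-c(X_{\lambda^{(m)}}|i)}\Bigr)$$ and $$\bigl(\tau-c(X_{\lambda^{(m)}}|1)\bigr)\cdot\mathcal{X}_{\lambda^{(m)}}=0 .$$ Equip $K[\mathcal{X}]\otimes\mathcal{F}$ with the associative algebra structure for which $x\mapsto x\otimes 1$ and $\phi\mapsto 1\otimes\phi$ are algebra embeddings, $(x\otimes1)(1\otimes\phi)=x\otimes\phi$, and the products $(1\otimes\phi)(x\otimes 1)$ are computed by using the relations above (extended by associativity) as rules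 to move the generators $\mathcal{X}$ to the left. Then the relations above are compatible with the defining relations of $H(m,1,n)$: for each defining relation $r\in\mathcal{F}$ of $H(m,1,n)$ and each standard $m$-tableau $X_{\lambda^{(m)}}$, the element $r\cdot\mathcal{X}_{\lambda^{(m)}}$ of $K[\mathcal{X}]\otimes\mathcal{F}$ is a linear combination of elements $\mathcal{X}_{\lambda^{(m)}}^{\pi}\otimes r'$ with $\pi\in S_n$ and $r'\in I$. Consequently the algebra structure on $K[\mathcal{X}]\otimes\mathcal{F}$ induces a structure of an associative algebra (denoted $\mathfrak{T}$) on the space $K[\mathcal{X}]\otimes H(m,1,n)$.
   Context: Parameters. Let $m,n\ge 1$. Either $K=\mathbb{C}(q,v_1,\dots,v_m)$ with $q,v_1,\dots,v_m$ indeterminates, or $K=\mathbb{C}$ and $q,v_1,\dots,v_m\in\mathbb{C}$, $q\neq0$, satisfy: $1+q^2+\dots+q^{2N}\neq0$ for all non-negative integers $N<n$; $q^{2i}v_j-v_k\neq0$ for all $i,j,k$ with $j\neq k$ and $-n<i<n$; $v_j\neq0$ for all $j=1,\dots,m$. Cyclotomic Hecke algebra. $H(m,1,n)$ is the associative unital $K$-algebra generated by $\tau,\sigma_1,\dots,\sigma_{n-1}$ with defining relations $\sigma_i\sigma_{i+1}\sigma_i=\sigma_{i+1}\sigma_i\sigma_{i+1}$; $\sigma_i\sigma_j=\sigma_j\sigma_i$ if $|i-j|>1$; $\tau\sigma_1\tau\sigma_1=\sigma_1\tau\sigma_1\tau$; $\tau\sigma_i=\sigma_i\tau$ for $i>1$;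 $\sigma_i^2=(q-q^{-1})\sigma_i+1$; $(\tau-v_1)\cdots(\tau-v_m)=0$. Tableaux. An $m$-partition of $n$ is an $m$-tuple $\lambda^{(m)}=(\lambda_1,\dots,\lambda_m)$ of partitions (Young diagrams) with $|\lambda_1|+\dots+|\lambda_m|=n$. Its $m$-nodes are the nodes of the diagrams together with the index $k$ of the diagram. The content of the $m$-node in row $r$ and column $s$ of the $k$-th diagram is $v_kq^{2(s-r)}$. A standard $m$-tableau of shape $\lambda^{(m)}$ is a bijective filling of the $m$-nodes with $1,\dots,n$ such that in every diagram the numbers increase along rows (to the right) and columns (downwards). $c(X_{\lambda^{(m)}}|i)$ denotes the content of the $m$-node carrying the number $i$ in $X_{\lambda^{(m)}}$. For $\pi\in S_n$, $X_{\lambda^{(m)}}^{\pi}$ is the $m$-tableau obtained by applying $\pi$ to the numbers in the $m$-nodes; $s_i$ is the transposition $(i,i+1)$. $\mathcal{X}_{\lambda^{(m)}}^{\pi}$ denotes the generator corresponding to $X_{\lambda^{(m)}}^{\pi}$ if this $m$-tableau is standard, and $\mathcal{X}_{\lambda^{(m)}}^{\pi}:=0$ otherwise.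
   Formalization: For K=C and q=±1 the coefficients are 0/0 when i and i+1 lie in the same diagram; there they are replaced by their limiting values, q/d with d the difference of s−r for the two nodes (opposite sign on the other side). Elsewhere the relations are as stated. *)

theory Defs
  imports
    Complex_Main
    "HOL-Library.Poly_Mapping"
    "HOL-Combinatorics.Transposition"
    "HOL-Combinatorics.Permutations"
    "HOL-Algebra.Module"
    "HOL-Algebra.QuotRing"
begin

section \<open>Associative algebras over a field\<close>

definition scalars :: "'k::field ring" where
  "scalars = \<lparr>carrier = UNIV, monoid.mult = (*), one = 1, ring.zero = 0, add = (+)\<rparr>"

text \<open>
  The locale \<open>algebra\<close> of \<^theory>\<open>HOL-Algebra.Module\<close> requires a commutative product.
\<close>

locale assoc_algebra = Module.module R A + A?: ring A for R (structure) and A (structure) +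
  assumes smult_mult_left:
    "\<lbrakk>c \<in> carrier R; x \<in> carrier A; y \<in> carrier A\<rbrakk> \<Longrightarrow> (c \<odot>\<^bsub>A\<^esub> x) \<otimes>\<^bsub>A\<^esub> y = c \<odot>\<^bsub>A\<^esub> (x \<otimes>\<^bsub>A\<^esub> y)"
    and smult_mult_right:
    "\<lbrakk>c \<in> carrier R; x \<in> carrier A; y \<in> carrier A\<rbrakk> \<Longrightarrow> x \<otimes>\<^bsub>A\<^esub> (c \<odot>\<^bsub>A\<^esub> y) = c \<odot>\<^bsub>A\<^esub> (x \<otimes>\<^bsub>A\<^esub> y)"

definition algebra_embedding ::
    "('k, 'a) module \<Rightarrow> ('k, 'b) module \<Rightarrow> ('a \<Rightarrow> 'b) \<Rightarrow> bool" where
  "algebra_embedding A B f \<longleftrightarrow>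
     f \<in> ring_hom A B \<and> (\<forall>c. \<forall>x\<in>carrier A. f (c \<odot>\<^bsub>A\<^esub> x) = c \<odot>\<^bsub>B\<^esub> f x) \<and>
     inj_on f (carrier A)"

definition linear_combinations :: "('k, 'a) module \<Rightarrow> 'a set \<Rightarrow> 'a set" where
  "linear_combinations A S =
     {(\<Oplus>\<^bsub>A\<^esub>j\<in>{..<N}. c j \<odot>\<^bsub>A\<^esub> s j) | (N::nat) c s. \<forall>j<N. s j \<in> S}"

definition quotient_algebra :: "('k, 'a) module \<Rightarrow> 'a set \<Rightarrow> ('k, 'a set) module" where
  "quotient_algebra A I =
     ring.extend (A Quot I) (module.fields (\<lambda>c S. \<Union>x\<in>S. I +>\<^bsub>A\<^esub> (c \<odot>\<^bsub>A\<^esub> x)))"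


section \<open>Free algebras\<close>

text \<open>
  Lists form the free monoid, so that \<open>'g list \<Rightarrow>\<^sub>0 'k\<close>, with the convolution product of
  \<^theory>\<open>HOL-Library.Poly_Mapping\<close>, is the free associative unital algebra on the
  elements of \<open>'g\<close>.
\<close>

instantiation list :: (type) monoid_add
begin

definition zero_list :: "'a list" where "zero_list = []"

definition plus_list :: "'a list \<Rightarrow> 'a list \<Rightarrow> 'a list" where "plus_list = (@)"

instance
  by standard (simp_all add: zero_list_def plus_list_def)

end

definition free_algebra :: "'g set \<Rightarrow> ('k::field, 'g list \<Rightarrow>\<^sub>0 'k) module" where
  "free_algebra G =
     \<lparr>carrier = {p. Poly_Mapping.keys p \<subseteq> lists G},
      monoid.mult = (*), one = 1, ring.zero = 0, add = (+),
      smult = (\<lambda>c. Poly_Mapping.map ((*) c))\<rparr>"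

definition gen :: "'g \<Rightarrow> 'g list \<Rightarrow>\<^sub>0 'k::field" where
  "gen g = Poly_Mapping.single [g] 1"

definition const :: "'k::field \<Rightarrow> 'g list \<Rightarrow>\<^sub>0 'k" where
  "const c = Poly_Mapping.single [] c"

text \<open>
  Since the words in \<open>G\<close> are a basis of the free algebra on \<open>G\<close>, its tensor product with an
  algebra \<open>W\<close> is, as a vector space, the space of finitely supported functions from these words
  to \<open>W\<close>; the pure tensor of \<open>x\<close> and \<open>w\<close> sends a word to its coefficient in \<open>x\<close> times \<open>w\<close>.
  The argument \<open>mul\<close> of \<open>tensor_algebra\<close> is an arbitrary candidate for a product on this space.
\<close>

definition pure_tensor ::
    "('k::field, 'w) module \<Rightarrow> ('g list \<Rightarrow>\<^sub>0 'k) \<Rightarrow> 'w \<Rightarrow> 'g list \<Rightarrow> 'w" where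
  "pure_tensor W x w = (\<lambda>u. Poly_Mapping.lookup x u \<odot>\<^bsub>W\<^esub> w)"

definition tensor_algebra ::
    "'g set \<Rightarrow> ('k::field, 'w) module \<Rightarrow>
     (('g list \<Rightarrow> 'w) \<Rightarrow> ('g list \<Rightarrow> 'w) \<Rightarrow> ('g list \<Rightarrow> 'w)) \<Rightarrow> ('k, 'g list \<Rightarrow> 'w) module" where
  "tensor_algebra G W mul =
     \<lparr>carrier = {f. (\<forall>u. f u \<in> carrier W) \<and> (\<forall>u. u \<notin> lists G \<longrightarrow> f u = \<zero>\<^bsub>W\<^esub>) \<and>
                    finite {u. f u \<noteq> \<zero>\<^bsub>W\<^esub>}},
      monoid.mult = mul,
      one = pure_tensor W 1 \<one>\<^bsub>W\<^esub>,
      ring.zero = (\<lambda>u. \<zero>\<^bsub>W\<^esub>),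
      add = (\<lambda>f g u. f u \<oplus>\<^bsub>W\<^esub> g u),
      smult = (\<lambda>c f u. c \<odot>\<^bsub>W\<^esub> f u)\<rparr>"


section \<open>Parameters\<close>

definition monomial_value :: "(nat \<Rightarrow> 'k::field) \<Rightarrow> (nat \<Rightarrow>\<^sub>0 nat) \<Rightarrow> 'k" where
  "monomial_value x \<mu> = (\<Prod>i\<in>Poly_Mapping.keys \<mu>. x i ^ Poly_Mapping.lookup \<mu> i)"

definition poly_value ::
    "(complex \<Rightarrow> 'k::field) \<Rightarrow> (nat \<Rightarrow> 'k) \<Rightarrow> ((nat \<Rightarrow>\<^sub>0 nat) \<Rightarrow>\<^sub>0 complex) \<Rightarrow> 'k" where
  "poly_value h x p =
     (\<Sum>\<mu>\<in>Poly_Mapping.keys p. h (Poly_Mapping.lookup p \<mu>) * monomial_value x \<mu>)"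

definition polys_upto :: "nat \<Rightarrow> ((nat \<Rightarrow>\<^sub>0 nat) \<Rightarrow>\<^sub>0 complex) set" where
  "polys_upto m = {p. \<forall>\<mu>\<in>Poly_Mapping.keys p. Poly_Mapping.keys \<mu> \<subseteq> {0..m}}"

text \<open>
  The field \<open>'k\<close> is the field of rational functions over the complex numbers in the
  indeterminates \<open>q, v 1, \<dots>, v m\<close>: these are algebraically independent and generate the field.
\<close>

definition rational_function_field :: "nat \<Rightarrow> 'k::field \<Rightarrow> (nat \<Rightarrow> 'k) \<Rightarrow> bool" where
  "rational_function_field m q v \<longleftrightarrow>
     (\<exists>h. h \<in> ring_hom (scalars :: complex ring) (scalars :: 'k ring) \<and>
        (\<forall>p\<in>polys_upto m. poly_value h (v(0 := q)) p = 0 \<longrightarrow> p = 0) \<and>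
        (\<forall>z. \<exists>a\<in>polys_upto m. \<exists>b\<in>polys_upto m.
           poly_value h (v(0 := q)) b \<noteq> 0 \<and>
           z = poly_value h (v(0 := q)) a / poly_value h (v(0 := q)) b))"

definition admissible_values :: "nat \<Rightarrow> nat \<Rightarrow> 'k::field \<Rightarrow> (nat \<Rightarrow> 'k) \<Rightarrow> bool" where
  "admissible_values m n q v \<longleftrightarrow>
     q \<noteq> 0 \<and>
     (\<forall>N<n. (\<Sum>i\<le>N. q ^ (2 * i)) \<noteq> 0) \<and>
     (\<forall>j\<in>{1..m}. \<forall>k\<in>{1..m}. \<forall>i::int.
        j \<noteq> k \<longrightarrow> - int n < i \<longrightarrow> i < int n \<longrightarrow> q powi (2 * i) * v j - v k \<noteq> 0) \<and>
     (\<forall>j\<in>{1..m}. v j \<noteq> 0)"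

definition admissible_parameters :: "nat \<Rightarrow> nat \<Rightarrow> 'k::field \<Rightarrow> (nat \<Rightarrow> 'k) \<Rightarrow> bool" where
  "admissible_parameters m n q v \<longleftrightarrow>
     rational_function_field m q v \<or>
     ((scalars :: complex ring) \<simeq> (scalars :: 'k ring) \<and> admissible_values m n q v)"


section \<open>The cyclotomic Hecke algebra\<close>

datatype hecke_gen = Tau | Sigma nat

definition hecke_gens :: "nat \<Rightarrow> hecke_gen set" where
  "hecke_gens n = insert Tau (Sigma ` {1..n - 1})"

abbreviation \<tau> :: "hecke_gen list \<Rightarrow>\<^sub>0 'k::field" where
  "\<tau> \<equiv> gen Tau"

abbreviation \<sigma> :: "nat \<Rightarrow> hecke_gen list \<Rightarrow>\<^sub>0 'k::field" where
  "\<sigma> i \<equiv> gen (Sigma i)"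

definition hecke_relations ::
    "nat \<Rightarrow> nat \<Rightarrow> 'k::field \<Rightarrow> (nat \<Rightarrow> 'k) \<Rightarrow> (hecke_gen list \<Rightarrow>\<^sub>0 'k) set" where
  "hecke_relations m n q v =
     {\<sigma> i * \<sigma> (i + 1) * \<sigma> i - \<sigma> (i + 1) * \<sigma> i * \<sigma> (i + 1) | i.
        i \<in> {1..n - 1} \<and> i + 1 \<in> {1..n - 1}} \<union>
     {\<sigma> i * \<sigma> j - \<sigma> j * \<sigma> i | i j.
        i \<in> {1..n - 1} \<and> j \<in> {1..n - 1} \<and> \<bar>int i - int j\<bar> > 1} \<union>
     (if n \<ge> 2 then {\<tau> * \<sigma> 1 * \<tau> * \<sigma> 1 - \<sigma> 1 * \<tau> * \<sigma> 1 * \<tau>} else {}) \<union>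
     {\<tau> * \<sigma> i - \<sigma> i * \<tau> | i. i \<in> {1..n - 1} \<and> i > 1} \<union>
     {\<sigma> i * \<sigma> i - (const (q - inverse q) * \<sigma> i + 1) | i. i \<in> {1..n - 1}} \<union>
     {prod_list (map (\<lambda>j. \<tau> - const (v j)) [1..<m + 1])}"

abbreviation hecke_free_algebra :: "nat \<Rightarrow> ('k::field, hecke_gen list \<Rightarrow>\<^sub>0 'k) module" where
  "hecke_free_algebra n \<equiv> free_algebra (hecke_gens n)"

definition hecke_ideal ::
    "nat \<Rightarrow> nat \<Rightarrow> 'k::field \<Rightarrow> (nat \<Rightarrow> 'k) \<Rightarrow> (hecke_gen list \<Rightarrow>\<^sub>0 'k) set" where
  "hecke_ideal m n q v = genideal (hecke_free_algebra n) (hecke_relations m n q v)"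

definition hecke_algebra ::
    "nat \<Rightarrow> nat \<Rightarrow> 'k::field \<Rightarrow> (nat \<Rightarrow> 'k) \<Rightarrow> ('k, (hecke_gen list \<Rightarrow>\<^sub>0 'k) set) module" where
  "hecke_algebra m n q v = quotient_algebra (hecke_free_algebra n) (hecke_ideal m n q v)"


section \<open>Standard tableaux\<close>

text \<open>A partition is the list of its row lengths; an \<open>m\<close>-partition is a list of partitions.\<close>

definition is_partition :: "nat list \<Rightarrow> bool" where
  "is_partition p \<longleftrightarrow> sorted_wrt (\<ge>) p \<and> 0 \<notin> set p"

definition multipartitions :: "nat \<Rightarrow> nat \<Rightarrow> nat list list set" where
  "multipartitions m n =
     {\<Lambda>. length \<Lambda> = m \<and> (\<forall>p\<in>set \<Lambda>. is_partition p) \<and> (\<Sum>p\<leftarrow>\<Lambda>. sum_list p) = n}"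

text \<open>The node \<open>(k, r, s)\<close> lies in row \<open>r\<close> and column \<open>s\<close> of the \<open>k\<close>-th diagram, all counted from 1.\<close>

type_synonym node = "nat \<times> nat \<times> nat"

definition nodes :: "nat list list \<Rightarrow> node set" where
  "nodes \<Lambda> = {(k, r, s). k \<in> {1..length \<Lambda>} \<and> r \<in> {1..length (\<Lambda> ! (k - 1))} \<and>
                        s \<in> {1..\<Lambda> ! (k - 1) ! (r - 1)}}"

text \<open>A tableau is a partial map from nodes to numbers; its domain determines the shape.\<close>

type_synonym tableau = "node \<rightharpoonup> nat"

definition standard_tableaux_of_shape :: "nat \<Rightarrow> nat list list \<Rightarrow> tableau set" where
  "standard_tableaux_of_shape n \<Lambda> =
     {X. dom X = nodes \<Lambda> \<and> bij_betw (\<lambda>a. the (X a)) (nodes \<Lambda>) {1..n} \<and>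
         (\<forall>k r s s'. (k, r, s) \<in> nodes \<Lambda> \<longrightarrow> (k, r, s') \<in> nodes \<Lambda> \<longrightarrow> s < s' \<longrightarrow>
            the (X (k, r, s)) < the (X (k, r, s'))) \<and>
         (\<forall>k r r' s. (k, r, s) \<in> nodes \<Lambda> \<longrightarrow> (k, r', s) \<in> nodes \<Lambda> \<longrightarrow> r < r' \<longrightarrow>
            the (X (k, r, s)) < the (X (k, r', s)))}"

definition standard_tableaux :: "nat \<Rightarrow> nat \<Rightarrow> tableau set" where
  "standard_tableaux m n = (\<Union>\<Lambda>\<in>multipartitions m n. standard_tableaux_of_shape n \<Lambda>)"

definition permute_tableau :: "(nat \<Rightarrow> nat) \<Rightarrow> tableau \<Rightarrow> tableau" where
  "permute_tableau \<pi> X = map_option \<pi> \<circ> X"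

definition tableau_gen :: "nat \<Rightarrow> nat \<Rightarrow> tableau \<Rightarrow> tableau list \<Rightarrow>\<^sub>0 'k::field" where
  "tableau_gen m n X = (if X \<in> standard_tableaux m n then gen X else 0)"

definition node_of :: "tableau \<Rightarrow> nat \<Rightarrow> node" where
  "node_of X i = (THE a. X a = Some i)"

definition diagonal :: "tableau \<Rightarrow> nat \<Rightarrow> int" where
  "diagonal X i = (case node_of X i of (k, r, s) \<Rightarrow> int s - int r)"

definition content :: "'k::field \<Rightarrow> (nat \<Rightarrow> 'k) \<Rightarrow> tableau \<Rightarrow> nat \<Rightarrow> 'k" where
  "content q v X i = (case node_of X i of (k, r, s) \<Rightarrow> v k * q powi (2 * (int s - int r)))"


section \<open>The product on the tensor product\<close>

text \<open>
  For standard tableaux and \<open>j = i \<plusminus> 1\<close>, the contents of \<open>i\<close> and \<open>j\<close> coincide only if \<open>q\<^sup>2 = 1\<close>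
  and the two nodes are in the same diagram (on different diagonals).  There the fraction of the
  first case reads \<open>0 / 0\<close>; for nodes in the same diagram it is
  \<open>(q - q\<^sup>-\<^sup>1) / (q\<^bsup>2d\<^esup> - 1)\<close>, where \<open>d\<close> is the difference of the diagonals, and its
  singularity at \<open>q\<^sup>2 = 1\<close> is removable with value \<open>q / d\<close>.
\<close>

definition exchange_coeff :: "'k::field \<Rightarrow> (nat \<Rightarrow> 'k) \<Rightarrow> tableau \<Rightarrow> nat \<Rightarrow> nat \<Rightarrow> 'k" where
  "exchange_coeff q v X i j =
     (if content q v X i \<noteq> content q v X j
      then (q - inverse q) * content q v X j / (content q v X i - content q v X j)
      else q / of_int (diagonal X i - diagonal X j))"

type_synonym 'k smash = "tableau list \<Rightarrow> hecke_gen list \<Rightarrow>\<^sub>0 'k"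

abbreviation smash_algebra ::
    "nat \<Rightarrow> nat \<Rightarrow> ('k::field smash \<Rightarrow> 'k smash \<Rightarrow> 'k smash) \<Rightarrow> ('k, 'k smash) module" where
  "smash_algebra m n mul \<equiv> tensor_algebra (standard_tableaux m n) (hecke_free_algebra n) mul"

abbreviation smash_tensor ::
    "nat \<Rightarrow> (tableau list \<Rightarrow>\<^sub>0 'k::field) \<Rightarrow> (hecke_gen list \<Rightarrow>\<^sub>0 'k) \<Rightarrow> 'k smash" where
  "smash_tensor n x \<phi> \<equiv> pure_tensor (hecke_free_algebra n) x \<phi>"

definition smash_product ::
    "nat \<Rightarrow> nat \<Rightarrow> 'k::field \<Rightarrow> (nat \<Rightarrow> 'k) \<Rightarrow> ('k smash \<Rightarrow> 'k smash \<Rightarrow> 'k smash) \<Rightarrow> bool" where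
  "smash_product m n q v mul \<longleftrightarrow>
     assoc_algebra (scalars :: 'k ring) (smash_algebra m n mul) \<and>
     algebra_embedding (free_algebra (standard_tableaux m n)) (smash_algebra m n mul)
       (\<lambda>x. smash_tensor n x 1) \<and>
     algebra_embedding (hecke_free_algebra n) (smash_algebra m n mul)
       (\<lambda>\<phi>. smash_tensor n 1 \<phi>) \<and>
     (\<forall>x\<in>carrier (free_algebra (standard_tableaux m n)). \<forall>\<phi>\<in>carrier (hecke_free_algebra n).
        mul (smash_tensor n x 1) (smash_tensor n 1 \<phi>) = smash_tensor n x \<phi>) \<and>
     (\<forall>X\<in>standard_tableaux m n. \<forall>i\<in>{1..n - 1}.
        mul (smash_tensor n 1 (\<sigma> i + const (exchange_coeff q v X i (i + 1))))
            (smash_tensor n (tableau_gen m n X) 1) =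
        mul (smash_tensor n (tableau_gen m n (permute_tableau (transpose i (i + 1)) X)) 1)
            (smash_tensor n 1 (\<sigma> i + const (exchange_coeff q v X (i + 1) i)))) \<and>
     (\<forall>X\<in>standard_tableaux m n.
        mul (smash_tensor n 1 (\<tau> - const (content q v X 1)))
            (smash_tensor n (tableau_gen m n X) 1) =
        \<zero>\<^bsub>smash_algebra m n mul\<^esub>)"

text \<open>
  The class of a tensor in the tensor product with the Hecke algebra: the identity tensored with
  the canonical projection.
\<close>

definition smash_projection ::
    "nat \<Rightarrow> nat \<Rightarrow> 'k::field \<Rightarrow> (nat \<Rightarrow> 'k) \<Rightarrow> 'k smash \<Rightarrow>
     tableau list \<Rightarrow> (hecke_gen list \<Rightarrow>\<^sub>0 'k) set" where
  "smash_projection m n q v f =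
     (\<lambda>u. hecke_ideal m n q v +>\<^bsub>hecke_free_algebra n :: ('k, _) module\<^esub> f u)"

end

theory Submission
  imports Defs
begin

text \<open>
  A tensor is a function \<open>f\<close> from words in tableaux to the free algebra \<open>F\<close>.  The exchange
  relations say how left multiplication by a generator acts on such functions, and this action
  can be computed by recursion on the word at which the result is evaluated.  It extends to an
  action of \<open>F\<close>, and splitting words gives the product; associativity reduces to the
  statement that left multiplication by a generator commutes with right multiplication.

  Let \<open>I\<close> be the ideal of the Hecke relations.  For a relation \<open>r\<close>, the value of \<open>r \<cdot> f\<close> at a word
  \<open>Y w\<close> is a combination of values at \<open>w\<close> of \<open>r' \<cdot> f'\<close> with \<open>r'\<close> a relation, so that it lies in \<open>I\<close> by
  induction on the word.  With \<open>d = q - q\<^sup>-\<^sup>1\<close>, \<open>x\<^sub>a\<close> the content of a node and \<open>e\<^sub>a\<^sub>b\<close> the exchange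
  coefficient of two nodes, this needs only \<open>e\<^sub>a\<^sub>b + e\<^sub>b\<^sub>a = - d\<close>, \<open>x\<^sub>a e\<^sub>a\<^sub>b + x\<^sub>b e\<^sub>b\<^sub>a = 0\<close> and
  \<open>e\<^sub>a\<^sub>b e\<^sub>b\<^sub>c = e\<^sub>a\<^sub>c (e\<^sub>a\<^sub>b + e\<^sub>b\<^sub>c + d)\<close>, together with \<open>e\<^sub>a\<^sub>b\<^sup>2 + d e\<^sub>a\<^sub>b = 1\<close> if \<open>a\<close> and \<open>b\<close> are adjacent
  nodes, that is, if exchanging their numbers destroys standardness.
  These identities also hold for the limiting values of the coefficients at \<open>q\<^sup>2 = 1\<close>.
\<close>

section \<open>Free algebras\<close>

text \<open>The delicate point is that an exchange is dropped when it destroys standardness. On such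
  a letter \<open>\<sigma> i\<close> acts by a scalar, minus the exchange coefficient, and never
  reaches the rest of the word; so this scalar must itself be a root of the quadratic relation,
  which adjacency of the two nodes guarantees. A factor 0 or 1 treats dropped and performed
  exchanges by one formula.

  The braid relation does not reproduce itself alone: if the middle generator stays in place, the
  outer two meet as a square, which leaves quadratic relations for the shorter word. Hence one
  induction covers all relations. A generator \<open>\<tau>\<close> never passes a letter, and the
  relations containing it leave no remainder on nonempty words.

  The theorem speaks of every product satisfying the rules; the recursion supplies one, and
  uniqueness carries its properties over to the others. Passing to the quotient is asymmetric: ideal
  values in the right factor need only a left ideal, whereas those in the left factor have to cross
  the letters of the right factor, which is what compatibility permits.\<close>

lemma poly_mapping_keys_induct [consumes 1, case_names zero single add]:
  fixes p :: "'a \<Rightarrow>\<^sub>0 'b::comm_monoid_add"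
  assumes "Poly_Mapping.keys p \<subseteq> S"
    and zero: "P 0"
    and single: "\<And>k c. k \<in> S \<Longrightarrow> P (Poly_Mapping.single k c)"
    and add: "\<And>p p'. Poly_Mapping.keys p \<subseteq> S \<Longrightarrow> Poly_Mapping.keys p' \<subseteq> S \<Longrightarrow>
                P p \<Longrightarrow> P p' \<Longrightarrow> P (p + p')"
  shows "P p"
  using assms(1)
proof (induction p rule: update_induct)
  case const
  show ?case by (rule zero)
next
  case (update p a b)
  have eq: "Poly_Mapping.update a b p = p + Poly_Mapping.single a b"
    using update.hyps(1) by (intro poly_mapping_eqI) (auto simp: lookup_update lookup_add lookup_single when_def in_keys_iff)
  have keys: "Poly_Mapping.keys p \<subseteq> S" "a \<in> S"
    using update by (auto simp: keys_update in_keys_iff lookup_update split: if_splits)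
  show ?case
    unfolding eq using keys update.IH by (intro add single) (auto simp: keys_def lookup_single when_def)
qed

lemmas poly_mapping_induct = poly_mapping_keys_induct [OF subset_UNIV, case_names zero single add]

lemma const_zero [simp]: "const 0 = 0"
  by (simp add: const_def)

lemma const_one [simp]: "const 1 = 1"
  by (simp add: const_def flip: zero_list_def)

lemma const_add: "const (c + d) = const c + const d"
  by (simp add: const_def single_add)

lemma const_minus: "const (- c) = - const c"
  by (simp add: const_def single_uminus)

lemma const_diff: "const (c - d) = const c - const d"
  by (simp add: const_def single_diff)

lemma const_mult: "const (c * d) = const c * const d"
  by (simp add: const_def mult_single plus_list_def)

lemma map_scale_eq_const_mult: "Poly_Mapping.map ((*) c) p = const c * p"
  by (simp add: mult_map_scale_conv_mult const_def zero_list_def)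

lemma lookup_const_mult [simp]: "Poly_Mapping.lookup (const c * p) w = c * Poly_Mapping.lookup p w"
  by (simp add: map.rep_eq when_def flip: map_scale_eq_const_mult)

lemma const_mult_single: "const c * Poly_Mapping.single w d = Poly_Mapping.single w (c * d)"
  by (simp add: const_def mult_single plus_list_def)

lemma const_commute: "p * const c = const c * (p :: 'g list \<Rightarrow>\<^sub>0 'k::field)"
  by (induction p rule: poly_mapping_induct)
    (simp_all add: const_def mult_single plus_list_def algebra_simps)

lemma const_left_commute: "p * (const c * r) = const c * (p * (r :: 'g list \<Rightarrow>\<^sub>0 'k::field))"
  by (simp add: const_commute flip: mult.assoc)

lemma const_const_left_commute:
  "const c * (const d * r) = const d * (const c * (r :: 'g list \<Rightarrow>\<^sub>0 'k::field))"
  by (rule const_left_commute)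

lemma single_Cons_eq_gen_mult:
  "Poly_Mapping.single (g # w) c = gen g * Poly_Mapping.single w (c :: 'k::field)"
  by (simp add: gen_def mult_single plus_list_def)

lemma keys_mult_lists:
  fixes p r :: "'g list \<Rightarrow>\<^sub>0 'k::field"
  assumes "Poly_Mapping.keys p \<subseteq> lists G" "Poly_Mapping.keys r \<subseteq> lists G"
  shows "Poly_Mapping.keys (p * r) \<subseteq> lists G"
  using keys_mult [of p r] assms by (fastforce simp: plus_list_def)

lemma keys_add_lists:
  assumes "Poly_Mapping.keys p \<subseteq> S" "Poly_Mapping.keys r \<subseteq> S"
  shows "Poly_Mapping.keys (p + r) \<subseteq> S"
  using keys_add [of p r] assms by blast

lemma keys_minus_lists:
  fixes p r :: "'g list \<Rightarrow>\<^sub>0 'k::field"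
  assumes "Poly_Mapping.keys p \<subseteq> S" "Poly_Mapping.keys r \<subseteq> S"
  shows "Poly_Mapping.keys (p - r) \<subseteq> S"
  using keys_diff [of p r] assms by blast

lemma keys_const_lists [simp]: "Poly_Mapping.keys (const c) \<subseteq> lists G"
  by (auto simp: const_def in_keys_iff lookup_single when_def split: if_splits)

lemma zero_in_lists [simp]: "0 \<in> lists G"
  by (simp add: zero_list_def)

lemma keys_gen [simp]: "Poly_Mapping.keys (gen g :: 'g list \<Rightarrow>\<^sub>0 'k::field) = {[g]}"
  by (simp add: gen_def)

section \<open>Scalars and free algebras as algebraic structures\<close>

lemma cring_scalars: "cring (scalars :: 'k::field ring)"
proof (rule cringI)
  show "abelian_group (scalars :: 'k ring)"
    by (rule abelian_groupI) (auto simp: scalars_def add.assoc add.commute intro: exI[of _ "- _"] left_minus)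
  show "comm_monoid (scalars :: 'k ring)"
    by (rule comm_monoidI) (auto simp: scalars_def ac_simps)
qed (auto simp: scalars_def algebra_simps)

lemma scalars_simps [simp]:
  "carrier scalars = UNIV" "x \<otimes>\<^bsub>scalars\<^esub> y = x * y" "\<one>\<^bsub>scalars\<^esub> = 1"
  "\<zero>\<^bsub>scalars\<^esub> = 0" "x \<oplus>\<^bsub>scalars\<^esub> y = x + y"
  by (simp_all add: scalars_def)

lemma free_algebra_simps [simp]:
  "p \<in> carrier (free_algebra G) \<longleftrightarrow> Poly_Mapping.keys p \<subseteq> lists G"
  "p \<otimes>\<^bsub>free_algebra G\<^esub> r = p * r" "\<one>\<^bsub>free_algebra G\<^esub> = 1"
  "\<zero>\<^bsub>free_algebra G\<^esub> = 0" "p \<oplus>\<^bsub>free_algebra G\<^esub> r = p + r"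
  "c \<odot>\<^bsub>free_algebra G\<^esub> p = const c * p"
  by (simp_all add: free_algebra_def map_scale_eq_const_mult)

lemma ring_free_algebra: "ring (free_algebra G :: ('k::field, 'g list \<Rightarrow>\<^sub>0 'k) module)"
proof (rule ringI)
  show "abelian_group (free_algebra G :: ('k, 'g list \<Rightarrow>\<^sub>0 'k) module)"
  proof (rule abelian_groupI)
    fix x :: "'g list \<Rightarrow>\<^sub>0 'k"
    assume "x \<in> carrier (free_algebra G)"
    then show "\<exists>y\<in>carrier (free_algebra G). y \<oplus>\<^bsub>free_algebra G\<^esub> x = \<zero>\<^bsub>free_algebra G\<^esub>"
      by (intro bexI [of _ "- x"]) (auto simp: keys_def)
  qed (auto simp: keys_add_lists ac_simps)
  show "Group.monoid (free_algebra G :: ('k, 'g list \<Rightarrow>\<^sub>0 'k) module)"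
    by (rule monoidI) (auto simp: keys_mult_lists mult.assoc)
qed (auto simp: algebra_simps)

section \<open>Exchange rules\<close>

text \<open>
  A generator \<open>g\<close> is moved to the right of a letter \<open>X\<close> by the rule
  \<open>g \<cdot> X = X' \<cdot> (A g X' g + B g X') + C g X \<cdot> X\<close>, where \<open>X' = s g X\<close> and \<open>X = s g X'\<close>.  A tensor being
  stored as the function of its coefficients, this is the following recursion on the word at
  which the product is evaluated; no finiteness of supports is needed.
\<close>

locale exchange_rules =
  fixes s :: "'g \<Rightarrow> 't \<Rightarrow> 't" and A B C :: "'g \<Rightarrow> 't \<Rightarrow> 'k::field"
begin

fun gen_act :: "'g \<Rightarrow> ('t list \<Rightarrow> 'g list \<Rightarrow>\<^sub>0 'k) \<Rightarrow> 't list \<Rightarrow> 'g list \<Rightarrow>\<^sub>0 'k" where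
  "gen_act g f [] = gen g * f []"
| "gen_act g f (Y # w) =
     const (A g Y) * gen_act g (\<lambda>u. f (s g Y # u)) w + const (B g Y) * f (s g Y # w) + const (C g Y) * f (Y # w)"

definition act :: "('g list \<Rightarrow>\<^sub>0 'k) \<Rightarrow> ('t list \<Rightarrow> 'g list \<Rightarrow>\<^sub>0 'k) \<Rightarrow> 't list \<Rightarrow> 'g list \<Rightarrow>\<^sub>0 'k" where
  "act \<phi> f w = (\<Sum>h\<in>Poly_Mapping.keys \<phi>. const (Poly_Mapping.lookup \<phi> h) * foldr gen_act h f w)"

text \<open>The word is cut into a prefix read by \<open>a\<close> and a suffix read by
  \<open>b\<close>. For each cut the coefficient found at the prefix has to cross the letters of the
  suffix, which is what \<open>act\<close> does. The recursion peels off the cut with empty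
  prefix.\<close>

fun smash :: "('t list \<Rightarrow> 'g list \<Rightarrow>\<^sub>0 'k) \<Rightarrow> ('t list \<Rightarrow> 'g list \<Rightarrow>\<^sub>0 'k) \<Rightarrow> 't list \<Rightarrow> 'g list \<Rightarrow>\<^sub>0 'k" where
  "smash a b [] = a [] * b []"
| "smash a b (Y # w) = act (a []) b (Y # w) + smash (\<lambda>u. a (Y # u)) b w"

lemma gen_act_add: "gen_act g (\<lambda>u. f u + f' u) w = gen_act g f w + gen_act g f' w"
proof (induction w arbitrary: f f')
  case (Cons Y w)
  show ?case by (simp add: Cons.IH distrib_left)
qed (simp add: distrib_left)

lemma gen_act_scale: "gen_act g (\<lambda>u. const c * f u) w = const c * gen_act g f w"
proof (induction g f w rule: gen_act.induct)
  case (2 g f Y w)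
  then show ?case by (simp add: distrib_left const_const_left_commute)
qed (simp add: const_left_commute [of "gen _"])

lemma gen_act_zero [simp]: "gen_act g (\<lambda>u. 0) w = 0"
  using gen_act_scale [of g 0 "\<lambda>_. 0" w] by simp

lemma foldr_gen_act_add:
  "foldr gen_act h (\<lambda>u. f u + f' u) w = foldr gen_act h f w + foldr gen_act h f' w"
proof (induction h arbitrary: w)
  case (Cons g h)
  have "foldr gen_act h (\<lambda>u. f u + f' u) = (\<lambda>u. foldr gen_act h f u + foldr gen_act h f' u)"
    using Cons.IH by auto
  then show ?case by (simp add: gen_act_add)
qed simp

lemma foldr_gen_act_scale:
  "foldr gen_act h (\<lambda>u. const c * f u) w = const c * foldr gen_act h f w"
proof (induction h arbitrary: w)
  case (Cons g h)
  have "foldr gen_act h (\<lambda>u. const c * f u) = (\<lambda>u. const c * foldr gen_act h f u)"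
    using Cons.IH by auto
  then show ?case by (simp add: gen_act_scale)
qed simp

lemma foldr_gen_act_Nil: "foldr gen_act h f [] = Poly_Mapping.single h 1 * f []"
proof (induction h)
  case Nil
  have "Poly_Mapping.single ([] :: 'g list) (1 :: 'k) = 1" by (simp flip: const_def)
  then show ?case by simp
qed (simp add: single_Cons_eq_gen_mult mult.assoc)

lemma act_superset:
  assumes "finite S" "Poly_Mapping.keys \<phi> \<subseteq> S"
  shows "act \<phi> f w = (\<Sum>h\<in>S. const (Poly_Mapping.lookup \<phi> h) * foldr gen_act h f w)"
  unfolding act_def using assms by (intro sum.mono_neutral_left) (auto simp: in_keys_iff)

lemma act_add_left: "act (\<phi> + \<psi>) f w = act \<phi> f w + act \<psi> f w"
proof -
  let ?S = "Poly_Mapping.keys \<phi> \<union> Poly_Mapping.keys \<psi>"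
  have "act \<theta> f w = (\<Sum>h\<in>?S. const (Poly_Mapping.lookup \<theta> h) * foldr gen_act h f w)"
    if "Poly_Mapping.keys \<theta> \<subseteq> ?S" for \<theta>
    using that by (intro act_superset) auto
  from this [of "\<phi> + \<psi>"] this [of \<phi>] this [of \<psi>] show ?thesis
    using keys_add [of \<phi> \<psi>] by (simp add: lookup_add const_add distrib_right sum.distrib)
qed

lemma act_single: "act (Poly_Mapping.single h c) f w = const c * foldr gen_act h f w"
  by (subst act_superset [of "{h}"]) (auto simp: in_keys_iff lookup_single when_def)

lemma act_zero_left [simp]: "act 0 f w = 0"
  by (simp add: act_def)

lemma act_const [simp]: "act (const c) f w = const c * f w"
  by (simp add: const_def [of c, where 'g = 'g] act_single)

lemma act_one [simp]: "act 1 f w = f w"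
  using act_const [of 1 f w] by simp

lemma act_gen [simp]: "act (gen g) f w = gen_act g f w"
  by (simp add: gen_def act_single)

lemma act_add_right: "act \<phi> (\<lambda>u. f u + f' u) w = act \<phi> f w + act \<phi> f' w"
  by (simp add: act_def foldr_gen_act_add distrib_left sum.distrib)

lemma act_scale_right: "act \<phi> (\<lambda>u. const c * f u) w = const c * act \<phi> f w"
  by (simp add: act_def foldr_gen_act_scale const_const_left_commute sum_distrib_left)

lemma act_zero_right [simp]: "act \<phi> (\<lambda>u. 0) w = 0"
  using act_scale_right [of \<phi> 0 "\<lambda>_. 0" w] by simp

lemma act_Nil [simp]: "act \<phi> f [] = \<phi> * f []"
  by (induction \<phi> rule: poly_mapping_induct)
    (simp_all add: act_single act_add_left foldr_gen_act_Nil distrib_right const_mult_single flip: mult.assoc)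

text \<open>For two basis words this is the splitting of \<open>foldr\<close> over a concatenation;
  bilinearity of the action extends it to the whole free algebra.\<close>

lemma act_mult: "act (\<phi> * \<psi>) f w = act \<phi> (act \<psi> f) w"
proof (induction \<phi> rule: poly_mapping_induct)
  case (single h c)
  show ?case
  proof (induction \<psi> rule: poly_mapping_induct)
    case zero
    have "act (0 :: 'g list \<Rightarrow>\<^sub>0 'k) f = (\<lambda>u. 0)" by auto
    then show ?case by simp
  next
    case (single h' c')
    have "act (Poly_Mapping.single h' c') f = (\<lambda>u. const c' * foldr gen_act h' f u)"
      by (auto simp: act_single)
    then show ?case
      by (simp add: mult_single act_single plus_list_def foldr_gen_act_scale const_mult mult.assoc)
  next
    case (add \<psi> \<psi>')
    have "act (\<psi> + \<psi>') f = (\<lambda>u. act \<psi> f u + act \<psi>' f u)"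
      by (auto simp: act_add_left)
    with add show ?case by (simp add: distrib_left act_add_left act_add_right)
  qed
qed (simp_all add: distrib_right act_add_left)

lemma act_diff_left: "act (\<phi> - \<psi>) f w = act \<phi> f w - act \<psi> f w"
  using act_add_left [of "\<phi> - \<psi>" \<psi> f w] by simp

lemma act_scale_left: "act (const c * \<phi>) f w = const c * act \<phi> f w"
  by (simp add: act_mult)

lemma smash_add_left: "smash (\<lambda>u. a u + a' u) b w = smash a b w + smash a' b w"
proof (induction w arbitrary: a a')
  case (Cons Y w)
  show ?case by (simp add: Cons.IH act_add_left)
qed (simp add: distrib_right)

lemma smash_scale_left: "smash (\<lambda>u. const c * a u) b w = const c * smash a b w"
  by (induction a b w rule: smash.induct) (simp_all add: mult.assoc distrib_left act_scale_left)

lemma smash_add_right: "smash a (\<lambda>u. b u + b' u) w = smash a b w + smash a b' w"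
  by (induction a b w rule: smash.induct) (simp_all add: distrib_left act_add_right)

lemma smash_scale_right: "smash a (\<lambda>u. const c * b u) w = const c * smash a b w"
proof (induction a b w rule: smash.induct)
  case (1 a b)
  show ?case unfolding smash.simps by (rule const_left_commute)
qed (simp add: distrib_left act_scale_right)

lemma smash_zero_left [simp]: "smash (\<lambda>u. 0) b w = 0"
  using smash_scale_left [of 0 "\<lambda>_. 0" b w] by simp

lemma smash_zero_right [simp]: "smash a (\<lambda>u. 0) w = 0"
  using smash_scale_right [of a 0 "\<lambda>_. 0" w] by simp

text \<open>The bimodule property behind associativity. Cut the word into a prefix for
  \<open>b\<close> and a suffix for \<open>c\<close>: if the prefix is nonempty, \<open>g\<close>
  meets the same first letter on both sides and the same rule applies; if it is empty,
  \<open>g\<close> is absorbed into the coefficient \<open>b []\<close> before anything is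
  moved.\<close>

lemma gen_act_smash: "gen_act g (smash b c) w = smash (gen_act g b) c w"
proof (induction w arbitrary: b)
  case Nil
  then show ?case by (simp add: mult.assoc)
next
  case (Cons Y w)
  let ?b' = "\<lambda>Z u. b (Z # u)"
  \<comment> \<open>Stated for every first letter \<open>Z\<close>, since the rule reads the product
    at \<open>Y\<close> and at \<open>s g Y\<close>.\<close>
  have cut: "(\<lambda>u. smash b c (Z # u)) = (\<lambda>u. act (b []) c (Z # u) + smash (?b' Z) c u)" for Z
    by simp
  have "gen_act g (smash b c) (Y # w) =
      gen_act g (act (b []) c) (Y # w)
      + (const (A g Y) * gen_act g (smash (?b' (s g Y)) c) w
         + const (B g Y) * smash (?b' (s g Y)) c w + const (C g Y) * smash (?b' Y) c w)"
    unfolding gen_act.simps cut gen_act_add smash.simps by (simp only: distrib_left ac_simps)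
  also have "gen_act g (act (b []) c) (Y # w) = act (gen_act g b []) c (Y # w)"
    by (simp only: act_mult act_gen gen_act.simps(1))
  also have "const (A g Y) * gen_act g (smash (?b' (s g Y)) c) w
         + const (B g Y) * smash (?b' (s g Y)) c w + const (C g Y) * smash (?b' Y) c w =
      smash (\<lambda>u. gen_act g b (Y # u)) c w"
    unfolding gen_act.simps smash_add_left smash_scale_left Cons.IH ..
  finally show ?case by (simp only: smash.simps)
qed

lemma act_smash: "act \<phi> (smash b c) w = smash (act \<phi> b) c w"
proof (induction \<phi> rule: poly_mapping_induct)
  case zero
  have "act (0 :: 'g list \<Rightarrow>\<^sub>0 'k) b = (\<lambda>u. 0)" by auto
  then show ?case by simp
next
  case (single h d)
  have *: "foldr gen_act h (smash b c) w = smash (foldr gen_act h b) c w" for w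
  proof (induction h arbitrary: w)
    case (Cons g h)
    then have "foldr gen_act h (smash b c) = smash (foldr gen_act h b) c" by auto
    then show ?case by (simp add: gen_act_smash)
  qed simp
  have "act (Poly_Mapping.single h d) b = (\<lambda>u. const d * foldr gen_act h b u)"
    by (auto simp: act_single)
  then show ?case by (simp add: act_single smash_scale_left *)
next
  case (add \<phi> \<psi>)
  have "act (\<phi> + \<psi>) b = (\<lambda>u. act \<phi> b u + act \<psi> b u)"
    by (auto simp: act_add_left)
  with add show ?case by (simp add: act_add_left smash_add_left)
qed

text \<open>The part of \<open>a\<close> at the empty word is handled by \<open>act_smash\<close>,
  the remaining part by the induction hypothesis for \<open>a\<close> with its first letter
  removed.\<close>

lemma smash_assoc: "smash (smash a b) c w = smash a (smash b c) w"
proof (induction w arbitrary: a)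
  case Nil
  then show ?case by (simp add: mult.assoc)
next
  case (Cons Y w)
  have "smash (smash a b) c (Y # w) = act (a [] * b []) c (Y # w)
      + smash (\<lambda>u. act (a []) b (Y # u)) c w + smash (smash (\<lambda>u. a (Y # u)) b) c w"
    by (simp add: smash_add_left)
  also have "act (a [] * b []) c (Y # w) + smash (\<lambda>u. act (a []) b (Y # u)) c w =
      smash (act (a []) b) c (Y # w)"
    by simp
  also have "\<dots> = act (a []) (smash b c) (Y # w)"
    by (simp add: act_smash)
  finally show ?case by (simp add: Cons.IH)
qed

end

section \<open>Standard tableaux\<close>

text \<open>The shape is read off as \<open>dom X\<close>, which exchanging numbers does not change.
  Monotonicity thereby becomes a property of a partial map alone and can be tested on tableaux not
  yet known to be standard.\<close>

definition increasing_tableau :: "tableau \<Rightarrow> bool" where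
  "increasing_tableau X \<longleftrightarrow>
     (\<forall>k r s s'. (k, r, s) \<in> dom X \<longrightarrow> (k, r, s') \<in> dom X \<longrightarrow> s < s' \<longrightarrow>
        the (X (k, r, s)) < the (X (k, r, s'))) \<and>
     (\<forall>k r r' s. (k, r, s) \<in> dom X \<longrightarrow> (k, r', s) \<in> dom X \<longrightarrow> r < r' \<longrightarrow>
        the (X (k, r, s)) < the (X (k, r', s)))"

lemma standard_tableaux_iff:
  "X \<in> standard_tableaux m n \<longleftrightarrow>
     dom X \<in> nodes ` multipartitions m n \<and> bij_betw (\<lambda>a. the (X a)) (dom X) {1..n} \<and> increasing_tableau X"
proof -
  have "X \<in> standard_tableaux_of_shape n \<Lambda> \<longleftrightarrow>
      dom X = nodes \<Lambda> \<and> bij_betw (\<lambda>a. the (X a)) (dom X) {1..n} \<and> increasing_tableau X" for \<Lambda>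
    unfolding standard_tableaux_of_shape_def increasing_tableau_def
    by (simp del: domIff cong: conj_cong)
  then show ?thesis
    unfolding standard_tableaux_def by blast
qed

lemma nodes_down_closed:
  assumes "\<Lambda> \<in> multipartitions m n" "(k, r, s) \<in> nodes \<Lambda>" "1 \<le> r'" "r' \<le> r" "1 \<le> s'" "s' \<le> s"
  shows "(k, r', s') \<in> nodes \<Lambda>"
proof -
  let ?p = "\<Lambda> ! (k - 1)"
  have k: "k \<in> {1..length \<Lambda>}" and r: "r \<in> {1..length ?p}" and s: "s \<in> {1..?p ! (r - 1)}"
    using assms(2) by (auto simp: nodes_def)
  have "?p \<in> set \<Lambda>"
    using k by (auto intro: nth_mem)
  then have "sorted_wrt (\<ge>) ?p"
    using assms(1) by (auto simp: multipartitions_def is_partition_def)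
  then have "?p ! (r - 1) \<le> ?p ! (r' - 1)" if "r' < r"
    using that r assms(3) by (intro sorted_wrt_nth_less [of "(\<ge>)"]) auto
  then have "?p ! (r - 1) \<le> ?p ! (r' - 1)"
    using assms(4) by (cases "r' = r") auto
  then show ?thesis
    using k r s assms(3-) by (auto simp: nodes_def)
qed

lemma nodes_component:
  assumes "\<Lambda> \<in> multipartitions m n" "(k, r, s) \<in> nodes \<Lambda>"
  shows "k \<in> {1..m}" "1 \<le> r" "1 \<le> s"
  using assms by (auto simp: nodes_def multipartitions_def)

text \<open>For nodes carrying consecutive numbers of a standard tableau this amounts to adjacency,
  as \<open>same_line_diagonal\<close> shows; the formulation by coordinates makes sense for
  arbitrary nodes.\<close>

definition same_line :: "node \<Rightarrow> node \<Rightarrow> bool" where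
  "same_line a b \<longleftrightarrow> fst a = fst b \<and> (fst (snd a) = fst (snd b) \<or> snd (snd a) = snd (snd b))"

lemma same_line_sym: "same_line a b \<longleftrightarrow> same_line b a"
  by (auto simp: same_line_def)

lemma permute_tableau_eq_Some_iff:
  "inj \<pi> \<Longrightarrow> permute_tableau \<pi> X a = Some (\<pi> i) \<longleftrightarrow> X a = Some i"
  by (auto simp: permute_tableau_def inj_def)

lemma node_of_permute: "inj \<pi> \<Longrightarrow> node_of (permute_tableau \<pi> X) (\<pi> i) = node_of X i"
  by (simp add: node_of_def permute_tableau_eq_Some_iff)

lemma node_of_permute_transpose [simp]:
  "node_of (permute_tableau (transpose i j) X) l = node_of X (transpose i j l)"
  using node_of_permute [of "transpose i j" X "transpose i j l"] by simp

lemma permute_permute_tableau: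
  "permute_tableau \<pi> (permute_tableau \<rho> X) = permute_tableau (\<pi> \<circ> \<rho>) X"
  by (auto simp: permute_tableau_def fun_eq_iff option.map_comp)

lemma permute_tableau_id [simp]: "permute_tableau id X = X"
  by (auto simp: permute_tableau_def fun_eq_iff option.map_id)

lemma dom_permute_tableau [simp]: "dom (permute_tableau \<pi> X) = dom X"
  by (auto simp: permute_tableau_def)

lemma the_permute_tableau: "a \<in> dom X \<Longrightarrow> the (permute_tableau \<pi> X a) = \<pi> (the (X a))"
  by (auto simp: permute_tableau_def)

section \<open>Geometry of a single standard tableau\<close>

context
  fixes m n :: nat and X :: tableau
  assumes X: "X \<in> standard_tableaux m n"
begin

lemma standard_bij: "bij_betw (\<lambda>a. the (X a)) (dom X) {1..n}"
  using X by (simp add: standard_tableaux_iff)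

lemma standard_increasing: "increasing_tableau X"
  using X by (simp add: standard_tableaux_iff)

lemma standard_row_less:
  assumes "X (k, r, s) = Some i" "X (k, r, s') = Some j"
  shows "s < s' \<longleftrightarrow> i < j"
proof -
  have "the (X (k, r, c)) < the (X (k, r, c'))"
    if "(k, r, c) \<in> dom X" "(k, r, c') \<in> dom X" "c < c'" for c c'
    using standard_increasing that unfolding increasing_tableau_def by blast
  from this [of s s'] this [of s' s] show ?thesis
    using assms by (cases s s' rule: linorder_cases) (auto simp: domIff)
qed

lemma standard_column_less:
  assumes "X (k, r, s) = Some i" "X (k, r', s) = Some j"
  shows "r < r' \<longleftrightarrow> i < j"
proof -
  have "the (X (k, c, s)) < the (X (k, c', s))"
    if "(k, c, s) \<in> dom X" "(k, c', s) \<in> dom X" "c < c'" for c c'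
    using standard_increasing that unfolding increasing_tableau_def by blast
  from this [of r r'] this [of r' r] show ?thesis
    using assms by (cases r r' rule: linorder_cases) (auto simp: domIff)
qed

lemma standard_inj: "X a = Some i \<Longrightarrow> X b = Some i \<Longrightarrow> a = b"
  by (rule inj_onD [OF bij_betw_imp_inj_on [OF standard_bij]]) auto

lemma standard_entry: "X a = Some i \<Longrightarrow> i \<in> {1..n}"
  using bij_betwE [OF standard_bij] by force

lemma node_of_eq: "X a = Some i \<Longrightarrow> node_of X i = a"
  unfolding node_of_def by (rule the_equality) (auto dest: standard_inj)

lemma X_node_of:
  assumes "i \<in> {1..n}"
  shows "X (node_of X i) = Some i"
proof -
  have "i \<in> (\<lambda>a. the (X a)) ` dom X"
    using assms bij_betw_imp_surj_on [OF standard_bij] by simp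
  then obtain a where "X a = Some i" by auto
  then show ?thesis using node_of_eq by simp
qed

lemma standard_shape: obtains \<Lambda> where "\<Lambda> \<in> multipartitions m n" "dom X = nodes \<Lambda>"
  using X by (auto simp: standard_tableaux_iff)

lemma standard_down_closed:
  assumes "(k, r, s) \<in> dom X" "1 \<le> r'" "r' \<le> r" "1 \<le> s'" "s' \<le> s"
  shows "(k, r', s') \<in> dom X"
proof -
  obtain \<Lambda> where \<Lambda>: "\<Lambda> \<in> multipartitions m n" "dom X = nodes \<Lambda>" by (rule standard_shape)
  show ?thesis using nodes_down_closed [OF \<Lambda>(1), of k r s r' s'] assms unfolding \<Lambda>(2) by simp
qed

lemma standard_component:
  assumes "(k, r, s) \<in> dom X"
  shows "k \<in> {1..m}" "1 \<le> r" "1 \<le> s"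
proof -
  obtain \<Lambda> where \<Lambda>: "\<Lambda> \<in> multipartitions m n" "dom X = nodes \<Lambda>" by (rule standard_shape)
  show "k \<in> {1..m}" "1 \<le> r" "1 \<le> s"
    using nodes_component [OF \<Lambda>(1), of k r s] assms unfolding \<Lambda>(2) by simp_all
qed

text \<open>The transposition reverses only the comparison of \<open>i\<close> with
  \<open>i + 1\<close>. Standardness compares numbers only within rows and columns, so it is lost
  exactly when these two numbers share a line.\<close>

lemma standard_permute_iff:
  assumes i: "i \<in> {1..n - 1}"
  shows "permute_tableau (transpose i (i + 1)) X \<in> standard_tableaux m n \<longleftrightarrow>
           \<not> same_line (node_of X i) (node_of X (i + 1))"
proof -
  let ?t = "transpose i (i + 1)" and ?Y = "permute_tableau (transpose i (i + 1)) X"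
  have "bij_betw ?t {1..n} {1..n}"
    using i by (intro permutes_imp_bij permutes_swap_id) auto
  then have "bij_betw (\<lambda>a. the (?Y a)) (dom X) {1..n}"
    using bij_betw_trans [OF standard_bij] by (simp add: the_permute_tableau comp_def cong: bij_betw_cong)
  then have std: "?Y \<in> standard_tableaux m n \<longleftrightarrow> increasing_tableau ?Y"
    using X by (simp add: standard_tableaux_iff)
  have t_less: "transpose i (Suc i) x < transpose i (Suc i) y \<longleftrightarrow> x < y \<and> \<not> (x = i \<and> y = i + 1) \<or> x = i + 1 \<and> y = i" for x y
    by (auto simp: transpose_def)
  have same: "same_line (node_of X i) (node_of X (i + 1))"
    if "same_line a b" "X a = Some i" "X b = Some (i + 1)" for a b
    using that node_of_eq by simp
  have "increasing_tableau ?Y" if nsl: "\<not> same_line (node_of X i) (node_of X (i + 1))"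
    unfolding increasing_tableau_def dom_permute_tableau
  proof (intro conjI allI impI)
    fix k r s s' assume *: "(k, r, s) \<in> dom X" "(k, r, s') \<in> dom X" "s < s'"
    then have "the (X (k, r, s)) < the (X (k, r, s'))"
      using standard_increasing by (auto simp: increasing_tableau_def)
    then show "the (?Y (k, r, s)) < the (?Y (k, r, s'))"
      using * nsl same [of "(k, r, s)" "(k, r, s')"]
      by (auto simp: the_permute_tableau t_less same_line_def)
  next
    fix k r r' s assume *: "(k, r, s) \<in> dom X" "(k, r', s) \<in> dom X" "r < r'"
    then have "the (X (k, r, s)) < the (X (k, r', s))"
      using standard_increasing by (auto simp: increasing_tableau_def)
    then show "the (?Y (k, r, s)) < the (?Y (k, r', s))"
      using * nsl same [of "(k, r, s)" "(k, r', s)"]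
      by (auto simp: the_permute_tableau t_less same_line_def)
  qed
  moreover have False if sl: "same_line (node_of X i) (node_of X (i + 1))" and inc: "increasing_tableau ?Y"
  proof -
    obtain k r s where a: "node_of X i = (k, r, s)" by (rule prod_cases3)
    obtain k' r' s' where b: "node_of X (i + 1) = (k', r', s')" by (rule prod_cases3)
    have Xa: "X (k, r, s) = Some i" and Xb: "X (k', r', s') = Some (i + 1)"
      using X_node_of [of i] X_node_of [of "i + 1"] i a b by auto
    then have Ya: "?Y (k, r, s) = Some (i + 1)" and Yb: "?Y (k', r', s') = Some i"
      by (simp_all add: permute_tableau_def)
    have in_dom: "(k, r, s) \<in> dom ?Y" "(k', r', s') \<in> dom ?Y" using Ya Yb by (blast intro: domI)+
    have "k = k'" and "r = r' \<or> s = s'" using sl a b by (auto simp: same_line_def)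
    from this(2) show False
    proof
      assume "r = r'"
      then have "s < s'" using standard_row_less Xa Xb \<open>k = k'\<close> by simp
      then have "the (?Y (k, r, s)) < the (?Y (k', r', s'))"
        using inc in_dom \<open>k = k'\<close> \<open>r = r'\<close> unfolding increasing_tableau_def by blast
      then show False using Ya Yb by simp
    next
      assume "s = s'"
      then have "r < r'" using standard_column_less Xa Xb \<open>k = k'\<close> by simp
      then have "the (?Y (k, r, s)) < the (?Y (k', r', s'))"
        using inc in_dom \<open>k = k'\<close> \<open>s = s'\<close> unfolding increasing_tableau_def by blast
      then show False using Ya Yb by simp
    qed
  qed
  ultimately show ?thesis using std by blast
qed

text \<open>A gap between the two nodes would contain, by closure of the diagram, a node whose
  number lies strictly between \<open>i\<close> and \<open>i + 1\<close>.\<close>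

lemma same_line_diagonal:
  assumes i: "i \<in> {1..n - 1}" and sl: "same_line (node_of X i) (node_of X (i + 1))"
  shows "fst (node_of X i) = fst (node_of X (i + 1))" "\<bar>diagonal X (i + 1) - diagonal X i\<bar> = 1"
proof -
  obtain k r s where a: "node_of X i = (k, r, s)" by (rule prod_cases3)
  obtain k' r' s' where b: "node_of X (i + 1) = (k', r', s')" by (rule prod_cases3)
  have Xa: "X (k, r, s) = Some i" and Xb: "X (k', r', s') = Some (i + 1)"
    using X_node_of [of i] X_node_of [of "i + 1"] i a b by auto
  have pos: "1 \<le> r" "1 \<le> s" using standard_component [OF domI [where m = X, OF Xa]] by simp_all
  have k: "k = k'" and line: "r = r' \<or> s = s'" using sl a b by (auto simp: same_line_def)
  from k show "fst (node_of X i) = fst (node_of X (i + 1))" using a b by simp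
  from line have "r = r' \<and> s' = s + 1 \<or> s = s' \<and> r' = r + 1"
  proof
    assume r: "r = r'"
    have "s < s'" using standard_row_less Xa Xb k r by simp
    then have "(k, r, s + 1) \<in> dom X"
      using standard_down_closed [of k r s' r "s + 1"] Xb k r pos by auto
    then obtain j where j: "X (k, r, s + 1) = Some j" by blast
    have "i < j" using standard_row_less [OF Xa j] by simp
    moreover have "s + 1 < s' \<longleftrightarrow> j < i + 1" using standard_row_less j Xb k r by simp
    ultimately show ?thesis using \<open>s < s'\<close> r by auto
  next
    assume s: "s = s'"
    have "r < r'" using standard_column_less Xa Xb k s by simp
    then have "(k, r + 1, s) \<in> dom X"
      using standard_down_closed [of k r' s "r + 1" s] Xb k s pos by auto
    then obtain j where j: "X (k, r + 1, s) = Some j" by blast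
    have "i < j" using standard_column_less [OF Xa j] by simp
    moreover have "r + 1 < r' \<longleftrightarrow> j < i + 1" using standard_column_less j Xb k s by simp
    ultimately show ?thesis using \<open>r < r'\<close> s by auto
  qed
  then show "\<bar>diagonal X (i + 1) - diagonal X i\<bar> = 1"
    using a b by (auto simp: diagonal_def)
qed

text \<open>
  Between two nodes of a diagonal there are at least two incomparable nodes, so that the
  numbers of two nodes on a diagonal differ by at least three.
\<close>

lemma diagonal_neq:
  assumes "i \<in> {1..n}" "j \<in> {1..n}" "i < j" "j \<le> i + 2" "fst (node_of X i) = fst (node_of X j)"
  shows "diagonal X i \<noteq> diagonal X j"
proof
  assume eq: "diagonal X i = diagonal X j"
  obtain k r s where a: "node_of X i = (k, r, s)" by (rule prod_cases3)
  obtain r' s' where b: "node_of X j = (k, r', s')"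
    using assms(5) a by (cases "node_of X j") auto
  have Xa: "X (k, r, s) = Some i" and Xb: "X (k, r', s') = Some j"
    using X_node_of [of i] X_node_of [of j] assms a b by auto
  have pos: "1 \<le> r" "1 \<le> s" "1 \<le> r'" "1 \<le> s'" using standard_component [OF domI [where m = X, OF Xa]] standard_component [OF domI [where m = X, OF Xb]] by simp_all
  have d: "int s - int r = int s' - int r'" using eq a b by (simp add: diagonal_def)
  have "r < r'"
  proof (rule ccontr)
    assume "\<not> r < r'"
    moreover have "r \<noteq> r'" using d a b assms Xa Xb by auto
    ultimately have *: "r' < r" "s' < s" using d by auto
    then have "(k, r', s) \<in> dom X"
      using standard_down_closed [of k r s r' s] Xa pos by auto
    then obtain l where l: "X (k, r', s) = Some l" by blast
    have "l < i" "j < l"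
      using standard_column_less [OF l Xa] standard_row_less [OF Xb l] * by auto
    then show False using assms by simp
  qed
  then have "s < s'" using d by simp
  have "(k, r, s') \<in> dom X" "(k, r', s) \<in> dom X"
    using standard_down_closed [of k r' s' r s'] standard_down_closed [of k r' s' r' s] Xb pos \<open>r < r'\<close> \<open>s < s'\<close>
    by auto
  then obtain l l' where l: "X (k, r, s') = Some l" "X (k, r', s) = Some l'" by blast
  have "i < l" "l < j" "i < l'" "l' < j"
    using standard_row_less [OF Xa l(1)] standard_column_less [OF l(1) Xb]
      standard_column_less [OF Xa l(2)] standard_row_less [OF l(2) Xb] \<open>r < r'\<close> \<open>s < s'\<close> by auto
  moreover have "l \<noteq> l'"
    using standard_inj [OF l(1)] l(2) \<open>r < r'\<close> by auto
  ultimately show False using assms(4) by simp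
qed

lemma diagonal_diff_less:
  assumes "i \<in> {1..n}" "j \<in> {1..n}"
  shows "diagonal X i - diagonal X j < int n"
proof -
  obtain k r s where a: "node_of X i = (k, r, s)" by (rule prod_cases3)
  obtain k' r' s' where b: "node_of X j = (k', r', s')" by (rule prod_cases3)
  have Xa: "(k, r, s) \<in> dom X" and Xb: "(k', r', s') \<in> dom X"
    using X_node_of [OF assms(1)] X_node_of [OF assms(2)] a b by auto
  have pos: "1 \<le> r" "1 \<le> s" "1 \<le> r'" "1 \<le> s'" using standard_component [OF Xa] standard_component [OF Xb] by simp_all
  text \<open>A row of length \<open>s\<close> and a column of length \<open>r'\<close> share at most one node.\<close>
  let ?R = "(\<lambda>c. (k, 1::nat, c)) ` {1..s}" and ?C = "(\<lambda>c. (k', c, 1::nat)) ` {2..r'}"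
  have "?R \<subseteq> dom X" using standard_down_closed [OF Xa] pos by (simp add: image_subset_iff)
  moreover have "?C \<subseteq> dom X" using standard_down_closed [OF Xb] pos by (simp add: image_subset_iff)
  moreover have "finite (dom X)" and card: "card (dom X) = n"
    using bij_betw_finite [OF standard_bij] bij_betw_same_card [OF standard_bij] by auto
  ultimately have "card (?R \<union> ?C) \<le> n" using card_mono [of "dom X" "?R \<union> ?C"] by simp
  moreover have "card (?R \<union> ?C) = s + (r' - 1)"
    by (subst card_Un_disjoint) (auto simp: card_image inj_on_def)
  ultimately have "s + (r' - 1) \<le> n" by simp
  then show ?thesis using a b pos by (auto simp: diagonal_def)
qed

text \<open>Moving up to the first row and then left to the corner can only decrease the number, and
  1 cannot decrease. Consequently the content of 1 is one of the \<open>v k\<close>, the roots of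
  the cyclotomic relation.\<close>

lemma standard_first_node:
  assumes "n \<ge> 1"
  obtains k where "k \<in> {1..m}" "node_of X 1 = (k, 1, 1)"
proof -
  obtain k r s where a: "node_of X 1 = (k, r, s)" by (rule prod_cases3)
  then have Xa: "X (k, r, s) = Some 1" using X_node_of [of 1] assms by auto
  have pos: "k \<in> {1..m}" "1 \<le> r" "1 \<le> s" using standard_component [OF domI [where m = X, OF Xa]] by simp_all
  have "(k, 1, s) \<in> dom X" "(k, 1, 1) \<in> dom X"
    using standard_down_closed [of k r s] pos Xa by auto
  then obtain i j where ij: "X (k, 1, s) = Some i" "X (k, 1, 1) = Some j" by blast
  have "i \<ge> 1" "j \<ge> 1"
    using standard_entry [OF ij(1)] standard_entry [OF ij(2)] by simp_all
  then have r: "r = 1"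
    using standard_column_less [OF ij(1) Xa] pos by simp
  then have "i = 1" using ij(1) Xa by simp
  then have "s = 1"
    using standard_row_less [OF ij(2) ij(1)] pos \<open>j \<ge> 1\<close> by simp
  then show ?thesis using that pos a r by auto
qed

text \<open>A node in row \<open>r\<close> and column \<open>s\<close> forces \<open>s\<close> nodes
  in the first row and \<open>r\<close> nodes in the first column, so that neither number exceeds
  \<open>n\<close>.\<close>

lemma standard_range: "dom X \<subseteq> {1..m} \<times> {1..n} \<times> {1..n}" "ran X \<subseteq> {1..n}"
proof -
  show "ran X \<subseteq> {1..n}"
    using standard_entry by (auto simp: ran_def)
  show "dom X \<subseteq> {1..m} \<times> {1..n} \<times> {1..n}"
  proof
    fix a assume "a \<in> dom X"
    moreover obtain k r s where a: "a = (k, r, s)" by (rule prod_cases3)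
    ultimately have *: "(k, r, s) \<in> dom X" by simp
    have fin: "finite (dom X)" and card: "card (dom X) = n"
      using bij_betw_finite [OF standard_bij] bij_betw_same_card [OF standard_bij] by auto
    have "(\<lambda>c. (k, 1::nat, c)) ` {1..s} \<subseteq> dom X" "(\<lambda>c. (k, c, 1::nat)) ` {1..r} \<subseteq> dom X"
      using standard_down_closed [OF *] standard_component [OF *] by (simp_all add: image_subset_iff)
    from this [THEN card_mono [OF fin]] show "a \<in> {1..m} \<times> {1..n} \<times> {1..n}"
      using standard_component [OF *] card a by (auto simp: card_image inj_on_def)
  qed
qed

end

lemma finite_standard_tableaux: "finite (standard_tableaux m n)"
proof (rule finite_subset)
  let ?D = "{1..m} \<times> {1..n} \<times> {1..n}"
  show "standard_tableaux m n \<subseteq> (\<Union>D\<in>Pow ?D. {X. dom X = D \<and> ran X \<subseteq> {1..n}})"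
    using standard_range by (auto dest!: subsetD simp del: domIff) 
  show "finite (\<Union>D\<in>Pow ?D. {X. dom X = D \<and> ran X \<subseteq> {1..n}})"
    by (intro finite_UN_I finite_set_of_finite_maps) (auto dest: finite_subset)
qed

section \<open>Parameters\<close>

lemma scalars_hom:
  assumes "h \<in> ring_hom (scalars :: 'a::field ring) (scalars :: 'k::field ring)"
  shows "h (x * y) = h x * h y" "h (x + y) = h x + h y" "h 1 = 1" "h 0 = 0" "h (- x) = - h x"
    "h x = 0 \<longleftrightarrow> x = 0" "h (of_nat n) = of_nat n"
proof -
  show mult: "h (x * y) = h x * h y" and add: "h (x + y) = h x + h y" and one: "h 1 = 1" for x y
    using assms by (auto simp: ring_hom_def)
  show zero: "h 0 = 0" using add [of 0 0] unfolding add_0_left by (metis add_cancel_right_left)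
  show "h (- x) = - h x" using add [of x "- x"] zero by (simp add: eq_neg_iff_add_eq_0 add.commute)
  show "h x = 0 \<longleftrightarrow> x = 0" using mult [of x "inverse x"] zero one by (cases "x = 0") auto
  show "h (of_nat n) = of_nat n" by (induction n) (simp_all add: zero one add)
qed

text \<open>Either kind of parameters comes with a ring homomorphism from the complex numbers,
  necessarily injective, so the field has characteristic zero. The limiting coefficients at q^2 = 1
  have integers as denominators.\<close>

lemma admissible_of_int_eq_0:
  assumes "admissible_parameters m n (q :: 'k::field) v"
  shows "(of_int d :: 'k) = 0 \<longleftrightarrow> d = 0"
proof -
  obtain h where h: "h \<in> ring_hom (scalars :: complex ring) (scalars :: 'k ring)"
    using assms unfolding admissible_parameters_def rational_function_field_def is_ring_iso_def ring_iso_def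
    by blast
  have nat: "(of_nat l :: 'k) = 0 \<longleftrightarrow> l = 0" for l
    using scalars_hom(6,7) [OF h] by (metis of_nat_eq_0_iff)
  show ?thesis
    using nat [of "nat \<bar>d\<bar>"] by (cases "d \<ge> 0") (auto simp: abs_if of_nat_nat)
qed

section \<open>Evaluation of monomials and polynomials\<close>

lemma monomial_value_superset:
  assumes "finite S" "Poly_Mapping.keys \<mu> \<subseteq> S"
  shows "monomial_value x \<mu> = (\<Prod>i\<in>S. x i ^ Poly_Mapping.lookup \<mu> i)"
  unfolding monomial_value_def using assms by (intro prod.mono_neutral_left) (auto simp: in_keys_iff)

lemma monomial_value_add: "monomial_value x (\<mu> + \<nu>) = monomial_value x \<mu> * monomial_value x \<nu>"
proof -
  let ?S = "Poly_Mapping.keys \<mu> \<union> Poly_Mapping.keys \<nu>"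
  have "monomial_value x \<rho> = (\<Prod>i\<in>?S. x i ^ Poly_Mapping.lookup \<rho> i)"
    if "Poly_Mapping.keys \<rho> \<subseteq> ?S" for \<rho>
    using that by (intro monomial_value_superset) auto
  from this [of "\<mu> + \<nu>"] this [of \<mu>] this [of \<nu>] show ?thesis
    using keys_add [of \<mu> \<nu>] by (simp add: lookup_add power_add prod.distrib)
qed

lemma monomial_value_single [simp]: "monomial_value x (Poly_Mapping.single i e) = x i ^ e"
  by (subst monomial_value_superset [of "{i}"]) (auto simp: in_keys_iff lookup_single when_def)

lemma poly_value_superset:
  assumes "finite S" "Poly_Mapping.keys p \<subseteq> S" "h 0 = 0"
  shows "poly_value h x p = (\<Sum>\<mu>\<in>S. h (Poly_Mapping.lookup p \<mu>) * monomial_value x \<mu>)"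
  unfolding poly_value_def using assms by (intro sum.mono_neutral_left) (auto simp: in_keys_iff)

context
  fixes h :: "complex \<Rightarrow> 'k::field" and x :: "nat \<Rightarrow> 'k"
  assumes h: "h \<in> ring_hom scalars scalars"
begin

lemma poly_value_single: "poly_value h x (Poly_Mapping.single \<mu> c) = h c * monomial_value x \<mu>"
  by (subst poly_value_superset [of "{\<mu>}"])
    (auto simp: in_keys_iff lookup_single when_def scalars_hom [OF h])

lemma poly_value_add: "poly_value h x (p + p') = poly_value h x p + poly_value h x p'"
proof -
  let ?S = "Poly_Mapping.keys p \<union> Poly_Mapping.keys p'"
  have "poly_value h x r = (\<Sum>\<mu>\<in>?S. h (Poly_Mapping.lookup r \<mu>) * monomial_value x \<mu>)"
    if "Poly_Mapping.keys r \<subseteq> ?S" for r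
    using that by (intro poly_value_superset) (auto simp: scalars_hom [OF h])
  from this [of "p + p'"] this [of p] this [of p'] show ?thesis
    using keys_add [of p p'] by (simp add: lookup_add scalars_hom [OF h] distrib_right sum.distrib)
qed

lemma poly_value_sum: "poly_value h x (\<Sum>i\<in>S. p i) = (\<Sum>i\<in>S. poly_value h x (p i))"
proof (induction S rule: infinite_finite_induct)
  case (insert i S)
  then show ?case by (simp add: poly_value_add)
qed (simp_all add: poly_value_def)

end

text \<open>Each condition says that a polynomial in algebraically independent elements does not
  vanish, so it suffices to exhibit one nonzero coefficient.\<close>

lemma rational_function_field_admissible_values:
  assumes "rational_function_field m (q :: 'k::field) v"
  shows "admissible_values m n q v"
proof -
  let ?x = "v(0 := q)"
  let ?mon = "\<lambda>\<mu>. Poly_Mapping.single \<mu> (1 :: complex)"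
  let ?var = "\<lambda>i e. Poly_Mapping.single (i :: nat) (e :: nat)"
  obtain h where h: "h \<in> ring_hom (scalars :: complex ring) (scalars :: 'k ring)"
    and indep: "\<And>p. p \<in> polys_upto m \<Longrightarrow> poly_value h ?x p = 0 \<Longrightarrow> p = 0"
    using assms unfolding rational_function_field_def by blast
  note eval = poly_value_single [OF h] poly_value_add [OF h] poly_value_sum [OF h] scalars_hom [OF h] monomial_value_add
  have var_upto: "Poly_Mapping.keys (?var i e) \<subseteq> {0..m}" if "i \<le> m" for i e
    using that by (auto simp: in_keys_iff lookup_single when_def split: if_splits)
  have single_upto: "Poly_Mapping.single \<mu> c \<in> polys_upto m" if "Poly_Mapping.keys \<mu> \<subseteq> {0..m}" for \<mu> c
    using that by (auto simp: polys_upto_def in_keys_iff lookup_single when_def split: if_splits)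
  have add_upto: "p + p' \<in> polys_upto m" if "p \<in> polys_upto m" "p' \<in> polys_upto m" for p p'
    using that keys_add [of p p'] by (auto simp: polys_upto_def)
  have sum_upto: "(\<Sum>i\<in>S. p i) \<in> polys_upto m" if "\<And>i. p i \<in> polys_upto m" for S :: "nat set" and p
    using that by (induction S rule: infinite_finite_induct) (simp_all add: add_upto, simp_all add: polys_upto_def)
  have var_neq_0: "?x i \<noteq> 0" if "i \<le> m" for i
  proof -
    have "?mon (?var i 1) \<noteq> 0" by (metis lookup_single_eq lookup_zero one_neq_zero)
    then have "poly_value h ?x (?mon (?var i 1)) \<noteq> 0"
      using indep single_upto var_upto that by blast
    then show ?thesis unfolding eval monomial_value_single by simp
  qed
  then have q: "q \<noteq> 0" and v: "\<And>j. j \<in> {1..m} \<Longrightarrow> v j \<noteq> 0"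
    by force+
  have sums: "(\<Sum>i\<le>N. q ^ (2 * i)) \<noteq> 0" for N
  proof -
    let ?p = "\<Sum>i\<le>N. ?mon (?var 0 (2 * i))"
    \<comment> \<open>The constant coefficient is 1: only the summand with \<open>i = 0\<close>
      contributes to it.\<close>
    have "Poly_Mapping.lookup ?p 0 = (\<Sum>i\<le>N. if i = 0 then 1 else 0)"
      unfolding lookup_sum
      by (intro sum.cong) (auto simp: lookup_single when_def poly_mapping_eq_iff fun_eq_iff split: if_splits)
    then have "?p \<noteq> 0" by auto
    moreover have "?p \<in> polys_upto m" by (intro sum_upto single_upto var_upto) simp
    ultimately have "poly_value h ?x ?p \<noteq> 0" using indep by blast
    then show ?thesis by (simp add: eval)
  qed
  have monomials: "q ^ e * v j \<noteq> q ^ e' * v k" if "j \<in> {1..m}" "k \<in> {1..m}" "j \<noteq> k" for j k e e'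
  proof -
    let ?\<mu> = "?var 0 e + ?var j 1" and ?\<nu> = "?var 0 e' + ?var k 1"
    let ?p = "?mon ?\<mu> + Poly_Mapping.single ?\<nu> (- 1)"
    have "Poly_Mapping.lookup ?\<mu> j \<noteq> Poly_Mapping.lookup ?\<nu> j"
      using that by (auto simp: lookup_add lookup_single when_def)
    then have "?\<mu> \<noteq> ?\<nu>" by metis
    then have "Poly_Mapping.lookup ?p ?\<mu> = 1"
      by (simp add: lookup_add lookup_single when_def)
    then have "?p \<noteq> 0" by auto
    moreover have "?p \<in> polys_upto m"
    proof -
      have "Poly_Mapping.keys (?var 0 e + ?var l 1) \<subseteq> {0..m}" if "l \<in> {1..m}" for e l
        using keys_add [of "?var 0 e" "?var l 1"] var_upto [of 0 e] var_upto [of l 1] that by auto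
      then show ?thesis using that by (intro add_upto single_upto)
    qed
    ultimately have "poly_value h ?x ?p \<noteq> 0" using indep by blast
    then show ?thesis using that by (auto simp: eval)
  qed
  have "q powi (2 * i) * v j - v k \<noteq> 0" if "j \<in> {1..m}" "k \<in> {1..m}" "j \<noteq> k" for i j k
  proof (cases "i \<ge> 0")
    case True
    then obtain e where "i = int e" using nonneg_int_cases by metis
    then have "q powi (2 * i) = q ^ (2 * e)" by (metis of_nat_mult of_nat_numeral power_int_of_nat)
    then show ?thesis using monomials [OF that, of "2 * e" 0] by simp
  next
    case False
    then obtain e where "i = - int e" using nonpos_int_cases by (metis linear)
    then have inv: "q powi (2 * i) = inverse (q ^ (2 * e))"
      by (metis mult_minus_right of_nat_mult of_nat_numeral power_int_minus power_int_of_nat)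
    \<comment> \<open>A negative power of \<open>q\<close> is not a polynomial; multiplying by its
      inverse reduces the claim to \<open>monomials\<close>.\<close>
    have "q ^ (2 * e) * (q powi (2 * i) * v j - v k) = q ^ 0 * v j - q ^ (2 * e) * v k"
      unfolding inv using q by (simp add: right_diff_distrib)
    also have "\<dots> \<noteq> 0" using monomials [OF that, of 0 "2 * e"] by simp
    finally show ?thesis by auto
  qed
  then show ?thesis
    unfolding admissible_values_def using q v sums by blast
qed

lemma admissible_parameters_values:
  "admissible_parameters m n q v \<Longrightarrow> admissible_values m n q v"
  using rational_function_field_admissible_values unfolding admissible_parameters_def by blast

section \<open>Exchange coefficients\<close>

lemma content_eq: "content q v X i = v (fst (node_of X i)) * q powi (2 * diagonal X i)"
  by (simp add: content_def diagonal_def split: prod.split)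

lemma content_permute [simp]:
  "content q v (permute_tableau (transpose i j) X) l = content q v X (transpose i j l)"
  by (simp add: content_def)

lemma exchange_coeff_permute [simp]:
  "exchange_coeff q v (permute_tableau (transpose i j) X) l l' =
     exchange_coeff q v X (transpose i j l) (transpose i j l')"
  by (simp add: exchange_coeff_def diagonal_def)

text \<open>The two alternatives are the situations in which \<open>exchange_coeff\<close> divides
  by a nonzero element: the fraction itself, or its limit at q^2 = 1. The algebraic identities for
  the coefficients use nothing else about the tableau.\<close>

definition separated :: "'k::field \<Rightarrow> (nat \<Rightarrow> 'k) \<Rightarrow> tableau \<Rightarrow> nat \<Rightarrow> nat \<Rightarrow> bool" where
  "separated q v X i j \<longleftrightarrow>
     content q v X i \<noteq> content q v X j \<or>
     q\<^sup>2 = 1 \<and> (of_int (diagonal X i - diagonal X j) :: 'k) \<noteq> 0"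

lemma square_eq_1_diff_inverse: "(q :: 'k::field)\<^sup>2 = 1 \<Longrightarrow> q - inverse q = 0"
  by (metis eq_iff_diff_eq_0 inverse_unique power2_eq_square)

text \<open>If the contents agree, then q^2 = 1, so the right-hand side is 0 and the limiting value
  is antisymmetric. Otherwise this is a computation with fractions.\<close>

lemma exchange_coeff_add:
  assumes "separated q v X i j"
  shows "exchange_coeff q v X i j + exchange_coeff q v X j i = - (q - inverse q)"
proof (cases "content q v X i = content q v X j")
  case True
  then have "q\<^sup>2 = 1" using assms by (simp add: separated_def)
  then have "q - inverse q = 0" by (rule square_eq_1_diff_inverse)
  moreover have "q / of_int (diagonal X j - diagonal X i) = - (q / of_int (diagonal X i - diagonal X j))"
    by (metis minus_diff_eq minus_divide_right of_int_minus)
  ultimately show ?thesis using True by (simp add: exchange_coeff_def)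
next
  case False
  define x y d where "x = content q v X i" "y = content q v X j" "d = q - inverse q"
  then have "x - y \<noteq> 0" "y - x \<noteq> 0" using False by auto
  then have "d * y / (x - y) + d * x / (y - x) = - d"
    by (simp add: divide_simps) (simp add: algebra_simps)
  then show ?thesis using False by (simp add: exchange_coeff_def x_y_d_def)
qed

lemma content_exchange_coeff:
  assumes "separated q v X i j"
  shows "content q v X i * exchange_coeff q v X i j + content q v X j * exchange_coeff q v X j i = 0"
proof (cases "content q v X i = content q v X j")
  case True
  then have "q\<^sup>2 = 1" using assms by (simp add: separated_def)
  then have "q - inverse q = 0" by (rule square_eq_1_diff_inverse)
  then show ?thesis
    using exchange_coeff_add [OF assms] True by (simp flip: distrib_left)
next
  case False
  define x y d where "x = content q v X i" "y = content q v X j" "d = q - inverse q"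
  then have "x - y \<noteq> 0" "y - x \<noteq> 0" using False by auto
  then have "x * (d * y / (x - y)) + y * (d * x / (y - x)) = 0"
    by (simp add: divide_simps) (simp add: algebra_simps)
  then show ?thesis using False by (simp add: exchange_coeff_def x_y_d_def)
qed

text \<open>The identity on which the braid relation rests. For q^2 different from 1 it holds
  between rational functions of the three contents. At q^2 = 1 with equal contents the coefficients
  are \<open>q\<close> divided by differences of diagonals, which add up along \<open>i\<close>,
  \<open>j\<close>, \<open>k\<close>, and it becomes 1/x * 1/y = 1/(x+y) * (1/x + 1/y).\<close>

lemma exchange_coeff_mult:
  assumes "separated q v X i j" "separated q v X j k" "separated q v X i k"
  shows "exchange_coeff q v X i j * exchange_coeff q v X j k =
    exchange_coeff q v X i k * (exchange_coeff q v X i j + exchange_coeff q v X j k + (q - inverse q))"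
proof (cases "q\<^sup>2 = 1")
  case True
  then have [simp]: "q - inverse q = 0" by (rule square_eq_1_diff_inverse)
  have *: "a / x * (a / y) = a / (x + y) * (a / x + a / y)"
    if "x \<noteq> 0" "y \<noteq> 0" "x + y \<noteq> 0" for a x y :: 'a
    using that by (simp add: divide_simps) (simp add: algebra_simps)
  let ?d = "\<lambda>a b. of_int (diagonal X a - diagonal X b) :: 'a"
  have d: "?d i k = ?d i j + ?d j k" by simp
  show ?thesis
  proof (cases "content q v X i = content q v X j \<and> content q v X j = content q v X k")
    case True
    then show ?thesis
      using assms * [of "?d i j" "?d j k" q] unfolding exchange_coeff_def separated_def d by simp
  \<comment> \<open>A coefficient between different contents contains the factor
    \<open>q - inverse q\<close>, now 0. At least two of the three pairs have different contents,
    and this makes both sides vanish.\<close>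
  qed (auto simp: exchange_coeff_def)
next
  case False
  define x y z d where "x = content q v X i" "y = content q v X j" "z = content q v X k" "d = q - inverse q"
  then have "x - y \<noteq> 0" "y - z \<noteq> 0" "x - z \<noteq> 0" using assms False by (auto simp: separated_def)
  then have "(d * y / (x - y)) * (d * z / (y - z)) = (d * z / (x - z)) * (d * y / (x - y) + d * z / (y - z) + d)"
    by (simp add: divide_simps) (simp add: algebra_simps)
  then show ?thesis using assms False by (simp add: exchange_coeff_def separated_def x_y_z_d_def)
qed

context
  fixes m n :: nat and q :: "'k::field" and v :: "nat \<Rightarrow> 'k"
  assumes adm: "admissible_parameters m n q v"
begin

lemma q_neq_0: "q \<noteq> 0"
  using admissible_parameters_values [OF adm] by (simp add: admissible_values_def)

text \<open>If q^2 differs from 1 but a power of it equals 1, a geometric sum vanishes that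
  admissibility requires to be nonzero. Negative exponents are treated by inversion.\<close>

lemma q_powi_neq_1:
  assumes "d \<noteq> 0" "\<bar>d\<bar> < int n" "q\<^sup>2 \<noteq> 1"
  shows "q powi (2 * d) \<noteq> 1"
proof -
  have pos: "q powi (2 * int (Suc N)) \<noteq> 1" if "Suc N < n" for N
  proof
    assume "q powi (2 * int (Suc N)) = 1"
    then have "(q\<^sup>2) ^ Suc N = 1"
      by (metis of_nat_mult of_nat_numeral power_int_of_nat power_mult)
    moreover have "(\<Sum>i\<le>N. (q\<^sup>2) ^ i) \<noteq> 0"
      using admissible_parameters_values [OF adm] that by (auto simp: admissible_values_def power_mult)
    ultimately show False
      using sum_gp_strict [of "q\<^sup>2" "Suc N"] assms(3) by (simp add: lessThan_Suc_atMost)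
  qed
  show ?thesis
  proof (cases "d > 0")
    case True
    then obtain N where "d = int (Suc N)" by (metis not0_implies_Suc of_nat_0 less_irrefl zero_less_imp_eq_int)
    then show ?thesis using pos assms by simp
  next
    case False
    then obtain N where N: "- d = int (Suc N)"
      by (metis assms(1) linorder_neqE_linordered_idom neg_0_less_iff_less not0_implies_Suc of_nat_0 less_irrefl zero_less_imp_eq_int)
    then have "q powi (2 * (- d)) \<noteq> 1" using pos assms by simp
    then show ?thesis by (simp add: power_int_minus)
  qed
qed

lemma content_neq_0:
  assumes "X \<in> standard_tableaux m n" "i \<in> {1..n}"
  shows "content q v X i \<noteq> 0"
proof -
  have "fst (node_of X i) \<in> {1..m}"
    using X_node_of [OF assms] standard_component(1) [OF assms(1)] by (metis domI prod.collapse)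
  then show ?thesis
    using admissible_parameters_values [OF adm] by (auto simp: content_eq admissible_values_def)
qed

text \<open>Different diagrams are separated by the admissibility condition on the
  \<open>v k\<close>, applicable because diagonals differ by less than \<open>n\<close>. Within one
  diagram the diagonals differ by \<open>diagonal_neq\<close>, whence the bound
  \<open>j \<le> i + 2\<close>; it covers the three consecutive numbers that occur in a braid
  relation.\<close>

lemma standard_separated:
  assumes X: "X \<in> standard_tableaux m n" and ij: "i \<in> {1..n}" "j \<in> {1..n}" "i < j" "j \<le> i + 2"
  shows "separated q v X i j"
proof -
  let ?k = "fst (node_of X i)" and ?l = "fst (node_of X j)"
  let ?d = "diagonal X i" and ?e = "diagonal X j"
  have kl: "?k \<in> {1..m}" "?l \<in> {1..m}"
    using X_node_of [OF X] ij standard_component(1) [OF X] by (metis domI prod.collapse)+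
  have vals: "admissible_values m n q v" by (rule admissible_parameters_values [OF adm])
  have bound: "\<bar>?d - ?e\<bar> < int n"
    using diagonal_diff_less [OF X ij(1,2)] diagonal_diff_less [OF X ij(2,1)] by linarith
  have eq: "content q v X i = q powi (2 * (?d - ?e)) * v ?k * q powi (2 * ?e)"
    using q_neq_0 by (simp add: content_eq algebra_simps power_int_diff)
  show ?thesis
  proof (cases "?k = ?l")
    case False
    then have "q powi (2 * (?d - ?e)) * v ?k - v ?l \<noteq> 0"
      using vals kl bound unfolding admissible_values_def abs_less_iff by (metis minus_less_iff)
    then have "content q v X i \<noteq> content q v X j"
      unfolding eq using q_neq_0 by (simp add: content_eq)
    then show ?thesis by (simp add: separated_def)
  next
    case True
    then have neq: "?d - ?e \<noteq> 0" using diagonal_neq [OF X ij(1,2,3,4)] by simp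
    show ?thesis
    proof (cases "q\<^sup>2 = 1")
      case True
      then show ?thesis using neq admissible_of_int_eq_0 [OF adm] unfolding separated_def by blast
    next
      case False
      then have "q powi (2 * (?d - ?e)) \<noteq> 1" using q_powi_neq_1 neq bound by blast
      moreover have "v ?l \<noteq> 0" using vals kl by (simp add: admissible_values_def)
      ultimately have "content q v X i \<noteq> content q v X j"
        unfolding eq using q_neq_0 True by (simp add: content_eq)
      then show ?thesis by (simp add: separated_def)
    qed
  qed
qed

text \<open>The contents of adjacent nodes differ by a factor q^2 or q^-2, so the coefficient is -q
  or q^-1. Its negative is therefore q or -q^-1, an eigenvalue allowed by the quadratic relation of
  \<open>\<sigma> i\<close>. At q^2 = 1 the limiting value is q or -q, in agreement with
  this.\<close>

lemma same_line_exchange_coeff: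
  assumes X: "X \<in> standard_tableaux m n" and i: "i \<in> {1..n - 1}"
    and sl: "same_line (node_of X i) (node_of X (i + 1))"
  shows "(exchange_coeff q v X i (i + 1))\<^sup>2 + (q - inverse q) * exchange_coeff q v X i (i + 1) = 1"
proof -
  have i': "i \<in> {1..n}" "i + 1 \<in> {1..n}" using i by auto
  define x where "x = content q v X i"
  have x: "x \<noteq> 0" using content_neq_0 [OF X i'(1)] by (simp add: x_def)
  note k = same_line_diagonal(1) [OF X i sl]
  have "diagonal X (i + 1) - diagonal X i = 1 \<or> diagonal X (i + 1) - diagonal X i = - 1"
    using same_line_diagonal(2) [OF X i sl] by linarith
  then obtain e :: int where e: "e = 1 \<or> e = - 1" and d: "diagonal X (i + 1) = diagonal X i + e"
    by (metis add_diff_cancel_left' diff_add_cancel add.commute)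
  have y: "content q v X (i + 1) = q powi (2 * e) * x"
    using q_neq_0 unfolding x_def content_eq k d by (simp add: distrib_left power_int_add)
  have sq: "q powi (2 * e) = q\<^sup>2 \<or> q powi (2 * e) = inverse (q\<^sup>2)"
    using e by (auto simp: power_int_minus)
  show ?thesis
  proof (cases "q\<^sup>2 = 1")
    case True
    then have "content q v X (i + 1) = x" using y sq by auto
    moreover have "(of_int (diagonal X i - diagonal X (i + 1)) :: 'k) = - of_int e"
      unfolding d by simp
    ultimately have "exchange_coeff q v X i (i + 1) = q / - of_int e"
      by (simp add: exchange_coeff_def flip: x_def)
    then show ?thesis using e True square_eq_1_diff_inverse [OF True] by auto
  next
    case False
    then have neq: "q powi (2 * e) \<noteq> 1" using sq by auto
    have "exchange_coeff q v X i (i + 1) = (q - inverse q) * (q powi (2 * e) * x) / (x - q powi (2 * e) * x)"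
      using x neq unfolding exchange_coeff_def y x_def [symmetric] by auto
    also have "\<dots> = (q - inverse q) * q powi (2 * e) / (1 - q powi (2 * e))"
    proof -
      have "x - q powi (2 * e) * x = x * (1 - q powi (2 * e))" by (simp add: algebra_simps)
      then show ?thesis using x by simp
    qed
    finally have f: "exchange_coeff q v X i (i + 1) = \<dots>" .
    from sq have "exchange_coeff q v X i (i + 1) = - q \<or> exchange_coeff q v X i (i + 1) = inverse q"
    proof
      assume s: "q powi (2 * e) = q\<^sup>2"
      have "1 - q\<^sup>2 \<noteq> 0" using False by simp
      then have "(q - inverse q) * q\<^sup>2 / (1 - q\<^sup>2) = - q"
        using q_neq_0 by (simp add: field_simps power2_eq_square)
      then show ?thesis unfolding f s by blast
    next
      assume s: "q powi (2 * e) = inverse (q\<^sup>2)"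
      have "1 - inverse (q\<^sup>2) \<noteq> 0" using False by simp
      then have "(q - inverse q) * inverse (q\<^sup>2) / (1 - inverse (q\<^sup>2)) = inverse q"
        using q_neq_0 by (simp add: divide_simps) (simp add: field_simps power2_eq_square)
      then show ?thesis unfolding f s by blast
    qed
    then show ?thesis using q_neq_0 by (auto simp: field_simps power2_eq_square)
  qed
qed

end

section \<open>The smash product\<close>

lemma assoc_algebraI:
  fixes A :: "('k::field, 'a) module"
  assumes ring: "ring A"
    and "\<And>c x. x \<in> carrier A \<Longrightarrow> c \<odot>\<^bsub>A\<^esub> x \<in> carrier A"
    and "\<And>c d x. x \<in> carrier A \<Longrightarrow> (c + d) \<odot>\<^bsub>A\<^esub> x = c \<odot>\<^bsub>A\<^esub> x \<oplus>\<^bsub>A\<^esub> d \<odot>\<^bsub>A\<^esub> x"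
    and "\<And>c x y. x \<in> carrier A \<Longrightarrow> y \<in> carrier A \<Longrightarrow> c \<odot>\<^bsub>A\<^esub> (x \<oplus>\<^bsub>A\<^esub> y) = c \<odot>\<^bsub>A\<^esub> x \<oplus>\<^bsub>A\<^esub> c \<odot>\<^bsub>A\<^esub> y"
    and "\<And>c d x. x \<in> carrier A \<Longrightarrow> (c * d) \<odot>\<^bsub>A\<^esub> x = c \<odot>\<^bsub>A\<^esub> (d \<odot>\<^bsub>A\<^esub> x)"
    and "\<And>x. x \<in> carrier A \<Longrightarrow> 1 \<odot>\<^bsub>A\<^esub> x = x"
    and "\<And>c x y. x \<in> carrier A \<Longrightarrow> y \<in> carrier A \<Longrightarrow> (c \<odot>\<^bsub>A\<^esub> x) \<otimes>\<^bsub>A\<^esub> y = c \<odot>\<^bsub>A\<^esub> (x \<otimes>\<^bsub>A\<^esub> y)"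
    and "\<And>c x y. x \<in> carrier A \<Longrightarrow> y \<in> carrier A \<Longrightarrow> x \<otimes>\<^bsub>A\<^esub> (c \<odot>\<^bsub>A\<^esub> y) = c \<odot>\<^bsub>A\<^esub> (x \<otimes>\<^bsub>A\<^esub> y)"
  shows "assoc_algebra scalars A"
proof (rule assoc_algebra.intro)
  show "Module.module scalars A"
    using assms by (intro moduleI cring_scalars ring.is_abelian_group) simp_all
  show "assoc_algebra_axioms scalars A"
    using assms by unfold_locales simp_all
qed (rule ring)

text \<open>Exchanges preserve the length of words and products add lengths, so over a finite
  alphabet a length bound is the convenient form of finite support.\<close>

lemma finite_support_iff_bounded_length:
  assumes "finite T" "\<And>u. u \<notin> lists T \<Longrightarrow> f u = 0"
  shows "finite {u. f u \<noteq> 0} \<longleftrightarrow> (\<exists>N. \<forall>u. N \<le> length u \<longrightarrow> f u = 0)"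
proof
  assume "finite {u. f u \<noteq> 0}"
  then obtain N where "\<forall>l\<in>length ` {u. f u \<noteq> 0}. l < N"
    using finite_nat_set_iff_bounded by blast
  then show "\<exists>N. \<forall>u. N \<le> length u \<longrightarrow> f u = 0"
    by (intro exI [of _ N]) (auto simp: not_less [symmetric])
next
  assume "\<exists>N. \<forall>u. N \<le> length u \<longrightarrow> f u = 0"
  then obtain N where "\<And>u. f u \<noteq> 0 \<Longrightarrow> length u \<le> N"
    by (metis nat_le_linear)
  then have "{u. f u \<noteq> 0} \<subseteq> {u. set u \<subseteq> T \<and> length u \<le> N}"
    using assms(2) by (auto simp: in_lists_conv_set)
  then show "finite {u. f u \<noteq> 0}"
    using finite_lists_length_le [OF assms(1)] finite_subset by blast
qed

definition pure_word :: "'t list \<Rightarrow> ('g list \<Rightarrow>\<^sub>0 'k::field) \<Rightarrow> 't list \<Rightarrow> 'g list \<Rightarrow>\<^sub>0 'k" where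
  "pure_word x \<phi> = (\<lambda>u. if u = x then \<phi> else 0)"

lemma pure_word_simps [simp]:
  "pure_word [] \<phi> (Y # w) = 0" "pure_word (X # x) \<phi> [] = 0" "pure_word x \<phi> x = \<phi>"
  by (simp_all add: pure_word_def)

lemma pure_word_Cons: "(\<lambda>u. pure_word (X # x) \<phi> (Y # u)) = (if X = Y then pure_word x \<phi> else (\<lambda>u. 0))"
  by (auto simp: pure_word_def)

lemma pure_word_add: "pure_word x (\<phi> + \<psi>) = (\<lambda>u. pure_word x \<phi> u + pure_word x \<psi> u)"
  by (auto simp: pure_word_def)

lemma pure_tensor_free_algebra:
  "pure_tensor (free_algebra G) x \<phi> = (\<lambda>u. const (Poly_Mapping.lookup x u) * \<phi>)"
  by (simp add: pure_tensor_def)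

lemma pure_tensor_single:
  "pure_tensor (free_algebra G) (Poly_Mapping.single u c) \<phi> = (\<lambda>w. const c * pure_word u \<phi> w)"
  by (auto simp: pure_tensor_free_algebra pure_word_def lookup_single when_def)

lemma pure_tensor_gen: "pure_tensor (free_algebra G) (gen X) \<phi> = pure_word [X] \<phi>"
  by (simp add: gen_def pure_tensor_single)

lemma pure_tensor_one: "pure_tensor (free_algebra G) 1 \<phi> = pure_word [] \<phi>"
  by (auto simp: pure_tensor_free_algebra pure_word_def lookup_one when_def zero_list_def)

lemma pure_tensor_add:
  "pure_tensor (free_algebra G) (x + y) \<phi> =
     (\<lambda>u. pure_tensor (free_algebra G) x \<phi> u + pure_tensor (free_algebra G) y \<phi> u)"
  by (simp add: pure_tensor_free_algebra lookup_add const_add distrib_right)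

lemma pure_tensor_zero [simp]: "pure_tensor (free_algebra G) 0 \<phi> = (\<lambda>u. 0)"
  by (simp add: pure_tensor_free_algebra)

lemma tensor_algebra_free_simps [simp]:
  "f \<in> carrier (tensor_algebra T (free_algebra G) mul) \<longleftrightarrow>
     (\<forall>u. Poly_Mapping.keys (f u) \<subseteq> lists G) \<and> (\<forall>u. u \<notin> lists T \<longrightarrow> f u = 0) \<and> finite {u. f u \<noteq> 0}"
  "x \<otimes>\<^bsub>tensor_algebra T W mul\<^esub> y = mul x y"
  "\<one>\<^bsub>tensor_algebra T (free_algebra G) mul\<^esub> = pure_word [] 1"
  "\<zero>\<^bsub>tensor_algebra T (free_algebra G) mul\<^esub> = (\<lambda>u. 0)"
  "f \<oplus>\<^bsub>tensor_algebra T (free_algebra G) mul\<^esub> g = (\<lambda>u. f u + g u)"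
  "c \<odot>\<^bsub>tensor_algebra T (free_algebra G) mul\<^esub> f = (\<lambda>u. const c * f u)"
  by (simp_all add: tensor_algebra_def pure_tensor_one)

section \<open>Products of pure tensors\<close>

context exchange_rules
begin

text \<open>Every rule replaces one letter by one letter, so the action respects the grading by word
  length.\<close>

lemma act_length:
  assumes "\<And>u. length u = length w \<Longrightarrow> f u = 0"
  shows "act \<phi> f w = 0"
proof -
  have gen: "gen_act g f w = 0" if "\<And>u. length u = length w \<Longrightarrow> f u = 0" for g f w
    using that
  proof (induction w arbitrary: f)
    case (Cons Y w)
    have "gen_act g (\<lambda>u. f (s g Y # u)) w = 0"
      using Cons.prems by (intro Cons.IH) simp
    then show ?case using Cons.prems by simp
  qed simp
  have "foldr gen_act h f u = 0" if "length u = length w" for h u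
    using that
  proof (induction h arbitrary: u)
    case (Cons g h)
    then show ?case by (simp add: gen)
  qed (simp add: assms)
  then show ?thesis by (simp add: act_def)
qed

lemma smash_pure_word_Nil: "smash (pure_word [] \<phi>) b = act \<phi> b"
proof
  show "smash (pure_word [] \<phi>) b w = act \<phi> b w" for w
    by (cases w) (simp_all add: pure_word_def)
qed

lemma act_pure_word_Nil: "act \<phi> (pure_word [] \<psi>) = pure_word [] (\<phi> * \<psi>)"
proof
  show "act \<phi> (pure_word [] \<psi>) w = pure_word [] (\<phi> * \<psi>) w" for w
  proof (cases w)
    case (Cons Y u)
    then have "act \<phi> (pure_word [] \<psi>) w = 0"
      by (intro act_length) (auto simp: pure_word_def)
    then show ?thesis using Cons by (simp add: pure_word_def)
  qed (simp add: pure_word_def)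
qed

lemma smash_pure_word: "smash (pure_word x 1) (pure_word y \<phi>) = pure_word (x @ y) \<phi>"
proof
  show "smash (pure_word x 1) (pure_word y \<phi>) w = pure_word (x @ y) \<phi> w" for w
  proof (induction x arbitrary: w)
    case Nil
    then show ?case by (simp add: smash_pure_word_Nil)
  next
    case (Cons X x)
    show ?case
    proof (cases w)
      case (Cons Y u)
      have "smash (pure_word (X # x) 1) (pure_word y \<phi>) (Y # u) =
          (if X = Y then smash (pure_word x 1) (pure_word y \<phi>) u else 0)"
        unfolding smash.simps pure_word_Cons by simp
      then show ?thesis using Cons Cons.IH by (simp add: pure_word_def)
    qed (simp add: pure_word_def)
  qed
qed

text \<open>The left tensor carries the coefficient 1, so nothing has to cross the letters of the
  right one and words are merely concatenated.\<close>

lemma smash_pure_tensor: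
  "smash (pure_tensor (free_algebra H) x 1) (pure_tensor (free_algebra H) y \<phi>) =
     pure_tensor (free_algebra H) (x * y) \<phi>"
proof -
  have "smash (pure_tensor (free_algebra H) x 1) (pure_tensor (free_algebra H) y \<phi>) w =
     pure_tensor (free_algebra H) (x * y) \<phi> w" for w
  proof (induction x rule: poly_mapping_induct)
    case (single u c)
    show ?case
    proof (induction y rule: poly_mapping_induct)
      case (single u' c')
      show ?case
        by (simp add: pure_tensor_single mult_single smash_scale_left smash_scale_right smash_pure_word
            plus_list_def const_mult mult.assoc)
    qed (simp_all add: pure_tensor_add distrib_left smash_add_right)
  qed (simp_all add: pure_tensor_add distrib_right smash_add_left)
  then show ?thesis by blast
qed

end

text \<open>The map \<open>s\<close> is total and may leave \<open>T\<close>, as a forbidden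
  exchange of numbers does; only exchanges with a nonzero coefficient have to respect
  \<open>T\<close>. Both directions matter: one keeps values at words in \<open>T\<close> under
  control, the other keeps the support inside \<open>T\<close>.\<close>

locale closed_exchange_rules = exchange_rules s A B C
  for s :: "'g \<Rightarrow> 't \<Rightarrow> 't" and A B C :: "'g \<Rightarrow> 't \<Rightarrow> 'k::field" +
  fixes G :: "'g set" and T :: "'t set"
  assumes finite_T: "finite T"
    and closed: "g \<in> G \<Longrightarrow> A g Y \<noteq> 0 \<or> B g Y \<noteq> 0 \<Longrightarrow> s g Y \<in> T \<longleftrightarrow> Y \<in> T"
begin

abbreviation "tensors mul \<equiv> tensor_algebra T (free_algebra G :: ('k, 'g list \<Rightarrow>\<^sub>0 'k) module) mul"

text \<open>The set \<open>J\<close> stays abstract because two instances are needed for the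
  product: the free algebra on \<open>G\<close>, for closure of the carrier, and the Hecke ideal,
  for passing to the quotient.\<close>

lemma gen_act_mem:
  assumes J: "0 \<in> J" "\<And>x y. x \<in> J \<Longrightarrow> y \<in> J \<Longrightarrow> x + y \<in> J" "\<And>c x. x \<in> J \<Longrightarrow> const c * x \<in> J"
      "\<And>x. x \<in> J \<Longrightarrow> gen g * x \<in> J"
    and g: "g \<in> G" and f: "\<And>u. u \<in> lists T \<Longrightarrow> f u \<in> J" and w: "w \<in> lists T"
  shows "gen_act g f w \<in> J"
  using f w
proof (induction w arbitrary: f)
  case (Cons Y w)
  have "const (A g Y) * gen_act g (\<lambda>u. f (s g Y # u)) w \<in> J"
  proof (cases "A g Y = 0")
    case False
    then show ?thesis using closed [OF g] Cons by (intro J Cons.IH) auto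
  qed (simp add: J)
  moreover have "const (B g Y) * f (s g Y # w) \<in> J"
  proof (cases "B g Y = 0")
    case False
    then show ?thesis using closed [OF g, of Y] Cons by (intro J) auto
  qed (simp add: J)
  moreover have "const (C g Y) * f (Y # w) \<in> J" using Cons by (intro J) auto
  ultimately show ?case using J by simp
qed (simp add: J)

lemma act_mem:
  assumes J: "0 \<in> J" "\<And>x y. x \<in> J \<Longrightarrow> y \<in> J \<Longrightarrow> x + y \<in> J"
      "\<And>\<phi> x. Poly_Mapping.keys \<phi> \<subseteq> lists G \<Longrightarrow> x \<in> J \<Longrightarrow> \<phi> * x \<in> J"
    and \<phi>: "Poly_Mapping.keys \<phi> \<subseteq> lists G"
    and f: "\<And>u. u \<in> lists T \<Longrightarrow> f u \<in> J" and w: "w \<in> lists T"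
  shows "act \<phi> f w \<in> J"
  using \<phi>
proof (induction \<phi> rule: poly_mapping_keys_induct)
  case (single h c)
  have "foldr gen_act h f u \<in> J" if "u \<in> lists T" for u
    using single that
  proof (induction h arbitrary: u)
    case (Cons g h)
    then show ?case
      unfolding foldr.simps o_apply by (intro gen_act_mem J) auto
  qed (simp add: f)
  then show ?case using w by (simp add: act_single J)
qed (simp_all add: J act_add_left)

lemma gen_act_support:
  assumes "g \<in> G" "\<And>u. u \<notin> lists T \<Longrightarrow> f u = 0" "w \<notin> lists T"
  shows "gen_act g f w = 0"
  using assms(2,3)
proof (induction w arbitrary: f)
  case (Cons Y w)
  show ?case
  proof (cases "A g Y = 0 \<and> B g Y = 0")
    case True
    then show ?thesis using Cons.prems by auto
  next
    case False
    then have outside: "s g Y # w \<notin> lists T"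
      using closed [OF assms(1), of Y] Cons.prems by auto
    have "gen_act g (\<lambda>u. f (s g Y # u)) w = 0"
    proof (cases "s g Y \<in> T")
      case True
      then show ?thesis using outside Cons.prems by (intro Cons.IH) auto
    next
      case False
      then have "(\<lambda>u. f (s g Y # u)) = (\<lambda>u. 0)" using Cons.prems by auto
      then show ?thesis by simp
    qed
    then show ?thesis using Cons.prems outside by simp
  qed
qed simp

lemma act_support:
  assumes "Poly_Mapping.keys \<phi> \<subseteq> lists G" "\<And>u. u \<notin> lists T \<Longrightarrow> f u = 0" "w \<notin> lists T"
  shows "act \<phi> f w = 0"
proof -
  have "foldr gen_act h f u = 0" if "h \<in> lists G" "u \<notin> lists T" for h u
    using that
  proof (induction h arbitrary: u)
    case (Cons g h)
    then show ?case by (auto intro!: gen_act_support)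
  qed (simp add: assms(2))
  then have "\<forall>h\<in>Poly_Mapping.keys \<phi>. foldr gen_act h f w = 0"
    using assms(1,3) by blast
  then show ?thesis by (simp add: act_def)
qed

lemma smash_mem:
  assumes J: "0 \<in> J" "\<And>x y. x \<in> J \<Longrightarrow> y \<in> J \<Longrightarrow> x + y \<in> J"
      "\<And>\<phi> x. Poly_Mapping.keys \<phi> \<subseteq> lists G \<Longrightarrow> x \<in> J \<Longrightarrow> \<phi> * x \<in> J"
    and a: "\<And>u. Poly_Mapping.keys (a u) \<subseteq> lists G"
    and b: "\<And>u. u \<in> lists T \<Longrightarrow> b u \<in> J" and w: "w \<in> lists T"
  shows "smash a b w \<in> J"
  using a w
proof (induction w arbitrary: a)
  case (Cons Y w)
  have "act (a []) b (Y # w) \<in> J" using Cons by (intro act_mem J b) auto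
  moreover have "smash (\<lambda>u. a (Y # u)) b w \<in> J" using Cons by (intro Cons.IH) auto
  ultimately show ?case by (simp add: J)
qed (simp add: J b)

lemma smash_support:
  assumes "\<And>u. Poly_Mapping.keys (a u) \<subseteq> lists G" "\<And>u. u \<notin> lists T \<Longrightarrow> a u = 0"
    "\<And>u. u \<notin> lists T \<Longrightarrow> b u = 0" "w \<notin> lists T"
  shows "smash a b w = 0"
  using assms(1,2,4)
proof (induction w arbitrary: a)
  case (Cons Y w)
  have "act (a []) b (Y # w) = 0" using Cons.prems assms(3) by (intro act_support) auto
  moreover have "smash (\<lambda>u. a (Y # u)) b w = 0"
  proof (cases "Y \<in> T")
    case True
    then show ?thesis using Cons.prems by (intro Cons.IH) auto
  next
    case False
    then have "(\<lambda>u. a (Y # u)) = (\<lambda>u. 0)" using Cons.prems(2) by auto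
    then show ?thesis by simp
  qed
  ultimately show ?case by simp
qed simp

text \<open>Each letter removed from the word lowers the bound for \<open>a\<close> by one; at bound
  0 nothing of \<open>a\<close> is left.\<close>

lemma smash_length:
  assumes "\<And>u. N \<le> length u \<Longrightarrow> a u = 0" "\<And>u. M \<le> length u \<Longrightarrow> b u = 0" "N + M \<le> length w"
  shows "smash a b w = 0"
  using assms(1,3)
proof (induction w arbitrary: a N)
  case (Cons Y w)
  have "act (a []) b (Y # w) = 0" using Cons.prems assms(2) by (intro act_length) auto
  moreover have "smash (\<lambda>u. a (Y # u)) b w = 0"
  proof (cases N)
    case (Suc N')
    then show ?thesis using Cons.prems by (intro Cons.IH [of N']) auto
  next
    case 0
    then have "(\<lambda>u. a (Y # u)) = (\<lambda>u. 0)" using Cons.prems(1) by auto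
    then show ?thesis by simp
  qed
  ultimately show ?case by simp
qed simp

lemma smash_closed:
  assumes "a \<in> carrier (tensors mul)" "b \<in> carrier (tensors mul')"
  shows "smash a b \<in> carrier (tensors mul'')"
proof -
  have a: "\<And>u. Poly_Mapping.keys (a u) \<subseteq> lists G" "\<And>u. u \<notin> lists T \<Longrightarrow> a u = 0"
    and b: "\<And>u. Poly_Mapping.keys (b u) \<subseteq> lists G" "\<And>u. u \<notin> lists T \<Longrightarrow> b u = 0"
    using assms by auto
  obtain N M where N: "\<And>u. N \<le> length u \<Longrightarrow> a u = 0" and M: "\<And>u. M \<le> length u \<Longrightarrow> b u = 0"
    using assms finite_support_iff_bounded_length [OF finite_T a(2)]
      finite_support_iff_bounded_length [OF finite_T b(2)] by auto
  have supp: "\<And>u. u \<notin> lists T \<Longrightarrow> smash a b u = 0" by (rule smash_support [OF a b(2)])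
  have "smash a b u = 0" if "N + M \<le> length u" for u
    by (rule smash_length [where a = a and b = b, OF N M that])
  then have "\<exists>N. \<forall>u. N \<le> length u \<longrightarrow> smash a b u = 0" by blast
  then have "finite {u. smash a b u \<noteq> 0}"
    using finite_support_iff_bounded_length [OF finite_T supp] by simp
  moreover have "Poly_Mapping.keys (smash a b u) \<subseteq> lists G" for u
  proof (cases "u \<in> lists T")
    case True
    have "smash a b u \<in> {p. Poly_Mapping.keys p \<subseteq> lists G}"
      by (rule smash_mem [OF _ _ _ a(1) _ True]) (use b in \<open>simp_all add: keys_add_lists keys_mult_lists\<close>)
    then show ?thesis by simp
  qed (simp add: supp)
  ultimately show ?thesis using supp by simp
qed

lemma pure_word_closed:
  "x \<in> lists T \<Longrightarrow> Poly_Mapping.keys \<phi> \<subseteq> lists G \<Longrightarrow> pure_word x \<phi> \<in> carrier (tensors mul)"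
  by (auto simp: pure_word_def)

lemma tensors_add_closed:
  assumes "a \<in> carrier (tensors mul)" "b \<in> carrier (tensors mul)"
  shows "(\<lambda>u. a u + b u) \<in> carrier (tensors mul)"
proof -
  have "{u. a u + b u \<noteq> 0} \<subseteq> {u. a u \<noteq> 0} \<union> {u. b u \<noteq> 0}" by auto
  then have "finite {u. a u + b u \<noteq> 0}" by (rule finite_subset) (use assms in auto)
  then show ?thesis using assms by (simp add: keys_add_lists)
qed

lemma tensors_scale_closed:
  assumes "a \<in> carrier (tensors mul)"
  shows "(\<lambda>u. const c * a u) \<in> carrier (tensors mul)"
proof -
  have "{u. const c * a u \<noteq> 0} \<subseteq> {u. a u \<noteq> 0}" by auto
  then have "finite {u. const c * a u \<noteq> 0}" by (rule finite_subset) (use assms in auto)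
  then show ?thesis using assms by (simp add: keys_mult_lists)
qed

lemma pure_tensor_closed:
  assumes "Poly_Mapping.keys x \<subseteq> lists T" "Poly_Mapping.keys \<phi> \<subseteq> lists G"
  shows "pure_tensor (free_algebra G) x \<phi> \<in> carrier (tensors mul)"
  using assms(1)
proof (induction x rule: poly_mapping_keys_induct)
  case (single u c)
  then show ?case unfolding pure_tensor_single by (intro tensors_scale_closed pure_word_closed assms)
next
  case (add x y)
  then show ?case unfolding pure_tensor_add by (intro tensors_add_closed)
qed simp

lemma assoc_algebra_smash: "assoc_algebra scalars (tensors smash)"
proof (rule assoc_algebraI)
  have [simp]: "smash (pure_word [] 1) b = b" for b
    unfolding smash_pure_word_Nil by auto
  have [simp]: "smash a (pure_word [] 1) = a" for a
  proof
    show "smash a (pure_word [] 1) w = a w" for w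
    proof (induction w arbitrary: a)
      case (Cons Y w)
      then show ?case by (simp add: act_pure_word_Nil)
    qed simp
  qed
  show "ring (tensors smash)"
  proof (rule ringI)
    show "abelian_group (tensors smash)"
    proof (rule abelian_groupI)
      fix x assume x: "x \<in> carrier (tensors smash)"
      then have "(\<lambda>u. const (- 1) * x u) \<in> carrier (tensors smash)" by (rule tensors_scale_closed)
      moreover have "(\<lambda>u. const (- 1) * x u) \<oplus>\<^bsub>tensors smash\<^esub> x = \<zero>\<^bsub>tensors smash\<^esub>"
        by (simp add: const_minus)
      ultimately show "\<exists>y\<in>carrier (tensors smash). y \<oplus>\<^bsub>tensors smash\<^esub> x = \<zero>\<^bsub>tensors smash\<^esub>" by blast
    next
      fix x y assume "x \<in> carrier (tensors smash)" "y \<in> carrier (tensors smash)"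
      then show "x \<oplus>\<^bsub>tensors smash\<^esub> y \<in> carrier (tensors smash)"
        unfolding tensor_algebra_free_simps(5) by (rule tensors_add_closed)
    qed (simp_all add: ac_simps)
    show "Group.monoid (tensors smash)"
    proof (rule monoidI)
      fix x y assume "x \<in> carrier (tensors smash)" "y \<in> carrier (tensors smash)"
      then show "x \<otimes>\<^bsub>tensors smash\<^esub> y \<in> carrier (tensors smash)"
        unfolding tensor_algebra_free_simps(2) by (rule smash_closed)
    next
      show "\<one>\<^bsub>tensors smash\<^esub> \<in> carrier (tensors smash)"
        unfolding tensor_algebra_free_simps(3) by (rule pure_word_closed) simp_all
    qed (simp_all add: smash_assoc fun_eq_iff)
  qed (simp_all add: smash_add_left smash_add_right)
next
  fix c x assume "x \<in> carrier (tensors smash)"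
  then show "c \<odot>\<^bsub>tensors smash\<^esub> x \<in> carrier (tensors smash)"
    unfolding tensor_algebra_free_simps(6) by (rule tensors_scale_closed)
qed (simp_all add: const_add const_mult distrib_left distrib_right mult.assoc smash_scale_left smash_scale_right)

lemma embedding_letters:
  "algebra_embedding (free_algebra T) (tensors smash) (\<lambda>x. pure_tensor (free_algebra G) x 1)"
  unfolding algebra_embedding_def
proof (intro conjI allI ballI)
  show "(\<lambda>x. pure_tensor (free_algebra G) x 1) \<in> ring_hom (free_algebra T) (tensors smash)"
  proof (rule ring_hom_memI)
    fix x :: "'t list \<Rightarrow>\<^sub>0 'k" assume "x \<in> carrier (free_algebra T)"
    then show "pure_tensor (free_algebra G) x 1 \<in> carrier (tensors smash)"
      by (intro pure_tensor_closed) simp_all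
  qed (simp_all add: smash_pure_tensor pure_tensor_add pure_tensor_one del: tensor_algebra_free_simps(1))
  have inj: "x = y" if "pure_tensor (free_algebra G) x 1 = pure_tensor (free_algebra G) y (1 :: 'g list \<Rightarrow>\<^sub>0 'k)"
    for x y :: "'t list \<Rightarrow>\<^sub>0 'k"
  proof (rule poly_mapping_eqI)
    fix u
    \<comment> \<open>The coefficient of the empty word in the value at \<open>u\<close> recovers
      the coefficient of \<open>u\<close>.\<close>
    have "Poly_Mapping.lookup (const (Poly_Mapping.lookup x u) * 1) ([] :: 'g list) =
        Poly_Mapping.lookup (const (Poly_Mapping.lookup y u) * 1) ([] :: 'g list)"
      using fun_cong [OF that, of u] unfolding pure_tensor_free_algebra by simp
    then show "Poly_Mapping.lookup x u = Poly_Mapping.lookup y u"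
      by (simp add: const_def)
  qed
  show "inj_on (\<lambda>x. pure_tensor (free_algebra G) x 1 :: _ \<Rightarrow> 'g list \<Rightarrow>\<^sub>0 'k) (carrier (free_algebra T))"
    using inj by (intro inj_onI)
qed (auto simp: pure_tensor_free_algebra const_mult mult.assoc)

lemma embedding_coefficients:
  "algebra_embedding (free_algebra G) (tensors smash) (\<lambda>\<phi>. pure_tensor (free_algebra G) 1 \<phi>)"
  unfolding algebra_embedding_def pure_tensor_one
proof (intro conjI allI ballI)
  show "pure_word [] \<in> ring_hom (free_algebra G) (tensors smash)"
  proof (rule ring_hom_memI)
    fix \<phi> :: "'g list \<Rightarrow>\<^sub>0 'k" assume "\<phi> \<in> carrier (free_algebra G)"
    then show "pure_word [] \<phi> \<in> carrier (tensors smash)"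
      by (intro pure_word_closed) simp_all
  qed (simp_all add: smash_pure_word_Nil act_pure_word_Nil pure_word_add del: tensor_algebra_free_simps(1))
  show "inj_on (pure_word []) (carrier (free_algebra G))"
    by (auto simp: inj_on_def pure_word_def fun_eq_iff split: if_splits)
qed (auto simp: pure_word_def)

end

section \<open>Compatibility with the Hecke relations\<close>

context exchange_rules
begin

lemma act_gen_eq: "act (gen g) = gen_act g"
  by (auto simp: fun_eq_iff)

text \<open>Here \<open>e\<close> is 1 or 0 according to whether the exchange takes place, and
  \<open>a\<close>, \<open>b\<close> are the two exchange coefficients. If it does,
  \<open>b = - d - a\<close> cancels everything but the relation for the shorter word. If not, the
  generator acts as \<open>- a\<close>, which has to be a root of the quadratic relation.\<close>

lemma quadratic_step:
  assumes "s S Y = Y'" "s S Y' = Y" "A S Y = e" "A S Y' = e" "B S Y = e * a" "B S Y' = e * b"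
    "C S Y = - a" "C S Y' = - b"
    and ab: "b = - d - a" and e: "e = 1 \<or> e = 0 \<and> a\<^sup>2 + d * a = 1"
  shows "gen_act S (gen_act S f) (Y # w) - (const d * gen_act S f (Y # w) + f (Y # w)) =
    const e * (gen_act S (gen_act S (\<lambda>u. f (Y # u))) w - (const d * gen_act S (\<lambda>u. f (Y # u)) w + f (Y # w)))"
    (is "?lhs = ?rhs")
proof (rule poly_mapping_eqI)
  fix h :: "'g list"
  have "e = 0 \<or> e = 1" using e by blast
  \<comment> \<open>Comparing coefficients of a fixed word \<open>h\<close> moves the computation
    into the commutative field. The factor \<open>1 - e\<close> isolates the dropped
    exchange.\<close>
  then have "Poly_Mapping.lookup ?lhs h - Poly_Mapping.lookup ?rhs h =
      (1 - e) * (a * a + d * a - 1) * Poly_Mapping.lookup (f (Y # w)) h"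
    by (elim disjE; simp add: assms(1-8) ab gen_act_add gen_act_scale lookup_add lookup_minus; simp add: algebra_simps)
  also have "(1 - e) * (a * a + d * a - 1) = 0"
    using e by (auto simp: power2_eq_square)
  finally show "Poly_Mapping.lookup ?lhs h = Poly_Mapping.lookup ?rhs h" by simp
qed

text \<open>The two exchanges leave each other's coefficients unchanged. Terms in which some
  generator stops at the letter occur equally in both orders and cancel; only those remain in which
  both pass.\<close>

lemma commuting_step:
  assumes "s S Y = Y1" "s T Y = Y2" "s T Y1 = Y3" "s S Y2 = Y3"
    "A S Y = e" "A S Y2 = e" "A T Y = e'" "A T Y1 = e'"
    "B S Y = e * a" "B S Y2 = e * a" "B T Y = e' * b" "B T Y1 = e' * b"
    "C S Y = - a" "C S Y2 = - a" "C T Y = - b" "C T Y1 = - b"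
  shows "gen_act S (gen_act T f) (Y # w) - gen_act T (gen_act S f) (Y # w) =
    const (e * e') * (gen_act S (gen_act T (\<lambda>u. f (Y3 # u))) w - gen_act T (gen_act S (\<lambda>u. f (Y3 # u))) w)"
  by (rule poly_mapping_eqI)
    (simp add: assms gen_act_add gen_act_scale lookup_add lookup_minus algebra_simps)

text \<open>\<open>D\<close> acts on a letter by a scalar and never passes it, so no instance of the
  relation for the shorter word survives; the defect is a multiple of
  \<open>x * a + y * b\<close>.\<close>

lemma mixed_step:
  assumes "s S Y = Y'" "s S Y' = Y" "A S Y = e" "A S Y' = e" "B S Y = e * a" "B S Y' = e * b"
    "C S Y = - a" "C S Y' = - b"
    "A D Y = 0" "A D Y' = 0" "B D Y = 0" "B D Y' = 0" "C D Y = x" "C D Y' = y"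
    and e: "e = 0 \<or> e = 1" and xy: "x * a + y * b = 0"
  shows "gen_act D (gen_act S (gen_act D (gen_act S f))) (Y # w) =
    gen_act S (gen_act D (gen_act S (gen_act D f))) (Y # w)"
    (is "?lhs = ?rhs")
proof (rule poly_mapping_eqI)
  fix h :: "'g list"
  let ?L = "\<lambda>p :: 'g list \<Rightarrow>\<^sub>0 'k. Poly_Mapping.lookup p h"
  have "?L ?lhs - ?L ?rhs =
      (y - x) * e * (x * a + y * b) * (?L (gen_act S (\<lambda>u. f (Y' # u)) w) + a * ?L (f (Y' # w)))"
    using e by (elim disjE; simp add: assms(1-14) gen_act_add gen_act_scale lookup_add lookup_minus; simp add: algebra_simps)
  then show "?L ?lhs = ?L ?rhs" using xy by simp
qed

lemma diagonal_commuting_step: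
  assumes "s S Y = Y'" "A D Y = 0" "A D Y' = 0" "B D Y = 0" "B D Y' = 0" "C D Y = x" "C D Y' = x"
  shows "gen_act D (gen_act S f) (Y # w) = gen_act S (gen_act D f) (Y # w)"
  by (rule poly_mapping_eqI)
    (simp add: assms gen_act_add gen_act_scale lookup_add lookup_minus algebra_simps)

text \<open>
  The six tableaux are named after the order in which they carry three consecutive numbers
  in the nodes \<open>a\<close>, \<open>b\<close>, \<open>c\<close>; only the words \<open>abc\<close> and \<open>cba\<close> contribute to the difference.
\<close>

lemma braid_step:
  assumes "s S abc = bac" "s S bac = abc" "s S acb = cab" "s S bca = cba"
    "s T abc = acb" "s T acb = abc" "s T bac = bca" "s T cab = cba"
    and "A S abc = eab" "A S bac = eab" "A S acb = eac" "A S bca = ebc"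
    "A T abc = ebc" "A T acb = ebc" "A T bac = eac" "A T cab = eab"
    and "B S abc = eab * ab" "B S bac = eab * ba" "B S acb = eac * ac" "B S bca = ebc * bc"
    "B T abc = ebc * bc" "B T acb = ebc * cb" "B T bac = eac * ac" "B T cab = eab * ab"
    and "C S abc = - ab" "C S bac = - ba" "C S acb = - ac" "C S bca = - bc"
    "C T abc = - bc" "C T acb = - cb" "C T bac = - ac" "C T cab = - ab"
    and inv: "ba = - d - ab" "cb = - d - bc" and exch: "ab * bc = ac * (ab + bc + d)"
    and eab: "eab = 1 \<or> eab = 0 \<and> ab\<^sup>2 + d * ab = 1"
    and ebc: "ebc = 1 \<or> ebc = 0 \<and> bc\<^sup>2 + d * bc = 1"
  shows "gen_act S (gen_act T (gen_act S f)) (abc # w) - gen_act T (gen_act S (gen_act T f)) (abc # w) =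
    const (eab * eac * ebc) *
      (gen_act S (gen_act T (gen_act S (\<lambda>u. f (cba # u)))) w - gen_act T (gen_act S (gen_act T (\<lambda>u. f (cba # u)))) w)
    + const (eab * eac * ebc * ac) *
      (gen_act S (gen_act S (\<lambda>u. f (cba # u))) w - (const d * gen_act S (\<lambda>u. f (cba # u)) w + f (cba # w)))
    + const (- (eab * eac * ebc * ac)) *
      (gen_act T (gen_act T (\<lambda>u. f (cba # u))) w - (const d * gen_act T (\<lambda>u. f (cba # u)) w + f (cba # w)))
    + const (- (eab * ac)) *
      (gen_act S (gen_act S (\<lambda>u. f (abc # u))) w - (const d * gen_act S (\<lambda>u. f (abc # u)) w + f (abc # w)))
    + const (ebc * ac) *
      (gen_act T (gen_act T (\<lambda>u. f (abc # u))) w - (const d * gen_act T (\<lambda>u. f (abc # u)) w + f (abc # w)))"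
    (is "?lhs = ?rhs")
proof (rule poly_mapping_eqI)
  fix h :: "'g list"
  let ?L = "\<lambda>p :: 'g list \<Rightarrow>\<^sub>0 'k. Poly_Mapping.lookup p h" and ?F = "\<lambda>Y u. f (Y # u)"
  have eab': "eab = 0 \<or> eab = 1" and ebc': "ebc = 0 \<or> ebc = 1" using eab ebc by blast+
  \<comment> \<open>The first factor is the exchange identity; the other two terms are quadratic
    defects, which count only for dropped exchanges. The quadratic relations in the statement arise
    when the middle generator stays: in \<open>S T S\<close> the factor \<open>- ac\<close> for
    \<open>T\<close> leaves \<open>S S\<close> on the letter \<open>abc\<close>.\<close>
  have "?L ?lhs - ?L ?rhs =
      (ab * bc - ac * (ab + bc + d)) *
        (eab * (?L (gen_act S (?F bac) w) + ab * ?L (f (bac # w)))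
         - ebc * (?L (gen_act T (?F acb) w) + bc * ?L (f (acb # w)))
         - (ab - bc) * ?L (f (abc # w))
         - eab * eac * ebc * (?L (gen_act S (?F cba) w) - ?L (gen_act T (?F cba) w)))
      - (1 - eab) * (ab * ab + d * ab - 1) * ac * ?L (f (abc # w))
      + (1 - ebc) * (bc * bc + d * bc - 1) * ac * ?L (f (abc # w))"
    using eab' ebc'
    by (elim disjE; simp add: assms(1-32) inv gen_act_add gen_act_scale lookup_add lookup_minus; simp add: algebra_simps)
  also have "(1 - eab) * (ab * ab + d * ab - 1) = 0"
    using eab by (auto simp: power2_eq_square)
  also have "(1 - ebc) * (bc * bc + d * bc - 1) = 0"
    using ebc by (auto simp: power2_eq_square)
  finally show "?L ?lhs = ?L ?rhs" using exch by simp
qed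

end

lemma (in exchange_rules) act_keys:
  assumes "Poly_Mapping.keys \<phi> \<subseteq> lists G" "\<And>u. Poly_Mapping.keys (f u) \<subseteq> lists G"
  shows "Poly_Mapping.keys (act \<phi> f w) \<subseteq> lists G"
proof -
  have gen: "Poly_Mapping.keys (gen_act g f w) \<subseteq> lists G"
    if "g \<in> G" "\<And>u. Poly_Mapping.keys (f u) \<subseteq> lists G" for g f w
    using that(2)
  proof (induction w arbitrary: f)
    case (Cons Y w)
    show ?case
      unfolding gen_act.simps by (intro keys_add_lists keys_mult_lists keys_const_lists Cons.IH Cons.prems)
  qed (use that(1) in \<open>simp add: keys_mult_lists\<close>)
  have "Poly_Mapping.keys (foldr gen_act h f u) \<subseteq> lists G" if "h \<in> lists G" for h u
    using that by (induction h arbitrary: u) (simp_all add: assms(2) gen)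
  with assms(1) show ?thesis
    by (induction \<phi> rule: poly_mapping_keys_induct) (simp_all add: act_single act_add_left keys_add_lists keys_mult_lists)
qed

section \<open>The exchange rules of tableaux\<close>

fun move :: "hecke_gen \<Rightarrow> tableau \<Rightarrow> tableau" where
  "move Tau Y = Y"
| "move (Sigma i) Y = permute_tableau (transpose i (i + 1)) Y"

text \<open>Phrased through nodes rather than standardness, so that it is invariant under the
  exchange for every tableau. For standard tableaux it says that the exchanged tableau is
  standard.\<close>

definition exchangeable :: "nat \<Rightarrow> tableau \<Rightarrow> bool" where
  "exchangeable i Y \<longleftrightarrow> \<not> same_line (node_of Y i) (node_of Y (i + 1))"

fun move_coeff :: "hecke_gen \<Rightarrow> tableau \<Rightarrow> 'k::field" where
  "move_coeff Tau Y = 0"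
| "move_coeff (Sigma i) Y = of_bool (exchangeable i Y)"

text \<open>Coefficients are indexed by the letter at which the result is read. The relation for
  \<open>X\<close> contains the coefficient of \<open>i + 1\<close> and \<open>i\<close> in
  \<open>X\<close>, which is that of \<open>i\<close> and \<open>i + 1\<close> in the exchanged
  tableau; hence the order of the arguments.\<close>

fun shift_coeff :: "'k::field \<Rightarrow> (nat \<Rightarrow> 'k) \<Rightarrow> hecke_gen \<Rightarrow> tableau \<Rightarrow> 'k" where
  "shift_coeff q v Tau Y = 0"
| "shift_coeff q v (Sigma i) Y = of_bool (exchangeable i Y) * exchange_coeff q v Y i (i + 1)"

fun stay_coeff :: "'k::field \<Rightarrow> (nat \<Rightarrow> 'k) \<Rightarrow> hecke_gen \<Rightarrow> tableau \<Rightarrow> 'k" where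
  "stay_coeff q v Tau Y = content q v Y 1"
| "stay_coeff q v (Sigma i) Y = - exchange_coeff q v Y i (i + 1)"

lemma permute_transpose_involutory [simp]:
  "permute_tableau (transpose i j) (permute_tableau (transpose i j) Y) = Y"
  by (simp add: permute_permute_tableau)

lemma exchangeable_permute [simp]:
  "exchangeable i (permute_tableau (transpose i (Suc i)) Y) \<longleftrightarrow> exchangeable i Y"
  by (auto simp: exchangeable_def same_line_sym)

lemma exchangeable_standard_iff:
  assumes "i \<in> {1..n - 1}" "exchangeable i Y"
  shows "permute_tableau (transpose i (i + 1)) Y \<in> standard_tableaux m n \<longleftrightarrow> Y \<in> standard_tableaux m n"
proof
  assume "Y \<in> standard_tableaux m n"
  then show "permute_tableau (transpose i (i + 1)) Y \<in> standard_tableaux m n"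
    using standard_permute_iff assms by (simp add: exchangeable_def)
next
  assume "permute_tableau (transpose i (i + 1)) Y \<in> standard_tableaux m n"
  from standard_permute_iff [OF this assms(1)] show "Y \<in> standard_tableaux m n"
    using assms(2) by (auto simp: exchangeable_def same_line_sym)
qed

lemma permute_braid:
  "permute_tableau (transpose i (i + 1)) (permute_tableau (transpose (i + 1) (i + 2)) (permute_tableau (transpose i (i + 1)) Y)) =
   permute_tableau (transpose (i + 1) (i + 2)) (permute_tableau (transpose i (i + 1)) (permute_tableau (transpose (i + 1) (i + 2)) Y))"
  unfolding permute_permute_tableau
  by (rule arg_cong [of _ _ "\<lambda>\<pi>. permute_tableau \<pi> Y"]) (auto simp: fun_eq_iff transpose_def)

lemma permute_commute:
  assumes "\<bar>int i - int j\<bar> > 1"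
  shows "permute_tableau (transpose i (i + 1)) (permute_tableau (transpose j (j + 1)) Y) =
    permute_tableau (transpose j (j + 1)) (permute_tableau (transpose i (i + 1)) Y)"
  unfolding permute_permute_tableau
  by (rule arg_cong [of _ _ "\<lambda>\<pi>. permute_tableau \<pi> Y"]) (use assms in \<open>auto simp: fun_eq_iff transpose_def\<close>)

locale hecke_parameters =
  fixes m n :: nat and q :: "'k::field" and v :: "nat \<Rightarrow> 'k"
  assumes n_pos: "n \<ge> 1" and adm: "admissible_parameters m n q v"

sublocale hecke_parameters \<subseteq>
  closed_exchange_rules move move_coeff "shift_coeff q v" "stay_coeff q v" "hecke_gens n" "standard_tableaux m n"
proof
  show "finite (standard_tableaux m n)" by (rule finite_standard_tableaux)
  fix g Y assume "g \<in> hecke_gens n" and "move_coeff g Y \<noteq> (0 :: 'k) \<or> shift_coeff q v g Y \<noteq> 0"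
  then show "move g Y \<in> standard_tableaux m n \<longleftrightarrow> Y \<in> standard_tableaux m n"
    using exchangeable_standard_iff by (cases g) (auto simp: hecke_gens_def split: if_splits)
qed

context hecke_parameters
begin

abbreviation "F \<equiv> hecke_free_algebra n :: ('k, hecke_gen list \<Rightarrow>\<^sub>0 'k) module"
abbreviation "I \<equiv> hecke_ideal m n q v"

lemma hecke_relations_cases [consumes 1, case_names braid commuting mixed tau quadratic cyclotomic]:
  assumes "r \<in> hecke_relations m n q v"
  obtains i where "r = \<sigma> i * \<sigma> (i + 1) * \<sigma> i - \<sigma> (i + 1) * \<sigma> i * \<sigma> (i + 1)" "i \<in> {1..n - 1}" "i + 1 \<in> {1..n - 1}"
  | i j where "r = \<sigma> i * \<sigma> j - \<sigma> j * \<sigma> i" "i \<in> {1..n - 1}" "j \<in> {1..n - 1}" "\<bar>int i - int j\<bar> > 1"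
  | "r = \<tau> * \<sigma> 1 * \<tau> * \<sigma> 1 - \<sigma> 1 * \<tau> * \<sigma> 1 * \<tau>" "n \<ge> 2"
  | i where "r = \<tau> * \<sigma> i - \<sigma> i * \<tau>" "i \<in> {1..n - 1}" "i > 1"
  | i where "r = \<sigma> i * \<sigma> i - (const (q - inverse q) * \<sigma> i + 1)" "i \<in> {1..n - 1}"
  | "r = prod_list (map (\<lambda>j. \<tau> - const (v j)) [1..<m + 1])"
  using assms unfolding hecke_relations_def
  by (elim UnE CollectE exE conjE; simp only: split: if_splits; blast?)

lemma hecke_relations_closed: "hecke_relations m n q v \<subseteq> carrier F"
proof
  fix r assume "r \<in> hecke_relations m n q v"
  have sigma: "Poly_Mapping.keys (gen (Sigma i) :: _ \<Rightarrow>\<^sub>0 'k) \<subseteq> lists (hecke_gens n)" if "i \<in> {1..n - 1}" for i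
    using that by (auto simp: hecke_gens_def)
  have tau: "Poly_Mapping.keys (\<tau> :: _ \<Rightarrow>\<^sub>0 'k) \<subseteq> lists (hecke_gens n)"
    by (auto simp: hecke_gens_def)
  have one: "Poly_Mapping.keys (1 :: hecke_gen list \<Rightarrow>\<^sub>0 'k) \<subseteq> lists (hecke_gens n)"
    by simp
  note closed = keys_minus_lists keys_add_lists keys_mult_lists sigma tau one keys_const_lists
  from \<open>r \<in> hecke_relations m n q v\<close> have "Poly_Mapping.keys r \<subseteq> lists (hecke_gens n)"
  proof (cases rule: hecke_relations_cases)
    case (braid i)
    show ?thesis unfolding braid(1) by (intro closed braid(2,3))
  next
    case (commuting i j)
    show ?thesis unfolding commuting(1) by (intro closed commuting(2,3))
  next
    case mixed
    then have "1 \<in> {1..n - 1}" by simp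
    then show ?thesis unfolding mixed(1) by (intro closed)
  next
    case (tau i)
    show ?thesis unfolding tau(1) by (intro closed tau(2))
  next
    case (quadratic i)
    show ?thesis unfolding quadratic(1) by (intro closed quadratic(2))
  next
    case cyclotomic
    have "Poly_Mapping.keys (prod_list (map (\<lambda>j. \<tau> - const (v j)) js)) \<subseteq> lists (hecke_gens n)" for js
    proof (induction js)
      case (Cons j js)
      then show ?case unfolding list.map prod_list.Cons by (intro closed)
    qed simp
    then show ?thesis unfolding cyclotomic(1) .
  qed
  then show "r \<in> carrier F" by simp
qed

lemma ideal_I: "ideal I F"
  unfolding hecke_ideal_def by (rule ring.genideal_ideal [OF ring_free_algebra hecke_relations_closed])

lemma I_subset: "x \<in> I \<Longrightarrow> Poly_Mapping.keys x \<subseteq> lists (hecke_gens n)"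
  using ideal.Icarr [OF ideal_I] by simp

lemma I_relation: "r \<in> hecke_relations m n q v \<Longrightarrow> r \<in> I"
  unfolding hecke_ideal_def using ring.genideal_self [OF ring_free_algebra hecke_relations_closed] by blast

lemma I_zero: "0 \<in> I"
  using additive_subgroup.zero_closed [OF ideal.axioms(1) [OF ideal_I]] by simp

lemma I_add: "x \<in> I \<Longrightarrow> y \<in> I \<Longrightarrow> x + y \<in> I"
  using additive_subgroup.a_closed [OF ideal.axioms(1) [OF ideal_I]] by simp

lemma I_left: "Poly_Mapping.keys \<phi> \<subseteq> lists (hecke_gens n) \<Longrightarrow> x \<in> I \<Longrightarrow> \<phi> * x \<in> I"
  using ideal.I_l_closed [OF ideal_I, of x \<phi>] by simp

lemma I_right: "x \<in> I \<Longrightarrow> Poly_Mapping.keys \<phi> \<subseteq> lists (hecke_gens n) \<Longrightarrow> x * \<phi> \<in> I"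
  using ideal.I_r_closed [OF ideal_I, of x \<phi>] by simp

lemma I_scale: "x \<in> I \<Longrightarrow> const c * x \<in> I"
  by (rule I_left) simp_all

lemma I_minus: "x \<in> I \<Longrightarrow> - x \<in> I"
  using I_scale [of x "- 1"] by (simp add: const_minus)

lemma content_first:
  assumes "Y \<in> standard_tableaux m n"
  obtains k where "k \<in> {1..m}" "content q v Y 1 = v k"
proof -
  obtain k where k: "k \<in> {1..m}" "node_of Y 1 = (k, 1, 1)" by (rule standard_first_node [OF assms n_pos])
  then have "content q v Y 1 = v k" by (simp add: content_def)
  with k(1) show thesis by (rule that)
qed

text \<open>On a nonempty word \<open>\<tau>\<close> is the scalar \<open>content q v Y 1\<close>,
  so a polynomial in \<open>\<tau>\<close> acts by its value at this scalar.\<close>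

lemma act_cyclotomic:
  "act (prod_list (map (\<lambda>j. \<tau> - const (v j)) js)) f (Y # w) =
     const (prod_list (map (\<lambda>j. content q v Y 1 - v j) js)) * f (Y # w)"
  by (induction js) (simp_all add: act_mult act_diff_left const_mult const_diff mult.assoc left_diff_distrib)

section \<open>The Hecke relations at a word with one more letter\<close>

context
  fixes Y assumes Y: "Y \<in> standard_tableaux m n"
begin

lemma exchange_coeff_swap:
  assumes "i \<in> {1..n}" "j \<in> {1..n}" "i < j" "j \<le> i + 2"
  shows "exchange_coeff q v Y j i = - (q - inverse q) - exchange_coeff q v Y i j"
  using exchange_coeff_add [OF standard_separated [OF adm Y assms]] by (simp add: algebra_simps)

lemma exchangeable_cases:
  assumes "i \<in> {1..n - 1}"
  shows "(of_bool (exchangeable i Y) :: 'k) = 1 \<or>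
    (of_bool (exchangeable i Y) :: 'k) = 0 \<and>
      (exchange_coeff q v Y i (i + 1))\<^sup>2 + (q - inverse q) * exchange_coeff q v Y i (i + 1) = 1"
  using same_line_exchange_coeff [OF adm Y assms] by (auto simp: exchangeable_def)

lemma act_quadratic_Cons:
  assumes i: "i \<in> {1..n - 1}"
  shows "\<exists>e. \<forall>f w. act (\<sigma> i * \<sigma> i - (const (q - inverse q) * \<sigma> i + 1)) f (Y # w) =
     const e * act (\<sigma> i * \<sigma> i - (const (q - inverse q) * \<sigma> i + 1)) (\<lambda>u. f (Y # u)) w"
proof (intro exI allI)
  fix f w
  show "act (\<sigma> i * \<sigma> i - (const (q - inverse q) * \<sigma> i + 1)) f (Y # w) =
     const (of_bool (exchangeable i Y)) * act (\<sigma> i * \<sigma> i - (const (q - inverse q) * \<sigma> i + 1)) (\<lambda>u. f (Y # u)) w"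
    unfolding act_diff_left act_add_left act_mult act_const act_gen_eq act_one
    by (rule quadratic_step [where Y' = "move (Sigma i) Y" and a = "exchange_coeff q v Y i (i + 1)"
          and b = "exchange_coeff q v Y (i + 1) i"])
      (use i exchange_coeff_swap [of i "i + 1"] exchangeable_cases [OF i] in auto)
qed

lemma act_braid_Cons:
  assumes i: "i \<in> {1..n - 1}" "i + 1 \<in> {1..n - 1}"
  defines "qi \<equiv> \<sigma> i * \<sigma> i - (const (q - inverse q) * \<sigma> i + 1)"
    and "qj \<equiv> \<sigma> (i + 1) * \<sigma> (i + 1) - (const (q - inverse q) * \<sigma> (i + 1) + 1)"
    and "b \<equiv> \<sigma> i * \<sigma> (i + 1) * \<sigma> i - \<sigma> (i + 1) * \<sigma> i * \<sigma> (i + 1)"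
  shows "\<exists>Z c1 c2 c3 c4 c5. \<forall>f w. act b f (Y # w) =
     const c1 * act b (\<lambda>u. f (Z # u)) w + const c2 * act qi (\<lambda>u. f (Z # u)) w + const c3 * act qj (\<lambda>u. f (Z # u)) w
     + const c4 * act qi (\<lambda>u. f (Y # u)) w + const c5 * act qj (\<lambda>u. f (Y # u)) w"
proof (intro exI allI)
  fix f w
  let ?S = "Sigma i" and ?T = "Sigma (i + 1)"
  let ?N = "node_of Y" and ?f = "exchange_coeff q v Y"
  let ?e = "\<lambda>j k. of_bool (\<not> same_line (?N j) (?N k)) :: 'k"
  have nz: "(1 :: nat) \<le> i" "i + 2 \<le> n" using i by auto
  have same: "same_line (?N (i + 1)) (?N i) = same_line (?N i) (?N (i + 1))"
    "same_line (?N (i + 2)) (?N i) = same_line (?N i) (?N (i + 2))"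
    "same_line (?N (i + 2)) (?N (i + 1)) = same_line (?N (i + 1)) (?N (i + 2))"
    by (rule same_line_sym)+
  have t: "transpose i (i + 1) (i + 2) = i + 2" "transpose (i + 1) (i + 2) i = i"
    by simp_all
  \<comment> \<open>The identity also involves the pair \<open>i\<close>, \<open>i + 2\<close>,
    hence separation at distance two.\<close>
  have mult: "?f i (i + 1) * ?f (i + 1) (i + 2) = ?f i (i + 2) * (?f i (i + 1) + ?f (i + 1) (i + 2) + (q - inverse q))"
    by (rule exchange_coeff_mult; rule standard_separated [OF adm Y]) (use nz in auto)
  \<comment> \<open>Let \<open>a\<close>, \<open>b\<close>, \<open>c\<close> be the nodes of
    \<open>i\<close>, \<open>i + 1\<close>, \<open>i + 2\<close> in \<open>Y\<close>. The witness
    \<open>Z\<close> is \<open>Y\<close> with \<open>i\<close> and \<open>i + 2\<close>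
    interchanged, reached along either side of the braid relation; the coefficients are those of
    \<open>braid_step\<close>.\<close>
  show "act b f (Y # w) =
     const (?e i (i + 1) * ?e i (i + 2) * ?e (i + 1) (i + 2)) * act b (\<lambda>u. f (move ?S (move ?T (move ?S Y)) # u)) w
     + const (?e i (i + 1) * ?e i (i + 2) * ?e (i + 1) (i + 2) * ?f i (i + 2)) * act qi (\<lambda>u. f (move ?S (move ?T (move ?S Y)) # u)) w
     + const (- (?e i (i + 1) * ?e i (i + 2) * ?e (i + 1) (i + 2) * ?f i (i + 2))) * act qj (\<lambda>u. f (move ?S (move ?T (move ?S Y)) # u)) w
     + const (- (?e i (i + 1) * ?f i (i + 2))) * act qi (\<lambda>u. f (Y # u)) w
     + const (?e (i + 1) (i + 2) * ?f i (i + 2)) * act qj (\<lambda>u. f (Y # u)) w"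
    unfolding b_def qi_def qj_def act_diff_left act_add_left act_mult act_const act_gen_eq act_one
  proof (rule braid_step [where bac = "move ?S Y" and acb = "move ?T Y" and cab = "move ?S (move ?T Y)"
          and bca = "move ?T (move ?S Y)" and ba = "?f (i + 1) i" and cb = "?f (i + 2) (i + 1)"
          and ab = "?f i (i + 1)" and bc = "?f (i + 1) (i + 2)"])
    show "move ?T (move ?S (move ?T Y)) = move ?S (move ?T (move ?S Y))"
      using permute_braid [of i Y] by simp
    show "?f (i + 1) i = - (q - inverse q) - ?f i (i + 1)" "?f (i + 2) (i + 1) = - (q - inverse q) - ?f (i + 1) (i + 2)"
      by (rule exchange_coeff_swap; use nz in simp)+
    show "?f i (i + 1) * ?f (i + 1) (i + 2) = ?f i (i + 2) * (?f i (i + 1) + ?f (i + 1) (i + 2) + (q - inverse q))"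
      by (rule mult)
    show "?e i (i + 1) = 1 \<or> ?e i (i + 1) = 0 \<and> (?f i (i + 1))\<^sup>2 + (q - inverse q) * ?f i (i + 1) = 1"
      using exchangeable_cases [OF i(1)] by (simp add: exchangeable_def)
    show "?e (i + 1) (i + 2) = 1 \<or> ?e (i + 1) (i + 2) = 0 \<and> (?f (i + 1) (i + 2))\<^sup>2 + (q - inverse q) * ?f (i + 1) (i + 2) = 1"
      using exchangeable_cases [OF i(2)] by (simp add: exchangeable_def)
  qed (use same t in \<open>simp_all add: exchangeable_def\<close>)
qed

lemma act_commuting_Cons:
  assumes "i \<in> {1..n - 1}" "j \<in> {1..n - 1}" "\<bar>int i - int j\<bar> > 1"
  shows "\<exists>Z c. \<forall>f w. act (\<sigma> i * \<sigma> j - \<sigma> j * \<sigma> i) f (Y # w) =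
    const c * act (\<sigma> i * \<sigma> j - \<sigma> j * \<sigma> i) (\<lambda>u. f (Z # u)) w"
proof (intro exI allI)
  fix f w
  have neq: "j \<noteq> i" "j \<noteq> Suc i" "i \<noteq> Suc j" "Suc i \<noteq> j" "Suc j \<noteq> i" "i \<noteq> j"
    using assms(3) by auto
  show "act (\<sigma> i * \<sigma> j - \<sigma> j * \<sigma> i) f (Y # w) =
    const (of_bool (exchangeable i Y) * of_bool (exchangeable j Y)) *
      act (\<sigma> i * \<sigma> j - \<sigma> j * \<sigma> i) (\<lambda>u. f (move (Sigma j) (move (Sigma i) Y) # u)) w"
    unfolding act_diff_left act_mult act_gen_eq
    by (rule commuting_step [where ?Y1.0 = "move (Sigma i) Y" and ?Y2.0 = "move (Sigma j) Y"
          and a = "exchange_coeff q v Y i (i + 1)" and b = "exchange_coeff q v Y j (j + 1)"])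
      (use neq permute_commute [OF assms(3), of Y] in \<open>simp_all add: exchangeable_def\<close>)
qed

lemma act_mixed_Cons:
  assumes "n \<ge> 2"
  shows "act (\<tau> * \<sigma> 1 * \<tau> * \<sigma> 1 - \<sigma> 1 * \<tau> * \<sigma> 1 * \<tau>) f (Y # w) = 0"
proof -
  have "content q v Y 1 * exchange_coeff q v Y 1 2 + content q v Y 2 * exchange_coeff q v Y 2 1 = 0"
    by (rule content_exchange_coeff, rule standard_separated [OF adm Y]) (use assms in auto)
  then have "gen_act Tau (gen_act (Sigma 1) (gen_act Tau (gen_act (Sigma 1) f))) (Y # w) =
      gen_act (Sigma 1) (gen_act Tau (gen_act (Sigma 1) (gen_act Tau f))) (Y # w)"
    by (intro mixed_step [where Y' = "move (Sigma 1) Y" and a = "exchange_coeff q v Y 1 2"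
          and b = "exchange_coeff q v Y 2 1" and e = "of_bool (exchangeable 1 Y)" and x = "content q v Y 1" and y = "content q v Y 2"])
      (simp_all add: numeral_2_eq_2)
  then show ?thesis
    unfolding act_diff_left act_mult act_gen_eq by simp
qed

lemma act_tau_commuting_Cons:
  assumes "i > 1"
  shows "act (\<tau> * \<sigma> i - \<sigma> i * \<tau>) f (Y # w) = 0"
proof -
  have "gen_act Tau (gen_act (Sigma i) f) (Y # w) = gen_act (Sigma i) (gen_act Tau f) (Y # w)"
    by (rule diagonal_commuting_step [where Y' = "move (Sigma i) Y" and x = "content q v Y 1"]) (use assms in simp_all)
  then show ?thesis
    unfolding act_diff_left act_mult act_gen_eq by simp
qed

end

text \<open>At the empty word the action multiplies \<open>f []\<close> by \<open>r\<close>, and the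
  two-sided ideal absorbs this right factor. Both \<open>r\<close> and \<open>f\<close> vary in the
  induction: a braid relation calls on quadratic relations at the shorter word, and \<open>f\<close>
  is read there behind a fixed first letter.\<close>

lemma act_relation_mem:
  assumes "r \<in> hecke_relations m n q v" "\<And>u. Poly_Mapping.keys (f u) \<subseteq> lists (hecke_gens n)"
    "w \<in> lists (standard_tableaux m n)"
  shows "act r f w \<in> I"
  using assms
proof (induction w arbitrary: r f)
  case Nil
  then show ?case using I_right [OF I_relation] by simp
next
  case (Cons Y w)
  have Y: "Y \<in> standard_tableaux m n" and w: "w \<in> lists (standard_tableaux m n)" using Cons.prems by auto
  have IH: "const c * act r (\<lambda>u. f (Z # u)) w \<in> I" if "r \<in> hecke_relations m n q v" for r Z c
    using Cons.IH [OF that, of "\<lambda>u. f (Z # u)"] Cons.prems(2) w by (intro I_scale) simp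
  have quadratic: "\<sigma> i * \<sigma> i - (const (q - inverse q) * \<sigma> i + 1) \<in> hecke_relations m n q v"
    if "i \<in> {1..n - 1}" for i
    using that unfolding hecke_relations_def by blast
  from Cons.prems(1) show ?case
  proof (cases rule: hecke_relations_cases)
    case (braid i)
    obtain Z c1 c2 c3 c4 c5 where eq: "act r f (Y # w) = const c1 * act r (\<lambda>u. f (Z # u)) w
       + const c2 * act (\<sigma> i * \<sigma> i - (const (q - inverse q) * \<sigma> i + 1)) (\<lambda>u. f (Z # u)) w
       + const c3 * act (\<sigma> (i + 1) * \<sigma> (i + 1) - (const (q - inverse q) * \<sigma> (i + 1) + 1)) (\<lambda>u. f (Z # u)) w
       + const c4 * act (\<sigma> i * \<sigma> i - (const (q - inverse q) * \<sigma> i + 1)) (\<lambda>u. f (Y # u)) w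
       + const c5 * act (\<sigma> (i + 1) * \<sigma> (i + 1) - (const (q - inverse q) * \<sigma> (i + 1) + 1)) (\<lambda>u. f (Y # u)) w"
      using act_braid_Cons [OF Y braid(2,3)] unfolding braid(1) by blast
    show ?thesis
      unfolding eq by (intro I_add IH Cons.prems(1) quadratic braid(2,3))
  next
    case (commuting i j)
    obtain Z c where "act r f (Y # w) = const c * act r (\<lambda>u. f (Z # u)) w"
      using act_commuting_Cons [OF Y commuting(2-4)] unfolding commuting(1) by blast
    then show ?thesis using IH [OF Cons.prems(1)] by simp
  next
    case mixed
    then show ?thesis using act_mixed_Cons [OF Y] I_zero by simp
  next
    case (tau i)
    then show ?thesis using act_tau_commuting_Cons [OF Y] I_zero by simp
  next
    case (quadratic i)
    obtain e where "act r f (Y # w) = const e * act r (\<lambda>u. f (Y # u)) w"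
      using act_quadratic_Cons [OF Y quadratic(2)] unfolding quadratic(1) by blast
    then show ?thesis using IH [OF Cons.prems(1)] by simp
  next
    case cyclotomic
    obtain k where "k \<in> {1..m}" "content q v Y 1 = v k" by (rule content_first [OF Y])
    then have "0 \<in> set (map (\<lambda>j. content q v Y 1 - v j) [1..<m + 1])"
      unfolding set_map by (intro image_eqI [of _ _ k]) auto
    then have "prod_list (map (\<lambda>j. content q v Y 1 - v j) [1..<m + 1]) = 0"
      by (simp only: prod_list_zero_iff)
    then show ?thesis unfolding cyclotomic act_cyclotomic using I_zero by simp
  qed
qed

text \<open>The elements whose action has values in \<open>I\<close> form an ideal: in
  \<open>\<phi> * r\<close> the factor \<open>\<phi>\<close> acts on an \<open>I\<close>-valued
  function, and in \<open>r * \<phi>\<close> the factor \<open>r\<close> acts on another function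
  with values in \<open>F\<close>. It contains the relations, hence the ideal generated by
  them.\<close>

lemma act_ideal_mem:
  assumes "r \<in> I" "\<And>u. Poly_Mapping.keys (f u) \<subseteq> lists (hecke_gens n)" "w \<in> lists (standard_tableaux m n)"
  shows "act r f w \<in> I"
proof -
  let ?T = "standard_tableaux m n" and ?carr = "\<lambda>f. \<forall>u. Poly_Mapping.keys (f u) \<subseteq> lists (hecke_gens n)"
  define K where "K = {r \<in> carrier F. \<forall>f w. ?carr f \<longrightarrow> w \<in> lists ?T \<longrightarrow> act r f w \<in> I}"
  have K: "r \<in> K \<longleftrightarrow> Poly_Mapping.keys r \<subseteq> lists (hecke_gens n) \<and>
      (\<forall>f w. ?carr f \<longrightarrow> w \<in> lists ?T \<longrightarrow> act r f w \<in> I)" for r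
    by (simp add: K_def)
  interpret F: ring F by (rule ring_free_algebra)
  have "ideal K F"
  proof (rule idealI)
    show "subgroup K (add_monoid F)"
    proof (rule F.a_group [THEN group.subgroupI])
      show "K \<subseteq> carrier (add_monoid F)" by (auto simp: K_def)
      have "0 \<in> K" by (simp add: K I_zero)
      then show "K \<noteq> {}" by blast
    next
      fix x assume x: "x \<in> K"
      have "\<ominus>\<^bsub>F\<^esub> x = const (- 1) * x"
      proof (rule F.minus_equality)
        show "const (- 1) * x \<oplus>\<^bsub>F\<^esub> x = \<zero>\<^bsub>F\<^esub>" by (simp add: const_minus)
      qed (use x in \<open>simp_all add: K keys_mult_lists\<close>)
      moreover have "const (- 1) * x \<in> K"
        using x I_scale by (simp add: K keys_mult_lists act_scale_left)
      ultimately show "inv\<^bsub>add_monoid F\<^esub> x \<in> K" by (simp add: a_inv_def)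
    next
      fix x y assume "x \<in> K" "y \<in> K"
      then show "x \<otimes>\<^bsub>add_monoid F\<^esub> y \<in> K"
        by (simp add: K keys_add_lists act_add_left I_add)
    qed
  next
    fix r \<phi> assume r: "r \<in> K" and "\<phi> \<in> carrier F"
    then have \<phi>: "Poly_Mapping.keys \<phi> \<subseteq> lists (hecke_gens n)" by simp
    have "act (\<phi> * r) f w \<in> I" if "?carr f" "w \<in> lists ?T" for f w
      unfolding act_mult using r that by (intro act_mem [OF I_zero I_add I_left \<phi>]) (auto simp: K)
    then show "\<phi> \<otimes>\<^bsub>F\<^esub> r \<in> K" using r \<phi> by (simp add: K keys_mult_lists)
    have "act (r * \<phi>) f w \<in> I" if "?carr f" "w \<in> lists ?T" for f w
      unfolding act_mult using r that act_keys [OF \<phi>, of f] by (simp add: K)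
    then show "r \<otimes>\<^bsub>F\<^esub> \<phi> \<in> K" using r \<phi> by (simp add: K keys_mult_lists)
  qed (rule ring_free_algebra)
  moreover have "hecke_relations m n q v \<subseteq> K"
    using act_relation_mem hecke_relations_closed unfolding K_def by blast
  ultimately have "I \<subseteq> K" unfolding hecke_ideal_def by (rule F.genideal_minimal)
  then show ?thesis using assms K by blast
qed

end

section \<open>Existence and uniqueness of the product\<close>

context closed_exchange_rules
begin

text \<open>Splitting off one word of the support at a time reduces additive statements about
  tensors to pure words.\<close>

lemma tensors_induct [consumes 1, case_names zero word add]:
  assumes "a \<in> carrier (tensors mul)"
    and zero: "P (\<lambda>u. 0)"
    and word: "\<And>x \<phi>. x \<in> lists T \<Longrightarrow> Poly_Mapping.keys \<phi> \<subseteq> lists G \<Longrightarrow> P (pure_word x \<phi>)"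
    and add: "\<And>a b. a \<in> carrier (tensors mul) \<Longrightarrow> b \<in> carrier (tensors mul) \<Longrightarrow> P a \<Longrightarrow> P b \<Longrightarrow> P (\<lambda>u. a u + b u)"
  shows "P a"
proof -
  have "finite {u. a u \<noteq> 0}" using assms(1) by simp
  then show ?thesis using assms(1)
  proof (induction "{u. a u \<noteq> 0}" arbitrary: a rule: finite_psubset_induct)
    case psubset
    show ?case
    proof (cases "{u. a u \<noteq> 0} = {}")
      case True
      then have "a = (\<lambda>u. 0)" by auto
      then show ?thesis using zero by simp
    next
      case False
      then obtain x where x: "a x \<noteq> 0" by blast
      let ?b = "a(x := 0)"
      have sub: "{u. ?b u \<noteq> 0} \<subset> {u. a u \<noteq> 0}" using x by auto
      have b: "?b \<in> carrier (tensors mul)"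
        using psubset.prems finite_subset [of "{u. ?b u \<noteq> 0}" "{u. a u \<noteq> 0}"] sub by auto
      have xT: "x \<in> lists T" and k: "Poly_Mapping.keys (a x) \<subseteq> lists G" using psubset.prems x by auto
      have "a = (\<lambda>u. pure_word x (a x) u + ?b u)" by (auto simp: pure_word_def)
      moreover have "P (\<lambda>u. pure_word x (a x) u + ?b u)"
        by (rule add [OF pure_word_closed [OF xT k] b word [OF xT k] psubset.hyps(2) [OF sub b]])
      ultimately show ?thesis by simp
    qed
  qed
qed

end

context hecke_parameters
begin

text \<open>The recursion is indexed by the letter being read, the relation by the letter being
  crossed, and this reconciles them. Whether the exchange term vanishes is decided by
  \<open>exchangeable\<close> in one and by standardness in the other; these agree by
  \<open>standard_permute_iff\<close>.\<close>

lemma exchange_relation: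
  assumes X: "X \<in> standard_tableaux m n" and i: "i \<in> {1..n - 1}"
  shows "act (\<sigma> i + const (exchange_coeff q v X i (i + 1))) (pure_word [X] 1) =
    smash_tensor n (tableau_gen m n (permute_tableau (transpose i (i + 1)) X))
      (\<sigma> i + const (exchange_coeff q v X (i + 1) i))"
    (is "?lhs = ?rhs")
proof
  fix w
  let ?t = "permute_tableau (transpose i (i + 1))"
  have eq: "Y = ?t X \<longleftrightarrow> ?t Y = X" for Y
    using permute_transpose_involutory by metis
  have ex: "exchangeable i X \<longleftrightarrow> ?t X \<in> standard_tableaux m n"
    using standard_permute_iff [OF X i] by (simp add: exchangeable_def)
  have rhs: "?rhs = (if exchangeable i X then pure_word [?t X] (\<sigma> i + const (exchange_coeff q v X (i + 1) i)) else (\<lambda>u. 0))"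
    by (auto simp: tableau_gen_def ex pure_tensor_gen)
  \<comment> \<open>The case rule of \<open>remdups_adj\<close> merely distinguishes words of length
    zero, one and more; only length one can give a nonzero value.\<close>
  show "?lhs w = ?rhs w"
  proof (cases w rule: remdups_adj.cases)
    case 1
    then show ?thesis unfolding rhs by simp
  next
    case (2 Y)
    have "(\<lambda>u. pure_word [X] 1 (?t Y # u)) = (if X = ?t Y then pure_word [] 1 else (\<lambda>u. 0))"
      by (rule pure_word_Cons)
    \<comment> \<open>If \<open>?t\<close> fixed \<open>X\<close>, the terms at \<open>X\<close> and
      at \<open>?t X\<close> would fall on one word; the two coefficients would then
      coincide.\<close>
    moreover have "exchange_coeff q v X i (Suc i) = exchange_coeff q v X (Suc i) i" if "?t X = X"
    proof -
      have "exchange_coeff q v (?t X) i (i + 1) = exchange_coeff q v X (i + 1) i" by simp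
      then show ?thesis unfolding that by simp
    qed
    ultimately show ?thesis
      using 2 eq [of Y] unfolding rhs
      by (auto simp: act_add_left pure_word_def [of "[_]"] const_minus exchangeable_def same_line_sym)
  next
    case (3 Y Z u)
    then have "?lhs w = 0" by (intro act_length) (auto simp: pure_word_def)
    then show ?thesis using 3 unfolding rhs by (simp add: pure_word_def)
  qed
qed

lemma tau_relation: "act (\<tau> - const (content q v X 1)) (pure_word [X] 1) = (\<lambda>u. 0)"
proof
  fix w
  show "act (\<tau> - const (content q v X 1)) (pure_word [X] 1) w = 0"
    by (cases w) (auto simp: act_diff_left pure_word_def)
qed

lemma smash_product_smash: "smash_product m n q v smash"
  unfolding smash_product_def
proof (intro conjI ballI)
  fix X i assume "X \<in> standard_tableaux m n" "i \<in> {1..n - 1}"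
  then show "smash (smash_tensor n 1 (\<sigma> i + const (exchange_coeff q v X i (i + 1)))) (smash_tensor n (tableau_gen m n X) 1) =
      smash (smash_tensor n (tableau_gen m n (permute_tableau (transpose i (i + 1)) X)) 1)
        (smash_tensor n 1 (\<sigma> i + const (exchange_coeff q v X (i + 1) i)))"
    unfolding smash_pure_tensor mult_1_right
    by (simp only: pure_tensor_one smash_pure_word_Nil tableau_gen_def [of m n X] if_True pure_tensor_gen exchange_relation)
next
  fix X assume "X \<in> standard_tableaux m n"
  then show "smash (smash_tensor n 1 (\<tau> - const (content q v X 1))) (smash_tensor n (tableau_gen m n X) 1) =
      \<zero>\<^bsub>smash_algebra m n smash\<^esub>"
    using tau_relation by (simp add: pure_tensor_one smash_pure_word_Nil tableau_gen_def pure_tensor_gen)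
next
  fix x :: "tableau list \<Rightarrow>\<^sub>0 'k" and \<phi> :: "hecke_gen list \<Rightarrow>\<^sub>0 'k"
  show "smash (smash_tensor n x 1) (smash_tensor n 1 \<phi>) = smash_tensor n x \<phi>"
    by (simp add: smash_pure_tensor)
qed (rule assoc_algebra_smash embedding_letters embedding_coefficients)+

section \<open>Consequences of the relations for an arbitrary product\<close>

context
  fixes mul
  assumes mul: "smash_product m n q v mul"
begin

lemma product_ring: "ring (tensors mul)"
  using mul unfolding smash_product_def assoc_algebra_def by blast

lemma product_closed:
  "a \<in> carrier (tensors mul) \<Longrightarrow> b \<in> carrier (tensors mul) \<Longrightarrow> mul a b \<in> carrier (tensors mul)"
  using ring.ring_simprules(5) [OF product_ring, of a b] by (simp only: tensor_algebra_free_simps(2))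

lemma product_assoc:
  "a \<in> carrier (tensors mul) \<Longrightarrow> b \<in> carrier (tensors mul) \<Longrightarrow> c \<in> carrier (tensors mul) \<Longrightarrow>
     mul (mul a b) c = mul a (mul b c)"
  using ring.ring_simprules(11) [OF product_ring, of a b c] by (simp only: tensor_algebra_free_simps(2))

lemma product_add_left:
  "a \<in> carrier (tensors mul) \<Longrightarrow> b \<in> carrier (tensors mul) \<Longrightarrow> c \<in> carrier (tensors mul) \<Longrightarrow>
     mul (\<lambda>u. a u + b u) c = (\<lambda>u. mul a c u + mul b c u)"
  using ring.ring_simprules(13) [OF product_ring, of a b c] by (simp only: tensor_algebra_free_simps(2,5))

lemma product_add_right:
  "a \<in> carrier (tensors mul) \<Longrightarrow> b \<in> carrier (tensors mul) \<Longrightarrow> c \<in> carrier (tensors mul) \<Longrightarrow>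
     mul c (\<lambda>u. a u + b u) = (\<lambda>u. mul c a u + mul c b u)"
  using ring.ring_simprules(23) [OF product_ring, of a b c] by (simp only: tensor_algebra_free_simps(2,5))

lemma product_zero:
  "a \<in> carrier (tensors mul) \<Longrightarrow> mul (\<lambda>u. 0) a = (\<lambda>u. 0)"
  "a \<in> carrier (tensors mul) \<Longrightarrow> mul a (\<lambda>u. 0) = (\<lambda>u. 0)"
  using ring.ring_simprules(24,25) [OF product_ring, of a] by (simp_all only: tensor_algebra_free_simps(2,4))

lemma product_scale_left:
  "a \<in> carrier (tensors mul) \<Longrightarrow> b \<in> carrier (tensors mul) \<Longrightarrow>
     mul (\<lambda>u. const c * a u) b = (\<lambda>u. const c * mul a b u)"
  using assoc_algebra.smult_mult_left [of scalars "tensors mul" c a b] mul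
  unfolding smash_product_def by (simp only: tensor_algebra_free_simps(2,6) scalars_simps UNIV_I)

lemma product_const_left:
  assumes "a \<in> carrier (tensors mul)"
  shows "mul (pure_word [] (const c)) a = (\<lambda>u. const c * a u)"
proof -
  have one: "pure_word [] 1 \<in> carrier (tensors mul)" by (rule pure_word_closed) simp_all
  have eq: "pure_word [] (const c) = (\<lambda>u. const c * pure_word [] 1 u)" by (auto simp: pure_word_def)
  have "mul (pure_word [] 1) a = a"
    using ring.ring_simprules(12) [OF product_ring assms] by (simp only: tensor_algebra_free_simps(2,3))
  then show ?thesis unfolding eq using product_scale_left [OF one assms] by simp
qed

lemma product_coefficients:
  assumes "Poly_Mapping.keys \<phi> \<subseteq> lists (hecke_gens n)" "Poly_Mapping.keys \<psi> \<subseteq> lists (hecke_gens n)"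
  shows "mul (pure_word [] \<phi>) (pure_word [] \<psi>) = pure_word [] (\<phi> * \<psi>)"
proof -
  have "(\<lambda>\<phi>. smash_tensor n 1 \<phi>) \<in> ring_hom F (tensors mul)"
    using mul unfolding smash_product_def algebra_embedding_def by blast
  from ring_hom_mult [OF this, of \<phi> \<psi>] assms show ?thesis by (simp add: pure_tensor_one)
qed

lemma product_letters:
  assumes "Poly_Mapping.keys x \<subseteq> lists (standard_tableaux m n)" "Poly_Mapping.keys y \<subseteq> lists (standard_tableaux m n)"
  shows "mul (smash_tensor n x 1) (smash_tensor n y 1) = smash_tensor n (x * y) 1"
proof -
  have "(\<lambda>x. smash_tensor n x 1) \<in> ring_hom (free_algebra (standard_tableaux m n)) (tensors mul)"
    using mul unfolding smash_product_def algebra_embedding_def by blast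
  from ring_hom_mult [OF this, of x y] assms show ?thesis by simp
qed

lemma product_tensor:
  assumes "Poly_Mapping.keys x \<subseteq> lists (standard_tableaux m n)" "Poly_Mapping.keys \<phi> \<subseteq> lists (hecke_gens n)"
  shows "mul (smash_tensor n x 1) (pure_word [] \<phi>) = smash_tensor n x \<phi>"
  using mul assms unfolding smash_product_def by (simp add: pure_tensor_one)

lemma smash_tensor_word: "smash_tensor n (Poly_Mapping.single x 1) \<phi> = pure_word x (\<phi> :: _ \<Rightarrow>\<^sub>0 'k)"
  by (simp add: pure_tensor_single)

lemma keys_single_lists:
  "x \<in> lists S \<Longrightarrow> Poly_Mapping.keys (Poly_Mapping.single x (1 :: 'k)) \<subseteq> lists S"
  by simp

text \<open>In any admissible product a pure word is its letters times its coefficient;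
  associativity regroups the factors.\<close>

lemma product_word:
  assumes "X \<in> standard_tableaux m n" "x \<in> lists (standard_tableaux m n)"
    "Poly_Mapping.keys \<phi> \<subseteq> lists (hecke_gens n)"
  shows "mul (pure_word [X] 1) (pure_word x \<phi>) = pure_word (X # x) \<phi>"
proof -
  have split: "pure_word y \<phi> = mul (pure_word y 1) (pure_word [] \<phi>)" if "y \<in> lists (standard_tableaux m n)" for y
    using product_tensor [OF keys_single_lists [OF that] assms(3)] by (simp only: smash_tensor_word)
  have "mul (pure_word [X] 1) (pure_word x \<phi>) = mul (mul (pure_word [X] 1) (pure_word x 1)) (pure_word [] \<phi>)"
    unfolding split [OF assms(2)]
    by (rule product_assoc [symmetric]; rule pure_word_closed) (use assms in simp_all)
  also have "mul (pure_word [X] 1) (pure_word x 1) = pure_word (X # x) 1"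
    using product_letters [OF keys_single_lists [of "[X]"] keys_single_lists [OF assms(2)]] assms(1)
    by (simp add: pure_tensor_single mult_single plus_list_def)
  also have "mul (pure_word (X # x) 1) (pure_word [] \<phi>) = pure_word (X # x) \<phi>"
    using split [of "X # x"] assms by simp
  finally show ?thesis .
qed

text \<open>Solving the relation for the product with \<open>\<sigma> i\<close> expresses its effect
  on \<open>X\<close> times \<open>b\<close> by its effect on \<open>b\<close>. This recursion
  determines the product on words.\<close>

lemma product_sigma:
  assumes X: "X \<in> standard_tableaux m n" and i: "i \<in> {1..n - 1}" and b: "b \<in> carrier (tensors mul)"
  shows "mul (pure_word [] (\<sigma> i)) (mul (pure_word [X] 1) b) =
    (\<lambda>u. mul (smash_tensor n (tableau_gen m n (permute_tableau (transpose i (i + 1)) X)) 1)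
           (\<lambda>u. mul (pure_word [] (\<sigma> i)) b u + const (exchange_coeff q v X (i + 1) i) * b u) u
       - const (exchange_coeff q v X i (i + 1)) * mul (pure_word [X] 1) b u)"
proof -
  let ?e = "exchange_coeff q v X i (i + 1)" and ?e' = "exchange_coeff q v X (i + 1) i"
  let ?z = "smash_tensor n (tableau_gen m n (permute_tableau (transpose i (i + 1)) X)) 1"
  have s: "Poly_Mapping.keys (\<sigma> i :: _ \<Rightarrow>\<^sub>0 'k) \<subseteq> lists (hecke_gens n)"
    using i by (auto simp: hecke_gens_def)
  have closed: "pure_word [] (\<sigma> i) \<in> carrier (tensors mul)" "pure_word [X] 1 \<in> carrier (tensors mul)"
    "pure_word [] (const c) \<in> carrier (tensors mul)" "pure_word [] (\<sigma> i + const c) \<in> carrier (tensors mul)" for c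
    by (rule pure_word_closed; use X s keys_add_lists [OF s keys_const_lists] in simp)+
  have z: "?z \<in> carrier (tensors mul)"
    by (rule pure_tensor_closed) (simp_all add: tableau_gen_def)
  have shift: "mul (pure_word [] (\<sigma> i + const c)) a = (\<lambda>u. mul (pure_word [] (\<sigma> i)) a u + const c * a u)"
    if "a \<in> carrier (tensors mul)" for a c
    unfolding pure_word_add using product_add_left [OF closed(1,3) that, of c] product_const_left [OF that, of c] by simp
  have rel: "mul (pure_word [] (\<sigma> i + const ?e)) (pure_word [X] 1) = mul ?z (pure_word [] (\<sigma> i + const ?e'))"
  proof -
    have "mul (smash_tensor n 1 (\<sigma> i + const ?e)) (smash_tensor n (tableau_gen m n X) 1) =
        mul ?z (smash_tensor n 1 (\<sigma> i + const ?e'))"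
      using mul X i unfolding smash_product_def by blast
    then show ?thesis using X by (simp add: pure_tensor_one tableau_gen_def [of m n X] pure_tensor_gen)
  qed
  have "(\<lambda>u. mul (pure_word [] (\<sigma> i)) (mul (pure_word [X] 1) b) u + const ?e * mul (pure_word [X] 1) b u) =
      mul (mul (pure_word [] (\<sigma> i + const ?e)) (pure_word [X] 1)) b"
    using shift [OF product_closed [OF closed(2) b]] product_assoc [OF closed(4,2) b] by simp
  also have "\<dots> = mul ?z (mul (pure_word [] (\<sigma> i + const ?e')) b)"
    unfolding rel by (rule product_assoc [OF z closed(4) b])
  also have "\<dots> = mul ?z (\<lambda>u. mul (pure_word [] (\<sigma> i)) b u + const ?e' * b u)"
    by (simp only: shift [OF b])
  finally show ?thesis
    by (simp add: fun_eq_iff eq_diff_eq)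
qed

lemma product_tau:
  assumes X: "X \<in> standard_tableaux m n" and b: "b \<in> carrier (tensors mul)"
  shows "mul (pure_word [] \<tau>) (mul (pure_word [X] 1) b) = (\<lambda>u. const (content q v X 1) * mul (pure_word [X] 1) b u)"
proof -
  let ?c = "content q v X 1"
  have t: "Poly_Mapping.keys (\<tau> :: _ \<Rightarrow>\<^sub>0 'k) \<subseteq> lists (hecke_gens n)"
    by (auto simp: hecke_gens_def)
  have closed: "pure_word [] \<tau> \<in> carrier (tensors mul)" "pure_word [X] 1 \<in> carrier (tensors mul)"
    "pure_word [] (const c) \<in> carrier (tensors mul)" "pure_word [] (\<tau> + const c) \<in> carrier (tensors mul)" for c
    by (rule pure_word_closed; use X t keys_add_lists [OF t keys_const_lists] in simp)+
  have tc: "\<tau> - const ?c = \<tau> + const (- ?c)" by (simp add: const_minus)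
  have "mul (smash_tensor n 1 (\<tau> - const ?c)) (smash_tensor n (tableau_gen m n X) 1) = (\<lambda>u. 0)"
    using mul X unfolding smash_product_def by simp
  then have rel: "mul (pure_word [] (\<tau> + const (- ?c))) (pure_word [X] 1) = (\<lambda>u. 0)"
    unfolding tc using X by (simp add: pure_tensor_one tableau_gen_def pure_tensor_gen)
  let ?b = "mul (pure_word [X] 1) b"
  have b': "?b \<in> carrier (tensors mul)" by (rule product_closed [OF closed(2) b])
  have "(\<lambda>u. mul (pure_word [] \<tau>) ?b u + const (- ?c) * ?b u) = mul (pure_word [] (\<tau> + const (- ?c))) ?b"
    unfolding pure_word_add using product_add_left [OF closed(1,3) b'] product_const_left [OF b'] by simp
  also have "\<dots> = (\<lambda>u. 0)"
    using product_assoc [OF closed(4,2) b, symmetric] rel product_zero(1) [OF b] by simp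
  finally show ?thesis by (simp add: fun_eq_iff const_minus)
qed

end

text \<open>
  The relations determine the product: two products that agree when the left factor is a
  generator agree everywhere, by associativity.
\<close>

lemma smash_product_unique:
  assumes "smash_product m n q v mul" and a: "a \<in> carrier (tensors mul)" and b: "b \<in> carrier (tensors mul)"
  shows "mul a b = smash a b"
proof -
  note M = assms(1) and N = smash_product_smash
  let ?T = "standard_tableaux m n" and ?C = "carrier (tensors mul)"
  have C: "carrier (tensors smash) = ?C" by auto
  define D where "D = {a \<in> ?C. \<forall>b\<in>?C. mul a b = smash a b}"
  have D: "a \<in> D \<longleftrightarrow> a \<in> ?C \<and> (\<forall>b\<in>?C. mul a b = smash a b)" for a
    unfolding D_def by blast
  have D_mult: "mul a b \<in> D" if a: "a \<in> D" and b: "b \<in> D" for a b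
  proof -
    have aC: "a \<in> ?C" and bC: "b \<in> ?C" using a b unfolding D by blast+
    have eq: "mul a b = smash a b" using a bC unfolding D by blast
    have "mul (mul a b) c = smash (mul a b) c" if c: "c \<in> ?C" for c
    proof -
      have "mul (mul a b) c = mul a (mul b c)" by (rule product_assoc [OF M aC bC c])
      also have "\<dots> = smash a (mul b c)" using a product_closed [OF M bC c] unfolding D by blast
      also have "mul b c = smash b c" using b c unfolding D by blast
      also have "smash a (smash b c) = smash (mul a b) c" unfolding eq by (auto simp: smash_assoc)
      finally show ?thesis .
    qed
    then show ?thesis using product_closed [OF M aC bC] unfolding D by blast
  qed
  have D_add: "(\<lambda>u. a u + b u) \<in> D" if a: "a \<in> D" and b: "b \<in> D" for a b
  proof -
    have aC: "a \<in> ?C" and bC: "b \<in> ?C" using a b unfolding D by blast+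
    have "mul (\<lambda>u. a u + b u) c = smash (\<lambda>u. a u + b u) c" if c: "c \<in> ?C" for c
    proof -
      have "mul a c = smash a c" "mul b c = smash b c" using a b c unfolding D by blast+
      then show ?thesis unfolding product_add_left [OF M aC bC c] by (auto simp: smash_add_left)
    qed
    then show ?thesis using tensors_add_closed [OF aC bC] unfolding D by blast
  qed
  have D_zero: "(\<lambda>u. 0) \<in> D"
    using product_zero(1) [OF M] unfolding D by (auto simp: fun_eq_iff)
  have D_letter: "pure_word [X] 1 \<in> D" if X: "X \<in> ?T" for X
  proof -
    have cl: "pure_word [X] 1 \<in> ?C" using X by (intro pure_word_closed) simp_all
    have "mul (pure_word [X] 1) b = smash (pure_word [X] 1) b" if "b \<in> ?C" for b
      using that
    proof (induction rule: tensors_induct)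
      case zero
      show ?case using product_zero(2) [OF M cl] by (auto simp: fun_eq_iff)
    next
      case (word x \<phi>)
      then show ?case using product_word [OF M X] product_word [OF N X] by simp
    next
      case (add a b)
      then show ?case using product_add_right [OF M _ _ cl] product_add_right [OF N, unfolded C, OF _ _ cl] by simp
    qed
    with cl show ?thesis unfolding D by blast
  qed
  have D_const: "pure_word [] (const c) \<in> D" for c
  proof -
    have "pure_word [] (const c) \<in> ?C" by (rule pure_word_closed) simp_all
    moreover have "mul (pure_word [] (const c)) b = smash (pure_word [] (const c)) b" if "b \<in> ?C" for b
      using product_const_left [OF M that] product_const_left [OF N, unfolded C, OF that] by simp
    ultimately show ?thesis unfolding D by blast
  qed
  have D_gen: "pure_word [] (gen g) \<in> D" if g: "g \<in> hecke_gens n" for g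
  proof -
    have gk: "Poly_Mapping.keys (gen g :: _ \<Rightarrow>\<^sub>0 'k) \<subseteq> lists (hecke_gens n)" using g by simp
    have cl: "pure_word [] (gen g) \<in> ?C" using gk by (intro pure_word_closed) simp_all
    \<comment> \<open>At the empty word both products are multiplication of the free algebra; at
      longer words both obey the recursions \<open>product_tau\<close> and
      \<open>product_sigma\<close>.\<close>
    have words: "mul (pure_word [] (gen g)) (pure_word x \<phi>) = smash (pure_word [] (gen g)) (pure_word x \<phi>)"
      if "x \<in> lists ?T" and \<phi>: "Poly_Mapping.keys \<phi> \<subseteq> lists (hecke_gens n)" for x \<phi>
      using that(1)
    proof (induction x)
      case Nil
      then show ?case using product_coefficients [OF M gk \<phi>] product_coefficients [OF N gk \<phi>] by simp
    next
      case (Cons X x)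
      let ?x = "pure_word x \<phi>"
      have cl_x: "?x \<in> ?C" using Cons \<phi> by (intro pure_word_closed)
      have step: "pure_word (X # x) \<phi> = mul (pure_word [X] 1) ?x" "pure_word (X # x) \<phi> = smash (pure_word [X] 1) ?x"
        using product_word [OF M Cons.hyps(1,2) \<phi>] product_word [OF N Cons.hyps(1,2) \<phi>] by simp_all
      show ?case
      proof (cases g)
        case Tau
        show ?thesis
          using product_tau [OF M Cons.hyps(1) cl_x] product_tau [OF N Cons.hyps(1), unfolded C, OF cl_x]
          unfolding Tau step(1) [symmetric] step(2) [symmetric] by (rule trans [OF _ sym])
      next
        case (Sigma i)
        then have i: "i \<in> {1..n - 1}" using g by (auto simp: hecke_gens_def)
        let ?y = "\<lambda>u. mul (pure_word [] (gen g)) ?x u + const (exchange_coeff q v X (i + 1) i) * ?x u"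
        let ?t = "permute_tableau (transpose i (i + 1)) X"
        have y: "?y \<in> ?C"
          by (intro tensors_add_closed product_closed [OF M] cl cl_x tensors_scale_closed)
        have "mul (smash_tensor n (tableau_gen m n ?t) 1) ?y = smash (smash_tensor n (tableau_gen m n ?t) 1) ?y"
        proof (cases "?t \<in> ?T")
          case True
          then show ?thesis using D_letter [of ?t] y by (simp only: D tableau_gen_def if_True pure_tensor_gen)
        next
          case False
          then show ?thesis using product_zero(1) [OF M y] product_zero(1) [OF N, unfolded C, OF y]
            by (simp only: tableau_gen_def if_False pure_tensor_zero)
        qed
        then show ?thesis
          using product_sigma [OF M Cons.hyps(1) i cl_x] product_sigma [OF N Cons.hyps(1) i, unfolded C, OF cl_x]
            Cons.IH
          unfolding step(1) [symmetric] step(2) [symmetric] Sigma by (simp only: )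
      qed
    qed
    have "mul (pure_word [] (gen g)) b = smash (pure_word [] (gen g)) b" if "b \<in> ?C" for b
      using that
    proof (induction rule: tensors_induct)
      case zero
      show ?case using product_zero(2) [OF M cl] by (auto simp: fun_eq_iff)
    next
      case (add a b)
      then show ?case using product_add_right [OF M _ _ cl] product_add_right [OF N, unfolded C, OF _ _ cl] by simp
    qed (rule words)
    with cl show ?thesis unfolding D by blast
  qed
  have D_coefficient: "pure_word [] \<phi> \<in> D" if "Poly_Mapping.keys \<phi> \<subseteq> lists (hecke_gens n)" for \<phi>
    using that
  proof (induction \<phi> rule: poly_mapping_keys_induct)
    case zero
    have "pure_word ([] :: tableau list) (0 :: hecke_gen list \<Rightarrow>\<^sub>0 'k) = (\<lambda>u. 0)" by (auto simp: pure_word_def)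
    then show ?case using D_zero by simp
  next
    case (single h c)
    then show ?case
    proof (induction h)
      case Nil
      then show ?case using D_const [of c] by (simp add: const_def)
    next
      case (Cons g h)
      have "Poly_Mapping.keys (Poly_Mapping.single h c) \<subseteq> lists (hecke_gens n)" using Cons.hyps by auto
      then have "pure_word [] (Poly_Mapping.single (g # h) c) = mul (pure_word [] (gen g)) (pure_word [] (Poly_Mapping.single h c))"
        using product_coefficients [OF M] Cons.hyps by (simp add: single_Cons_eq_gen_mult)
      then show ?case using D_mult [OF D_gen] Cons by simp
    qed
  next
    case (add \<phi> \<psi>)
    then show ?case unfolding pure_word_add by (intro D_add)
  qed
  have "a \<in> D" using a
  proof (induction rule: tensors_induct)
    case (word x \<phi>)
    then show ?case
    proof (induction x)
      case Nil
      then show ?case using D_coefficient by blast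
    next
      case (Cons X x)
      then show ?case using D_mult [OF D_letter, of X "pure_word x \<phi>"] product_word [OF M, of X x \<phi>] by simp
    qed
  qed (intro D_zero D_add)+
  then show ?thesis using b D by blast
qed

end

section \<open>The induced product on the tensor product with the Hecke algebra\<close>

text \<open>Every axiom can be checked on images of elements of \<open>A\<close>, and by
  surjectivity there are no others. Applied to a product \<open>mul'\<close> on \<open>B\<close>
  that is known only through \<open>p\<close>.\<close>

lemma assoc_algebra_image:
  fixes A :: "('k::field, 'a) module" and B :: "('k, 'b) module"
  assumes A: "assoc_algebra scalars A" and surj: "p ` carrier A = carrier B"
    and mult: "\<And>x y. x \<in> carrier A \<Longrightarrow> y \<in> carrier A \<Longrightarrow> p (x \<otimes>\<^bsub>A\<^esub> y) = p x \<otimes>\<^bsub>B\<^esub> p y"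
    and add: "\<And>x y. x \<in> carrier A \<Longrightarrow> y \<in> carrier A \<Longrightarrow> p (x \<oplus>\<^bsub>A\<^esub> y) = p x \<oplus>\<^bsub>B\<^esub> p y"
    and smult: "\<And>c x. x \<in> carrier A \<Longrightarrow> p (c \<odot>\<^bsub>A\<^esub> x) = c \<odot>\<^bsub>B\<^esub> p x"
    and one: "p \<one>\<^bsub>A\<^esub> = \<one>\<^bsub>B\<^esub>" and zero: "p \<zero>\<^bsub>A\<^esub> = \<zero>\<^bsub>B\<^esub>"
  shows "assoc_algebra scalars B"
proof -
  interpret A: assoc_algebra "scalars :: 'k ring" A by (rule A)
  have closed: "p x \<in> carrier B" if "x \<in> carrier A" for x using surj that by blast
  have lift: thesis if "x \<in> carrier B" "\<And>a. a \<in> carrier A \<Longrightarrow> x = p a \<Longrightarrow> thesis" for x thesis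
    using surj that by blast
  note hom = mult [symmetric] add [symmetric] smult [symmetric] one [symmetric] zero [symmetric]
  have "ring B"
  proof (rule ringI)
    show "abelian_group B"
    proof (rule abelian_groupI)
      show "\<And>x y. x \<in> carrier B \<Longrightarrow> y \<in> carrier B \<Longrightarrow> x \<oplus>\<^bsub>B\<^esub> y \<in> carrier B"
        by (elim lift) (simp add: hom closed)
      show "\<And>x y z. x \<in> carrier B \<Longrightarrow> y \<in> carrier B \<Longrightarrow> z \<in> carrier B \<Longrightarrow>
          (x \<oplus>\<^bsub>B\<^esub> y) \<oplus>\<^bsub>B\<^esub> z = x \<oplus>\<^bsub>B\<^esub> (y \<oplus>\<^bsub>B\<^esub> z)"
        by (elim lift) (simp add: hom A.a_assoc)
      show "\<And>x y. x \<in> carrier B \<Longrightarrow> y \<in> carrier B \<Longrightarrow> x \<oplus>\<^bsub>B\<^esub> y = y \<oplus>\<^bsub>B\<^esub> x"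
        by (elim lift) (simp add: hom A.a_comm)
      show "\<And>x. x \<in> carrier B \<Longrightarrow> \<zero>\<^bsub>B\<^esub> \<oplus>\<^bsub>B\<^esub> x = x"
        by (elim lift) (simp add: hom)
      show "\<And>x. x \<in> carrier B \<Longrightarrow> \<exists>y\<in>carrier B. y \<oplus>\<^bsub>B\<^esub> x = \<zero>\<^bsub>B\<^esub>"
      proof (elim lift)
        fix x a assume "a \<in> carrier A" "x = p a"
        then show "\<exists>y\<in>carrier B. y \<oplus>\<^bsub>B\<^esub> x = \<zero>\<^bsub>B\<^esub>"
          by (intro bexI [of _ "p (\<ominus>\<^bsub>A\<^esub> a)"]) (simp_all add: hom closed A.l_neg)
      qed
    qed (simp add: hom closed)
    show "Group.monoid B"
    proof (rule monoidI)
      show "\<And>x y. x \<in> carrier B \<Longrightarrow> y \<in> carrier B \<Longrightarrow> x \<otimes>\<^bsub>B\<^esub> y \<in> carrier B"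
        by (elim lift) (simp add: hom closed)
      show "\<And>x y z. x \<in> carrier B \<Longrightarrow> y \<in> carrier B \<Longrightarrow> z \<in> carrier B \<Longrightarrow>
          (x \<otimes>\<^bsub>B\<^esub> y) \<otimes>\<^bsub>B\<^esub> z = x \<otimes>\<^bsub>B\<^esub> (y \<otimes>\<^bsub>B\<^esub> z)"
        by (elim lift) (simp add: hom A.m_assoc)
      show "\<And>x. x \<in> carrier B \<Longrightarrow> \<one>\<^bsub>B\<^esub> \<otimes>\<^bsub>B\<^esub> x = x" "\<And>x. x \<in> carrier B \<Longrightarrow> x \<otimes>\<^bsub>B\<^esub> \<one>\<^bsub>B\<^esub> = x"
        by (elim lift, simp add: hom)+
    qed (simp add: hom closed)
    show "\<And>x y z. x \<in> carrier B \<Longrightarrow> y \<in> carrier B \<Longrightarrow> z \<in> carrier B \<Longrightarrow>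
        (x \<oplus>\<^bsub>B\<^esub> y) \<otimes>\<^bsub>B\<^esub> z = x \<otimes>\<^bsub>B\<^esub> z \<oplus>\<^bsub>B\<^esub> y \<otimes>\<^bsub>B\<^esub> z"
      by (elim lift) (simp add: hom A.l_distr)
    show "\<And>x y z. x \<in> carrier B \<Longrightarrow> y \<in> carrier B \<Longrightarrow> z \<in> carrier B \<Longrightarrow>
        z \<otimes>\<^bsub>B\<^esub> (x \<oplus>\<^bsub>B\<^esub> y) = z \<otimes>\<^bsub>B\<^esub> x \<oplus>\<^bsub>B\<^esub> z \<otimes>\<^bsub>B\<^esub> y"
      by (elim lift) (simp add: hom A.r_distr)
  qed
  have sc: "c \<odot>\<^bsub>A\<^esub> x \<in> carrier A" if "x \<in> carrier A" for c x using A.smult_closed that by simp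
  show ?thesis
  proof (rule assoc_algebraI)
    show "ring B" by fact
    show "\<And>c x. x \<in> carrier B \<Longrightarrow> c \<odot>\<^bsub>B\<^esub> x \<in> carrier B"
      by (elim lift) (simp add: hom closed sc)
    show "\<And>c d x. x \<in> carrier B \<Longrightarrow> (c + d) \<odot>\<^bsub>B\<^esub> x = c \<odot>\<^bsub>B\<^esub> x \<oplus>\<^bsub>B\<^esub> d \<odot>\<^bsub>B\<^esub> x"
      using A.smult_l_distr by (elim lift) (simp add: hom sc)
    show "\<And>c x y. x \<in> carrier B \<Longrightarrow> y \<in> carrier B \<Longrightarrow> c \<odot>\<^bsub>B\<^esub> (x \<oplus>\<^bsub>B\<^esub> y) = c \<odot>\<^bsub>B\<^esub> x \<oplus>\<^bsub>B\<^esub> c \<odot>\<^bsub>B\<^esub> y"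
      using A.smult_r_distr by (elim lift) (simp add: hom sc)
    show "\<And>c d x. x \<in> carrier B \<Longrightarrow> (c * d) \<odot>\<^bsub>B\<^esub> x = c \<odot>\<^bsub>B\<^esub> (d \<odot>\<^bsub>B\<^esub> x)"
      using A.smult_assoc1 by (elim lift) (simp add: hom sc)
    show "\<And>x. x \<in> carrier B \<Longrightarrow> 1 \<odot>\<^bsub>B\<^esub> x = x"
      using A.smult_one by (elim lift) (simp add: hom sc)
    show "\<And>c x y. x \<in> carrier B \<Longrightarrow> y \<in> carrier B \<Longrightarrow> (c \<odot>\<^bsub>B\<^esub> x) \<otimes>\<^bsub>B\<^esub> y = c \<odot>\<^bsub>B\<^esub> (x \<otimes>\<^bsub>B\<^esub> y)"
      using A.smult_mult_left by (elim lift) (simp add: hom sc)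
    show "\<And>c x y. x \<in> carrier B \<Longrightarrow> y \<in> carrier B \<Longrightarrow> x \<otimes>\<^bsub>B\<^esub> (c \<odot>\<^bsub>B\<^esub> y) = c \<odot>\<^bsub>B\<^esub> (x \<otimes>\<^bsub>B\<^esub> y)"
      using A.smult_mult_right by (elim lift) (simp add: hom sc)
  qed
qed

text \<open>\<open>linear_combinations\<close> sums over an initial segment of the natural numbers,
  so \<open>K\<close> is enumerated first. The coefficients are all 1, the summands
  \<open>h Y\<close> already containing their scalars.\<close>

lemma (in closed_exchange_rules) sum_linear_combination:
  assumes ring: "ring (tensors mul)" and "finite K"
    and h: "\<And>Y. Y \<in> K \<Longrightarrow> h Y \<in> S" "\<And>Y. Y \<in> K \<Longrightarrow> h Y \<in> carrier (tensors mul)"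
  shows "(\<lambda>u. \<Sum>Y\<in>K. h Y u) \<in> linear_combinations (tensors mul) S"
proof -
  interpret R: ring "tensors mul" by (rule ring)
  obtain e where e: "bij_betw e {..<card K} K"
    using ex_bij_betw_nat_finite [OF \<open>finite K\<close>] by (auto simp: atLeast0LessThan)
  have eK: "e j \<in> K" if "j < card K" for j using bij_betwE [OF e] that by blast
  let ?s = "\<lambda>j. 1 \<odot>\<^bsub>tensors mul\<^esub> h (e j)"
  have s: "?s j = h (e j)" for j by simp
  have "finsum (tensors mul) ?s {..<N} = (\<lambda>u. \<Sum>j<N. h (e j) u)" if "N \<le> card K" for N
    using that
  proof (induction N)
    case 0
    then show ?case by simp
  next
    case (Suc N)
    have "finsum (tensors mul) ?s (insert N {..<N}) = ?s N \<oplus>\<^bsub>tensors mul\<^esub> finsum (tensors mul) ?s {..<N}"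
      unfolding s
      by (rule R.finsum_insert) (use Suc.prems in \<open>auto simp del: tensor_algebra_free_simps(1) intro!: h(2) eK\<close>)
    then show ?case
      using Suc unfolding s lessThan_Suc by (simp add: Suc_le_eq)
  qed
  from this [of "card K"] have "finsum (tensors mul) ?s {..<card K} = (\<lambda>u. \<Sum>Y\<in>K. h Y u)"
    by (simp add: sum.reindex_bij_betw [OF e, of "\<lambda>Y. h Y _"])
  moreover have "\<forall>j<card K. h (e j) \<in> S" using eK h(1) by blast
  ultimately show ?thesis
    unfolding linear_combinations_def mem_Collect_eq
    by (intro exI [of _ "card K"] exI [of _ "\<lambda>_. 1"] exI [of _ "\<lambda>j. h (e j)"]) simp
qed

section \<open>Support and values of a relation applied to a letter\<close>

context hecke_parameters
begin

lemma move_move [simp]: "move g (move g Y) = Y"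
  by (cases g) simp_all

text \<open>A nonzero value at \<open>[Y]\<close> stems from a value at \<open>Y\<close> or at its
  exchange. Since exchanges are involutions, each generator at most composes the permutation with a
  transposition.\<close>

lemma act_orbit:
  assumes "Poly_Mapping.keys \<phi> \<subseteq> lists (hecke_gens n)"
    and f: "\<And>u. f u \<noteq> 0 \<Longrightarrow> \<exists>\<pi>. \<pi> permutes {1..n} \<and> u = [permute_tableau \<pi> X]"
    and "act \<phi> f w \<noteq> 0"
  shows "\<exists>\<pi>. \<pi> permutes {1..n} \<and> w = [permute_tableau \<pi> X]"
proof -
  define orbit where "orbit f \<longleftrightarrow> (\<forall>u. f u \<noteq> 0 \<longrightarrow> (\<exists>\<pi>. \<pi> permutes {1..n} \<and> u = [permute_tableau \<pi> X]))"
    for f :: "tableau list \<Rightarrow> hecke_gen list \<Rightarrow>\<^sub>0 'k"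
  have gen: "orbit (gen_act g f)" if g: "g \<in> hecke_gens n" and f: "orbit f" for g f
    unfolding orbit_def
  proof (intro allI impI)
    fix w assume w: "gen_act g f w \<noteq> 0"
    have "length w = 1"
    proof (rule ccontr)
      assume "length w \<noteq> 1"
      then have "act (gen g) f w = 0"
        using f by (intro act_length) (force simp: orbit_def)
      then show False using w by simp
    qed
    then obtain Y where Y: "w = [Y]" by (auto simp: length_Suc_conv)
    have "f [move g Y] \<noteq> 0 \<or> f [Y] \<noteq> 0"
      using w unfolding Y by auto
    then show "\<exists>\<pi>. \<pi> permutes {1..n} \<and> w = [permute_tableau \<pi> X]"
    proof
      assume "f [Y] \<noteq> 0"
      then show ?thesis using f unfolding Y orbit_def by blast
    next
      assume "f [move g Y] \<noteq> 0"
      then obtain \<pi> where \<pi>: "\<pi> permutes {1..n}" "move g Y = permute_tableau \<pi> X"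
        using f unfolding orbit_def by blast
      then have eq: "Y = move g (permute_tableau \<pi> X)" using move_move by metis
      show ?thesis
      proof (cases g)
        case Tau
        then show ?thesis using \<pi>(1) eq unfolding Y by auto
      next
        case (Sigma i)
        then have "transpose i (i + 1) permutes {1..n}"
          using g by (intro permutes_swap_id) (auto simp: hecke_gens_def)
        then have "transpose i (i + 1) \<circ> \<pi> permutes {1..n}"
          by (rule permutes_compose [OF \<pi>(1)])
        then show ?thesis
          using eq Sigma unfolding Y by (auto simp: permute_permute_tableau)
      qed
    qed
  qed
  have "orbit (foldr gen_act h f)" if "h \<in> lists (hecke_gens n)" for h
    using that f by (induction h) (simp_all add: gen, simp add: orbit_def)
  moreover have "\<exists>h\<in>Poly_Mapping.keys \<phi>. foldr gen_act h f w \<noteq> 0"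
  proof (rule ccontr)
    assume "\<not> (\<exists>h\<in>Poly_Mapping.keys \<phi>. foldr gen_act h f w \<noteq> 0)"
    then show False using assms(3) by (simp add: act_def)
  qed
  ultimately show ?thesis using assms(1) unfolding orbit_def by blast
qed

text \<open>By uniqueness the product is \<open>act r\<close> on the word \<open>[X]\<close>. Its
  values lie in \<open>I\<close> by \<open>act_ideal_mem\<close>, and \<open>act_orbit\<close>
  places its support on permuted copies of \<open>X\<close>.\<close>

lemma relation_linear_combination:
  assumes mul: "smash_product m n q v mul" and r: "r \<in> hecke_relations m n q v"
    and X: "X \<in> standard_tableaux m n"
  shows "mul (smash_tensor n 1 r) (smash_tensor n (tableau_gen m n X) 1) \<in>
    linear_combinations (smash_algebra m n mul)
      {smash_tensor n (tableau_gen m n (permute_tableau \<pi> X)) r' | \<pi> r'. \<pi> permutes {1..n} \<and> r' \<in> I}"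
    (is "_ \<in> linear_combinations _ ?S")
proof -
  let ?T = "standard_tableaux m n" and ?f = "act r (pure_word [X] 1)"
  have rI: "r \<in> I" by (rule I_relation [OF r])
  have one: "pure_word [X] 1 \<in> carrier (tensors mul)" using X by (intro pure_word_closed) simp_all
  have rc: "pure_word [] r \<in> carrier (tensors mul)" using I_subset [OF rI] by (intro pure_word_closed) simp_all
  have "mul (smash_tensor n 1 r) (smash_tensor n (tableau_gen m n X) 1) = mul (pure_word [] r) (pure_word [X] 1)"
    using X by (simp add: pure_tensor_one tableau_gen_def pure_tensor_gen)
  also have "\<dots> = ?f"
    using smash_product_unique [OF mul rc one] by (simp add: smash_pure_word_Nil)
  finally have eq: "mul (smash_tensor n 1 r) (smash_tensor n (tableau_gen m n X) 1) = ?f" .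
  \<comment> \<open>Restricting to standard \<open>Y\<close> makes each
    \<open>tableau_gen m n Y\<close> below a generator rather than 0.\<close>
  define K where "K = {Y \<in> ?T. ?f [Y] \<noteq> 0}"
  have finK: "finite K" unfolding K_def using finite_standard_tableaux by simp
  have mem: "?f w \<in> I" if "w \<in> lists ?T" for w
    by (rule act_ideal_mem [OF rI _ that]) (simp add: pure_word_def)
  have orbit: "\<exists>\<pi>. \<pi> permutes {1..n} \<and> w = [permute_tableau \<pi> X]" if "?f w \<noteq> 0" for w
  proof (rule act_orbit [OF I_subset [OF rI] _ that])
    fix u assume "pure_word [X] 1 u \<noteq> (0 :: hecke_gen list \<Rightarrow>\<^sub>0 'k)"
    then have "u = [permute_tableau id X]" by (simp add: pure_word_def split: if_splits)
    then show "\<exists>\<pi>. \<pi> permutes {1..n} \<and> u = [permute_tableau \<pi> X]" using permutes_id by blast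
  qed
  have supp: "w \<in> (\<lambda>Y. [Y]) ` K" if "?f w \<noteq> 0" for w
  proof -
    have "w \<in> lists ?T"
    proof (rule ccontr)
      assume "w \<notin> lists ?T"
      then have "?f w = 0"
        using X by (intro act_support [OF I_subset [OF rI]]) (auto simp: pure_word_def)
      then show False using that by simp
    qed
    then show ?thesis using orbit [OF that] that by (auto simp: K_def)
  qed
  have "?f = (\<lambda>w. \<Sum>Y\<in>K. pure_word [Y] (?f [Y]) w)"
  proof
    fix w
    show "?f w = (\<Sum>Y\<in>K. pure_word [Y] (?f [Y]) w)"
    proof (cases "w \<in> (\<lambda>Y. [Y]) ` K")
      case True
      then obtain Y where Y: "Y \<in> K" "w = [Y]" by blast
      then have "(\<Sum>Z\<in>K. pure_word [Z] (?f [Z]) w) = (\<Sum>Z\<in>K. if Z = Y then ?f [Y] else 0)"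
        by (intro sum.cong) (auto simp: pure_word_def)
      then show ?thesis using Y finK by simp
    next
      case False
      then have "(\<Sum>Y\<in>K. pure_word [Y] (?f [Y]) w) = 0"
        by (intro sum.neutral) (auto simp: pure_word_def)
      then show ?thesis using supp False by fastforce
    qed
  qed
  moreover have "(\<lambda>w. \<Sum>Y\<in>K. pure_word [Y] (?f [Y]) w) \<in> linear_combinations (tensors mul) ?S"
  proof (rule sum_linear_combination [OF product_ring [OF mul] finK])
    fix Y assume Y: "Y \<in> K"
    then have YT: "Y \<in> ?T" and I: "?f [Y] \<in> I" using mem [of "[Y]"] by (auto simp: K_def)
    obtain \<pi> where \<pi>: "\<pi> permutes {1..n}" "Y = permute_tableau \<pi> X"
      using orbit [of "[Y]"] Y by (auto simp: K_def)
    have "pure_word [Y] (?f [Y]) = smash_tensor n (tableau_gen m n Y) (?f [Y])"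
      using YT by (simp add: tableau_gen_def pure_tensor_gen)
    then show "pure_word [Y] (?f [Y]) \<in> ?S" using \<pi> I by blast
    show "pure_word [Y] (?f [Y]) \<in> carrier (tensors mul)"
      using YT I_subset [OF I] by (intro pure_word_closed) simp_all
  qed
  ultimately show ?thesis unfolding eq by simp
qed

end

section \<open>Cosets of the Hecke ideal and well-definedness\<close>

context hecke_parameters
begin

lemma coset_eq: "I +>\<^bsub>F\<^esub> p = (\<lambda>h. h + p) ` I"
  by (auto simp: a_r_coset_def r_coset_def)

lemma coset_eq_iff: "I +>\<^bsub>F\<^esub> p = I +>\<^bsub>F\<^esub> r \<longleftrightarrow> p - r \<in> I"
proof
  assume "I +>\<^bsub>F\<^esub> p = I +>\<^bsub>F\<^esub> r"
  moreover have "p \<in> I +>\<^bsub>F\<^esub> p" unfolding coset_eq using I_zero by force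
  ultimately show "p - r \<in> I" unfolding coset_eq by auto
next
  have sub: "I +>\<^bsub>F\<^esub> p \<subseteq> I +>\<^bsub>F\<^esub> r" if "p - r \<in> I" for p r
    unfolding coset_eq
  proof clarify
    fix h assume "h \<in> I"
    then have "h + (p - r) \<in> I" using that by (rule I_add)
    moreover have "h + p = h + (p - r) + r" by simp
    ultimately show "h + p \<in> (\<lambda>h. h + r) ` I" by (rule rev_image_eqI)
  qed
  assume "p - r \<in> I"
  then show "I +>\<^bsub>F\<^esub> p = I +>\<^bsub>F\<^esub> r"
    using sub [of p r] sub [of r p] I_minus [of "p - r"] by auto
qed

lemma coset_zero: "I +>\<^bsub>F\<^esub> 0 = I"
  by (simp add: coset_eq)

lemma hecke_algebra_simps:
  "carrier (hecke_algebra m n q v) = (\<lambda>p. I +>\<^bsub>F\<^esub> p) ` carrier F"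
  "\<zero>\<^bsub>hecke_algebra m n q v\<^esub> = I"
  "\<one>\<^bsub>hecke_algebra m n q v\<^esub> = I +>\<^bsub>F\<^esub> 1"
  "p \<in> carrier F \<Longrightarrow> r \<in> carrier F \<Longrightarrow>
     (I +>\<^bsub>F\<^esub> p) \<oplus>\<^bsub>hecke_algebra m n q v\<^esub> (I +>\<^bsub>F\<^esub> r) = I +>\<^bsub>F\<^esub> (p + r)"
proof -
  note defs = hecke_algebra_def quotient_algebra_def ring.extend_def module.fields_def FactRing_def
  show "carrier (hecke_algebra m n q v) = (\<lambda>p. I +>\<^bsub>F\<^esub> p) ` carrier F"
    by (auto simp: defs A_RCOSETS_def RCOSETS_def a_r_coset_def)
  show "\<zero>\<^bsub>hecke_algebra m n q v\<^esub> = I" "\<one>\<^bsub>hecke_algebra m n q v\<^esub> = I +>\<^bsub>F\<^esub> 1"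
    by (simp_all add: defs)
  assume "p \<in> carrier F" "r \<in> carrier F"
  from ring_hom_add [OF ideal.rcos_ring_hom [OF ideal_I] this]
  show "(I +>\<^bsub>F\<^esub> p) \<oplus>\<^bsub>hecke_algebra m n q v\<^esub> (I +>\<^bsub>F\<^esub> r) = I +>\<^bsub>F\<^esub> (p + r)"
    by (simp add: defs)
qed

text \<open>\<open>quotient_algebra\<close> takes a union over all representatives; it collapses to
  one coset because \<open>I\<close> is closed under scalars.\<close>

lemma hecke_algebra_smult: "c \<odot>\<^bsub>hecke_algebra m n q v\<^esub> (I +>\<^bsub>F\<^esub> p) = I +>\<^bsub>F\<^esub> (const c * p)"
proof -
  have "I +>\<^bsub>F\<^esub> (const c * x) = I +>\<^bsub>F\<^esub> (const c * p)" if "x \<in> I +>\<^bsub>F\<^esub> p" for x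
    unfolding coset_eq_iff using that by (auto simp: coset_eq distrib_left I_scale)
  moreover have "p \<in> I +>\<^bsub>F\<^esub> p" unfolding coset_eq using I_zero by force
  ultimately have "(\<Union>x\<in>I +>\<^bsub>F\<^esub> p. I +>\<^bsub>F\<^esub> (const c * x)) = I +>\<^bsub>F\<^esub> (const c * p)" by blast
  then show ?thesis
    by (simp add: hecke_algebra_def quotient_algebra_def ring.extend_def module.fields_def)
qed

abbreviation "projection \<equiv> smash_projection m n q v"

abbreviation "hecke_tensors mul \<equiv> tensor_algebra (standard_tableaux m n) (hecke_algebra m n q v) mul"

lemma projection_apply: "projection f u = I +>\<^bsub>F\<^esub> f u"
  by (simp add: smash_projection_def)

lemma projection_eq_iff: "projection f = projection g \<longleftrightarrow> (\<forall>u. f u - g u \<in> I)"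
  by (simp add: fun_eq_iff projection_apply coset_eq_iff)

lemma projection_image: "projection ` carrier (tensors mul) = carrier (hecke_tensors mul')"
proof (intro equalityI subsetI)
  fix g assume "g \<in> projection ` carrier (tensors mul)"
  then obtain f where f: "f \<in> carrier (tensors mul)" and g: "g = projection f" by blast
  have "{u. projection f u \<noteq> I} \<subseteq> {u. f u \<noteq> 0}"
    by (auto simp: projection_apply coset_zero)
  then have "finite {u. projection f u \<noteq> I}"
    by (rule finite_subset) (use f in simp)
  then show "g \<in> carrier (hecke_tensors mul')"
    using f unfolding g by (auto simp: tensor_algebra_def hecke_algebra_simps projection_apply coset_zero)
next
  fix g assume "g \<in> carrier (hecke_tensors mul')"
  then have g: "\<And>u. g u \<in> (\<lambda>p. I +>\<^bsub>F\<^esub> p) ` carrier F" "\<And>u. u \<notin> lists (standard_tableaux m n) \<Longrightarrow> g u = I"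
      "finite {u. g u \<noteq> I}"
    by (auto simp: tensor_algebra_def hecke_algebra_simps)
  then have "\<forall>u. \<exists>p. p \<in> carrier F \<and> g u = I +>\<^bsub>F\<^esub> p" by blast
  then obtain p where p: "\<And>u. p u \<in> carrier F" "\<And>u. g u = I +>\<^bsub>F\<^esub> p u" by metis
  \<comment> \<open>Choosing 0 for the zero class keeps the support finite; arbitrary
    representatives might be nonzero at infinitely many words.\<close>
  let ?f = "\<lambda>u. if g u = I then 0 else p u"
  have "{u. ?f u \<noteq> 0} \<subseteq> {u. g u \<noteq> I}" by auto
  then have "finite {u. ?f u \<noteq> 0}" using g(3) by (rule finite_subset)
  then have "?f \<in> carrier (tensors mul)" using p(1) g(2) by simp
  moreover have "g = projection ?f"
    using p(2) by (auto simp: fun_eq_iff projection_apply coset_zero)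
  ultimately show "g \<in> projection ` carrier (tensors mul)" by blast
qed

text \<open>The coefficients of \<open>a\<close> have to cross the letters of \<open>b\<close> and
  remain in \<open>I\<close> by \<open>act_ideal_mem\<close>; this is where compatibility with the
  relations enters the quotient.\<close>

lemma smash_ideal_left:
  assumes "\<And>u. a u \<in> I" "\<And>u. Poly_Mapping.keys (b u) \<subseteq> lists (hecke_gens n)" "w \<in> lists (standard_tableaux m n)"
  shows "smash a b w \<in> I"
  using assms(1,3)
proof (induction w arbitrary: a)
  case (Cons Y w)
  have "act (a []) b (Y # w) \<in> I" using Cons.prems assms(2) by (intro act_ideal_mem)
  moreover have "smash (\<lambda>u. a (Y # u)) b w \<in> I" using Cons by auto
  ultimately show ?case by (simp add: I_add)
qed (simp add: I_right assms(2))

lemma projection_smash_cong: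
  assumes f: "f \<in> carrier (tensors mul)" "f' \<in> carrier (tensors mul)"
    and g: "g \<in> carrier (tensors mul)" "g' \<in> carrier (tensors mul)"
    and eq: "projection f = projection f'" "projection g = projection g'"
  shows "projection (smash f g) = projection (smash f' g')"
  unfolding projection_eq_iff
proof
  fix w
  have keys: "Poly_Mapping.keys (h u) \<subseteq> lists (hecke_gens n)" and supp: "u \<notin> lists (standard_tableaux m n) \<Longrightarrow> h u = 0"
    if "h \<in> carrier (tensors mul)" for h u
    using that by simp_all
  show "smash f g w - smash f' g' w \<in> I"
  proof (cases "w \<in> lists (standard_tableaux m n)")
    case True
    have left: "smash (\<lambda>u. f u - f' u) g w \<in> I"
      using eq(1) keys [OF g(1)] True unfolding projection_eq_iff by (intro smash_ideal_left) blast+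
    have right: "smash f' (\<lambda>u. g u - g' u) w \<in> I"
      using eq(2) keys [OF f(2)] True unfolding projection_eq_iff
      by (intro smash_mem [OF I_zero I_add I_left]) blast+
    \<comment> \<open>Replace \<open>f\<close> by \<open>f'\<close> beside \<open>g\<close>, then
      \<open>g\<close> by \<open>g'\<close> beside \<open>f'\<close>.\<close>
    have "smash f g w - smash f' g' w = smash (\<lambda>u. f u - f' u) g w + smash f' (\<lambda>u. g u - g' u) w"
      using smash_add_left [of "\<lambda>u. f u - f' u" f' g w] smash_add_right [of f' "\<lambda>u. g u - g' u" g' w] by simp
    then show ?thesis using I_add [OF left right] by simp
  next
    case False
    then have "smash f g w = 0" "smash f' g' w = 0"
      using smash_support [of f g w, OF keys [OF f(1)] supp [OF f(1)] supp [OF g(1)]]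
        smash_support [of f' g' w, OF keys [OF f(2)] supp [OF f(2)] supp [OF g(2)]] by blast+
    then show ?thesis by (simp add: I_zero)
  qed
qed

lemma induced_product:
  assumes mul: "smash_product m n q v mul"
  shows "\<exists>mul'. assoc_algebra scalars (hecke_tensors mul') \<and> projection \<in> ring_hom (smash_algebra m n mul) (hecke_tensors mul')"
proof -
  let ?C = "carrier (tensors mul)"
  \<comment> \<open>Classes are multiplied through representatives chosen by \<open>SOME\<close>.
    The choice is immaterial by \<open>projection_smash_cong\<close>, since \<open>mul\<close>
    agrees with \<open>smash\<close> on the carrier.\<close>
  define lift where "lift g = (SOME f. f \<in> ?C \<and> projection f = g)" for g
  define mul' where "mul' g h = projection (mul (lift g) (lift h))" for g h
  have lift: "lift (projection f) \<in> ?C" "projection (lift (projection f)) = projection f" if "f \<in> ?C" for f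
    using someI [of "\<lambda>f'. f' \<in> ?C \<and> projection f' = projection f" f] that unfolding lift_def by blast+
  have keys: "h u \<in> carrier F" if "h \<in> ?C" for h u using that by simp
  have hom_mult: "projection (mul f g) = mul' (projection f) (projection g)" if "f \<in> ?C" "g \<in> ?C" for f g
  proof -
    have "mul f g = smash f g" "mul (lift (projection f)) (lift (projection g)) = smash (lift (projection f)) (lift (projection g))"
      by (intro smash_product_unique [OF mul] that lift)+
    then show ?thesis
      unfolding mul'_def using projection_smash_cong [of f mul "lift (projection f)" g "lift (projection g)"] that lift by simp
  qed
  have hom_add: "projection (\<lambda>u. f u + g u) = projection f \<oplus>\<^bsub>hecke_tensors mul'\<^esub> projection g"
    if "f \<in> ?C" "g \<in> ?C" for f g
    using that [THEN keys] by (simp add: tensor_algebra_def projection_apply fun_eq_iff hecke_algebra_simps)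
  have hom_smult: "projection (\<lambda>u. const c * f u) = c \<odot>\<^bsub>hecke_tensors mul'\<^esub> projection f" for c f
    by (simp add: tensor_algebra_def projection_apply fun_eq_iff hecke_algebra_smult)
  have hom_one: "projection (pure_word [] 1) = \<one>\<^bsub>hecke_tensors mul'\<^esub>"
    by (auto simp: tensor_algebra_def pure_tensor_def projection_apply fun_eq_iff hecke_algebra_simps(3)
        hecke_algebra_smult pure_word_def lookup_one when_def zero_list_def)
  have hom_zero: "projection (\<lambda>u. 0) = \<zero>\<^bsub>hecke_tensors mul'\<^esub>"
    by (simp add: tensor_algebra_def projection_apply fun_eq_iff hecke_algebra_simps(2) coset_zero)
  have mult': "mul' g h = g \<otimes>\<^bsub>hecke_tensors mul'\<^esub> h" for g h by (simp add: tensor_algebra_def)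
  have "assoc_algebra scalars (tensors mul)" using mul unfolding smash_product_def by blast
  then have "assoc_algebra scalars (hecke_tensors mul')"
    by (rule assoc_algebra_image [where p = projection, OF _ projection_image])
      (simp_all only: tensor_algebra_free_simps(2-6) hom_mult hom_add hom_smult hom_one hom_zero mult')
  moreover have "projection \<in> ring_hom (smash_algebra m n mul) (hecke_tensors mul')"
  proof (rule ring_hom_memI)
    show "projection f \<in> carrier (hecke_tensors mul')" if "f \<in> ?C" for f
      using projection_image [of mul mul'] that by blast
  qed (simp_all only: tensor_algebra_free_simps(2-6) hom_mult hom_add hom_one mult')
  ultimately show ?thesis by blast
qed

end

theorem proposition8:
  fixes m n :: nat and q :: "'k::field" and v :: "nat \<Rightarrow> 'k"
  assumes "m \<ge> 1" and "n \<ge> 1"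
    and "admissible_parameters m n q v"
  shows "(\<exists>mul. smash_product m n q v mul) \<and>
    (\<forall>mul. smash_product m n q v mul \<longrightarrow>
      (\<forall>r\<in>hecke_relations m n q v. \<forall>X\<in>standard_tableaux m n.
         mul (smash_tensor n 1 r) (smash_tensor n (tableau_gen m n X) 1) \<in>
           linear_combinations (smash_algebra m n mul)
             {smash_tensor n (tableau_gen m n (permute_tableau \<pi> X)) r' | \<pi> r'.
                \<pi> permutes {1..n} \<and> r' \<in> hecke_ideal m n q v}) \<and>
      (\<exists>mul'. assoc_algebra (scalars :: 'k ring)
           (tensor_algebra (standard_tableaux m n) (hecke_algebra m n q v) mul') \<and>
         smash_projection m n q v \<in>
           ring_hom (smash_algebra m n mul)
             (tensor_algebra (standard_tableaux m n) (hecke_algebra m n q v) mul')))"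
proof -
  interpret hecke_parameters m n q v by unfold_locales (rule assms)+
  show ?thesis
    using smash_product_smash relation_linear_combination induced_product by blast
qed

end
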